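(* Let $L$ be a Dirac structure on a smooth manifold $M$, let $P$ be a pre-symplectic leaf of $L$, let $m_0\in P$, and let $Q$ be a submanifold of $M$ containing $m_0$ and transversal to $P$ at $m_0$ in the sense that $T_{m_0}M=T_{m_0}P\oplus T_{m_0}Q$. Then $L$ induces a Poisson structure $\Pi_Q$ on a neighborhood of $m_0$ in $Q$ (that is, on such a neighborhood the induced family $L_Q$ is a Dirac structure which is the graph of a Poisson bivector field $\Pi_Q$), and $\Pi_Q(m_0)=0$.
   Context: On $TM\oplus T^*M$ consider the symmetric pairing $\langle (X_1,\alpha_1),(X_2,\alpha_2)\rangle=\frac12(i_{X_2}\alpha_1+i_{X_1}\alpha_2)$, and on $\Gamma(TM\oplus T^*M)$ the Courant bracket $[(X_1,\alpha_1),(X_2,\alpha_2)]=([X_1,X_2],\ \mathcal L_{X_1}\alpha_2-i_{X_2}d\alpha_1)$. A Dirac structure on $M$ is a smooth vector subbundle $L\subset TM\oplus T^*M$ that is maximal isotropic for $\langle\cdot,\cdot\rangle$ and such that $\Gamma(L)$ is closed under the Courant bracket. The distribution $(\mathcal D_L)_x=pr_1(L_x)\subset T_xM$ integrates to a singular foliation, whose leaves are the pre-symplectic leaves of $L$. Induced structure: for a submanifold $Q\subset M$ and $q\in Q$, $(L_Q)_q=\dfrac{L_q\cap(T_qQ\oplus T_q^*M)}{L_q\cap(\{0\}\oplus T_qQ^\circ)}$, where $T_qQ^\circ=\{v\in T_q^*M: v|_{T_qQ}=0\}$; via $(u,v)\mapsto(u,v|_{T_qQ})$ it is identified with the subspace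 $\{(u,v|_{T_qQ}) : (u,v)\in L_q,\ u\in T_qQ\}$ of $T_qQ\oplus T_q^*Q$. The graph of a bivector field $\pi$ is $L_\pi=\{(\pi^\sharp\alpha,\alpha)\}$, with $\beta(\pi^\sharp\alpha)=\pi(\alpha,\beta)$; $\pi$ is Poisson if its Schouten bracket $[\pi,\pi]$ vanishes. *)

theory Defs
  imports "HOL-Analysis.Analysis"
begin

text \<open>
  Manifolds are modelled on finite-dimensional spaces of class \<open>real_inner\<close>, i.e. Euclidean
  spaces, and not on types of class \<open>euclidean_space\<close>, because the latter exclude dimension 0:
  leaves and transversals may be points. The following instance shows that dimension 0 is really
  available.
\<close>

instantiation unit :: real_inner
begin
definition zero_unit :: unit where "zero_unit = ()"
definition plus_unit :: "unit \<Rightarrow> unit \<Rightarrow> unit" where "plus_unit x y = ()"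
definition scaleR_unit :: "real \<Rightarrow> unit \<Rightarrow> unit" where "scaleR_unit r x = ()"
definition sgn_unit :: "unit \<Rightarrow> unit" where "sgn_unit x = ()"
definition norm_unit :: "unit \<Rightarrow> real" where "norm_unit x = 0"
definition dist_unit :: "unit \<Rightarrow> unit \<Rightarrow> real" where "dist_unit x y = 0"
definition inner_unit :: "unit \<Rightarrow> unit \<Rightarrow> real" where "inner_unit x y = 0"
definition uniformity_unit :: "(unit \<times> unit) filter"
  where "uniformity_unit = (INF e\<in>{0<..}. principal {(x, y). dist x y < e})"
definition open_unit :: "unit set \<Rightarrow> bool"
  where "open_unit U \<longleftrightarrow> (\<forall>x\<in>U. \<forall>\<^sub>F (x', y) in uniformity. x' = x \<longrightarrow> y \<in> U)"
instance
  by standard (simp_all add: norm_unit_def dist_unit_def inner_unit_def uniformity_unit_def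
    open_unit_def case_prod_beta')
end


section \<open>Smooth maps between open subsets of Euclidean spaces\<close>

definition finite_dim :: "'a::real_vector itself \<Rightarrow> bool"
  where "finite_dim _ \<longleftrightarrow> (\<exists>B::'a set. finite B \<and> span B = UNIV)"

text \<open>\<open>Ck_on k S f\<close> is \<open>C^k\<close> regularity; intended for open \<open>S\<close> and finite-dimensional domains,
  where it suffices to iterate directional derivatives.\<close>

primrec Ck_on :: "nat \<Rightarrow> 'a::real_normed_vector set \<Rightarrow> ('a \<Rightarrow> 'b::real_normed_vector) \<Rightarrow> bool" where
  "Ck_on 0 S f \<longleftrightarrow> continuous_on S f"
| "Ck_on (Suc k) S f \<longleftrightarrow> (\<forall>x\<in>S. f differentiable (at x)) \<and>
     (\<forall>v. Ck_on k S (\<lambda>x. frechet_derivative f (at x) v))"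

definition smooth_on :: "'a::real_normed_vector set \<Rightarrow> ('a \<Rightarrow> 'b::real_normed_vector) \<Rightarrow> bool"
  where "smooth_on S f \<longleftrightarrow> (\<forall>k. Ck_on k S f)"


section \<open>Smooth manifolds\<close>

type_synonym ('a, 'm) chart = "'a set \<times> ('a \<Rightarrow> 'm)"

text \<open>The topology is part of the structure, so that an immersed submanifold may carry a finer
  topology than the ambient manifold. The atlas need not be maximal.\<close>

record ('a, 'm) mfd =
  mtop :: "'a topology"
  atlas :: "('a, 'm) chart set"

definition cinv :: "('a, 'm) chart \<Rightarrow> 'm \<Rightarrow> 'a"
  where "cinv c = inv_into (fst c) (snd c)"

definition smooth_manifold :: "('a, 'm::real_inner) mfd \<Rightarrow> bool"
  where "smooth_manifold M \<longleftrightarrow>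
    finite_dim TYPE('m) \<and>
    Hausdorff_space (mtop M) \<and> second_countable (mtop M) \<and>
    (\<Union>c\<in>atlas M. fst c) = topspace (mtop M) \<and>
    (\<forall>c\<in>atlas M. openin (mtop M) (fst c) \<and> open (snd c ` fst c) \<and>
       homeomorphic_map (subtopology (mtop M) (fst c)) (top_of_set (snd c ` fst c)) (snd c)) \<and>
    (\<forall>c\<in>atlas M. \<forall>d\<in>atlas M. smooth_on (snd c ` (fst c \<inter> fst d)) (snd d \<circ> cinv c))"

definition smooth_map ::
  "('a, 'm::real_inner) mfd \<Rightarrow> ('b, 'n::real_inner) mfd \<Rightarrow> ('a \<Rightarrow> 'b) \<Rightarrow> bool"
  where "smooth_map M N f \<longleftrightarrow> continuous_map (mtop M) (mtop N) f \<and>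
    (\<forall>c\<in>atlas M. \<forall>d\<in>atlas N.
       smooth_on (snd c ` (fst c \<inter> f -` fst d)) (snd d \<circ> f \<circ> cinv c))"

text \<open>
  Tangent vectors at \<open>x\<close> are represented by their coordinates in a chosen chart \<open>chart_at M x\<close>
  around \<open>x\<close>. Thus every tangent space is the whole model type \<open>'m\<close>, every cotangent space is
  its dual \<open>'m \<Rightarrow>\<^sub>L real\<close>, and a vector field is a function \<open>'a \<Rightarrow> 'm\<close>. Since the chosen chart
  varies with \<open>x\<close>, such functions must be transported to a fixed chart (by \<open>tchart\<close>) before
  being differentiated.
\<close>

definition chart_at :: "('a, 'm) mfd \<Rightarrow> 'a \<Rightarrow> ('a, 'm) chart"
  where "chart_at M x = (SOME c. c \<in> atlas M \<and> x \<in> fst c)"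

definition coord_at :: "('a, 'm) mfd \<Rightarrow> 'a \<Rightarrow> 'm"
  where "coord_at M x = snd (chart_at M x) x"

text \<open>\<open>tchart M c x v\<close> are the coordinates in the chart \<open>c\<close> of the tangent vector \<open>v\<close> at \<open>x\<close>.\<close>

definition tchart :: "('a, 'm::real_inner) mfd \<Rightarrow> ('a, 'm) chart \<Rightarrow> 'a \<Rightarrow> 'm \<Rightarrow> 'm"
  where "tchart M c x = frechet_derivative (snd c \<circ> cinv (chart_at M x)) (at (coord_at M x))"

definition tmap :: "('a, 'm::real_inner) mfd \<Rightarrow> ('b, 'n::real_inner) mfd \<Rightarrow> ('a \<Rightarrow> 'b) \<Rightarrow> 'a \<Rightarrow> 'm \<Rightarrow> 'n"
  where "tmap M N f x =
    frechet_derivative (snd (chart_at N (f x)) \<circ> f \<circ> cinv (chart_at M x)) (at (coord_at M x))"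


section \<open>Vector fields, one-forms and the Courant bracket\<close>

text \<open>The coordinate expressions \<open>vrep\<close> and \<open>covrep\<close> of a vector field and a one-form in the chart
  \<open>c\<close> are functions on the image of \<open>c\<close>.\<close>

definition vrep :: "('a, 'm::real_inner) mfd \<Rightarrow> ('a, 'm) chart \<Rightarrow> ('a \<Rightarrow> 'm) \<Rightarrow> 'm \<Rightarrow> 'm"
  where "vrep M c X y = tchart M c (cinv c y) (X (cinv c y))"

definition covrep :: "('a, 'm::real_inner) mfd \<Rightarrow> ('a, 'm) chart \<Rightarrow> ('a \<Rightarrow> 'm \<Rightarrow>\<^sub>L real) \<Rightarrow> 'm \<Rightarrow> 'm \<Rightarrow>\<^sub>L real"
  where "covrep M c \<alpha> y = \<alpha> (cinv c y) o\<^sub>L Blinfun (inv (tchart M c (cinv c y)))"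

definition smooth_section ::
  "('a, 'm::real_inner) mfd \<Rightarrow> 'a set \<Rightarrow> ('a \<Rightarrow> 'm \<times> ('m \<Rightarrow>\<^sub>L real)) \<Rightarrow> bool"
  where "smooth_section M U s \<longleftrightarrow> (\<forall>c\<in>atlas M.
    smooth_on (snd c ` (fst c \<inter> U)) (vrep M c (fst \<circ> s)) \<and>
    smooth_on (snd c ` (fst c \<inter> U)) (covrep M c (snd \<circ> s)))"

text \<open>The differential operations at \<open>x\<close> are given by their usual coordinate formulas, evaluated
  in the chart \<open>chart_at M x\<close>; that is the chart in which elements of the (co)tangent space at \<open>x\<close>
  are expressed, so no further transport is needed.\<close>

definition lie_bracket :: "('a, 'm::real_inner) mfd \<Rightarrow> ('a \<Rightarrow> 'm) \<Rightarrow> ('a \<Rightarrow> 'm) \<Rightarrow> 'a \<Rightarrow> 'm"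
  where "lie_bracket M X Y x =
    (let c = chart_at M x; y = coord_at M x in
      frechet_derivative (vrep M c Y) (at y) (X x) - frechet_derivative (vrep M c X) (at y) (Y x))"

text \<open>\<open>(L\<^sub>X \<alpha>)\<^sub>j = X\<^sup>i \<partial>\<^sub>i \<alpha>\<^sub>j + \<alpha>\<^sub>i \<partial>\<^sub>j X\<^sup>i\<close>\<close>

definition lie_derivative ::
  "('a, 'm::real_inner) mfd \<Rightarrow> ('a \<Rightarrow> 'm) \<Rightarrow> ('a \<Rightarrow> 'm \<Rightarrow>\<^sub>L real) \<Rightarrow> 'a \<Rightarrow> 'm \<Rightarrow>\<^sub>L real"
  where "lie_derivative M X \<alpha> x =
    (let c = chart_at M x; y = coord_at M x in
      frechet_derivative (covrep M c \<alpha>) (at y) (X x) +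
      (\<alpha> x o\<^sub>L Blinfun (frechet_derivative (vrep M c X) (at y))))"

definition ext_derivative ::
  "('a, 'm::real_inner) mfd \<Rightarrow> ('a \<Rightarrow> 'm \<Rightarrow>\<^sub>L real) \<Rightarrow> 'a \<Rightarrow> 'm \<Rightarrow> 'm \<Rightarrow> real"
  where "ext_derivative M \<alpha> x u v =
    (let D = frechet_derivative (covrep M (chart_at M x) \<alpha>) (at (coord_at M x)) in
      blinfun_apply (D u) v - blinfun_apply (D v) u)"

definition courant_bracket ::
  "('a, 'm::real_inner) mfd \<Rightarrow> ('a \<Rightarrow> 'm \<times> ('m \<Rightarrow>\<^sub>L real)) \<Rightarrow> ('a \<Rightarrow> 'm \<times> ('m \<Rightarrow>\<^sub>L real)) \<Rightarrow>
   'a \<Rightarrow> 'm \<times> ('m \<Rightarrow>\<^sub>L real)"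
  where "courant_bracket M s\<^sub>1 s\<^sub>2 =
    (let X\<^sub>1 = fst \<circ> s\<^sub>1; \<alpha>\<^sub>1 = snd \<circ> s\<^sub>1; X\<^sub>2 = fst \<circ> s\<^sub>2; \<alpha>\<^sub>2 = snd \<circ> s\<^sub>2 in
      (\<lambda>x. (lie_bracket M X\<^sub>1 X\<^sub>2 x,
            lie_derivative M X\<^sub>1 \<alpha>\<^sub>2 x - Blinfun (ext_derivative M \<alpha>\<^sub>1 x (X\<^sub>2 x)))))"


section \<open>Dirac structures\<close>

definition pairing :: "'m::real_inner \<times> ('m \<Rightarrow>\<^sub>L real) \<Rightarrow> 'm \<times> ('m \<Rightarrow>\<^sub>L real) \<Rightarrow> real"
  where "pairing a b = (blinfun_apply (snd a) (fst b) + blinfun_apply (snd b) (fst a)) / 2"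

definition isotropic :: "('m::real_inner \<times> ('m \<Rightarrow>\<^sub>L real)) set \<Rightarrow> bool"
  where "isotropic W \<longleftrightarrow> subspace W \<and> (\<forall>a\<in>W. \<forall>b\<in>W. pairing a b = 0)"

definition maximal_isotropic :: "('m::real_inner \<times> ('m \<Rightarrow>\<^sub>L real)) set \<Rightarrow> bool"
  where "maximal_isotropic W \<longleftrightarrow> isotropic W \<and> (\<forall>W'. isotropic W' \<and> W \<subseteq> W' \<longrightarrow> W' = W)"

text \<open>Bundles and sections over an open subset \<open>U\<close> of \<open>M\<close>, viewed as an open submanifold.\<close>

definition smooth_subbundle_on ::
  "('a, 'm::real_inner) mfd \<Rightarrow> 'a set \<Rightarrow> ('a \<Rightarrow> ('m \<times> ('m \<Rightarrow>\<^sub>L real)) set) \<Rightarrow> bool"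
  where "smooth_subbundle_on M U L \<longleftrightarrow>
    (\<forall>x\<in>U. \<exists>V k s. openin (mtop M) V \<and> x \<in> V \<and> V \<subseteq> U \<and>
      (\<forall>i<k::nat. smooth_section M V (s i)) \<and>
      (\<forall>y\<in>V. inj_on (\<lambda>i. s i y) {..<k} \<and> independent ((\<lambda>i. s i y) ` {..<k}) \<and>
              span ((\<lambda>i. s i y) ` {..<k}) = L y))"

definition sections ::
  "('a, 'm::real_inner) mfd \<Rightarrow> 'a set \<Rightarrow> ('a \<Rightarrow> ('m \<times> ('m \<Rightarrow>\<^sub>L real)) set) \<Rightarrow>
   ('a \<Rightarrow> 'm \<times> ('m \<Rightarrow>\<^sub>L real)) set"
  where "sections M U L = {s. smooth_section M U s \<and> (\<forall>x\<in>U. s x \<in> L x)}"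

definition dirac_structure_on ::
  "('a, 'm::real_inner) mfd \<Rightarrow> 'a set \<Rightarrow> ('a \<Rightarrow> ('m \<times> ('m \<Rightarrow>\<^sub>L real)) set) \<Rightarrow> bool"
  where "dirac_structure_on M U L \<longleftrightarrow> openin (mtop M) U \<and>
    smooth_subbundle_on M U L \<and> (\<forall>x\<in>U. maximal_isotropic (L x)) \<and>
    (\<forall>s\<^sub>1\<in>sections M U L. \<forall>s\<^sub>2\<in>sections M U L. courant_bracket M s\<^sub>1 s\<^sub>2 \<in> sections M U L)"

abbreviation dirac_structure ::
  "('a, 'm::real_inner) mfd \<Rightarrow> ('a \<Rightarrow> ('m \<times> ('m \<Rightarrow>\<^sub>L real)) set) \<Rightarrow> bool"
  where "dirac_structure M L \<equiv> dirac_structure_on M (topspace (mtop M)) L"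


section \<open>Submanifolds, leaves and induced structures\<close>

text \<open>An immersed submanifold is a manifold on a subset of \<open>M\<close>; \<open>id\<close> is the inclusion, and
  \<open>tmap N M id q\<close> the embedding of the tangent space of \<open>N\<close> at \<open>q\<close> into that of \<open>M\<close>. Embedded
  submanifolds are the special case in which \<open>N\<close> carries the subspace topology.\<close>

definition immersed_submanifold ::
  "('a, 'm::real_inner) mfd \<Rightarrow> ('a, 'n::real_inner) mfd \<Rightarrow> bool"
  where "immersed_submanifold M N \<longleftrightarrow> smooth_manifold N \<and>
    topspace (mtop N) \<subseteq> topspace (mtop M) \<and> smooth_map N M id \<and>
    (\<forall>q\<in>topspace (mtop N). inj (tmap N M id q))"

definition characteristic_distribution :: "('a \<Rightarrow> ('m \<times> ('m \<Rightarrow>\<^sub>L real)) set) \<Rightarrow> 'a \<Rightarrow> 'm::real_inner set"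
  where "characteristic_distribution L x = fst ` L x"

definition integral_manifold ::
  "('a, 'm::real_inner) mfd \<Rightarrow> ('a \<Rightarrow> ('m \<times> ('m \<Rightarrow>\<^sub>L real)) set) \<Rightarrow> ('a, 'p::real_inner) mfd \<Rightarrow> bool"
  where "integral_manifold M L P \<longleftrightarrow> immersed_submanifold M P \<and>
    (\<forall>p\<in>topspace (mtop P). range (tmap P M id p) = characteristic_distribution L p)"

text \<open>Leaves are the maximal connected integral manifolds. It is enough to compare with integral
  manifolds modelled on the same type: one that contains a point of \<open>P\<close> has the dimension of \<open>P\<close>
  there.\<close>

definition presymplectic_leaf ::
  "('a, 'm::real_inner) mfd \<Rightarrow> ('a \<Rightarrow> ('m \<times> ('m \<Rightarrow>\<^sub>L real)) set) \<Rightarrow> ('a, 'p::real_inner) mfd \<Rightarrow> bool"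
  where "presymplectic_leaf M L P \<longleftrightarrow>
    integral_manifold M L P \<and> connected_space (mtop P) \<and> topspace (mtop P) \<noteq> {} \<and>
    (\<forall>P'::('a, 'p) mfd. integral_manifold M L P' \<and> connected_space (mtop P') \<and>
       topspace (mtop P) \<subseteq> topspace (mtop P') \<longrightarrow> topspace (mtop P') = topspace (mtop P))"

text \<open>\<open>T\<^sub>xM = T\<^sub>xP \<oplus> T\<^sub>xQ\<close>\<close>

definition transversal_at ::
  "('a, 'm::real_inner) mfd \<Rightarrow> ('a, 'p::real_inner) mfd \<Rightarrow> ('a, 'q::real_inner) mfd \<Rightarrow> 'a \<Rightarrow> bool"
  where "transversal_at M P Q x \<longleftrightarrow>
    {u + v | u v. u \<in> range (tmap P M id x) \<and> v \<in> range (tmap Q M id x)} = UNIV \<and>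
    range (tmap P M id x) \<inter> range (tmap Q M id x) = {0}"

text \<open>The induced structure, as the image of \<open>L\<^sub>q \<inter> (T\<^sub>qQ \<oplus> T\<^sub>q\<^sup>*M)\<close> under
  \<open>(u, \<xi>) \<mapsto> (u, \<xi>|T\<^sub>qQ)\<close>.\<close>

definition induced_structure ::
  "('a, 'm::real_inner) mfd \<Rightarrow> ('a \<Rightarrow> ('m \<times> ('m \<Rightarrow>\<^sub>L real)) set) \<Rightarrow> ('a, 'q::real_inner) mfd \<Rightarrow>
   'a \<Rightarrow> ('q \<times> ('q \<Rightarrow>\<^sub>L real)) set"
  where "induced_structure M L Q q =
    {(u, \<xi> o\<^sub>L Blinfun (tmap Q M id q)) | u \<xi>. (tmap Q M id q u, \<xi>) \<in> L q}"


section \<open>Bivector fields and Poisson structures\<close>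

text \<open>A bivector at a point is an alternating bilinear form on the cotangent space.\<close>

type_synonym 'm bivector = "('m \<Rightarrow>\<^sub>L real) \<Rightarrow> ('m \<Rightarrow>\<^sub>L real) \<Rightarrow> real"

definition is_bivector :: "'m::real_inner bivector \<Rightarrow> bool"
  where "is_bivector \<pi> \<longleftrightarrow> (\<forall>\<alpha>. linear (\<pi> \<alpha>)) \<and> (\<forall>\<beta>. linear (\<lambda>\<alpha>. \<pi> \<alpha> \<beta>)) \<and> (\<forall>\<alpha>. \<pi> \<alpha> \<alpha> = 0)"

definition sharp :: "'m::real_inner bivector \<Rightarrow> ('m \<Rightarrow>\<^sub>L real) \<Rightarrow> 'm"
  where "sharp \<pi> \<alpha> = (THE v. \<forall>\<beta>. blinfun_apply \<beta> v = \<pi> \<alpha> \<beta>)"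

definition bivector_graph :: "'m::real_inner bivector \<Rightarrow> ('m \<times> ('m \<Rightarrow>\<^sub>L real)) set"
  where "bivector_graph \<pi> = {(sharp \<pi> \<alpha>, \<alpha>) | \<alpha>. True}"

text \<open>\<open>birep M c \<pi> y \<xi> \<eta>\<close> is the component of \<open>\<pi>\<close> along the covectors of constant coordinates
  \<open>\<xi>, \<eta>\<close> in the chart \<open>c\<close>.\<close>

definition birep :: "('a, 'm::real_inner) mfd \<Rightarrow> ('a, 'm) chart \<Rightarrow> ('a \<Rightarrow> 'm bivector) \<Rightarrow> 'm \<Rightarrow> 'm bivector"
  where "birep M c \<pi> y \<xi> \<eta> =
    \<pi> (cinv c y) (\<xi> o\<^sub>L Blinfun (tchart M c (cinv c y))) (\<eta> o\<^sub>L Blinfun (tchart M c (cinv c y)))"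

definition bivector_field_on :: "('a, 'm::real_inner) mfd \<Rightarrow> 'a set \<Rightarrow> ('a \<Rightarrow> 'm bivector) \<Rightarrow> bool"
  where "bivector_field_on M U \<pi> \<longleftrightarrow> (\<forall>x\<in>U. is_bivector (\<pi> x)) \<and>
    (\<forall>c\<in>atlas M. \<forall>\<xi> \<eta>. smooth_on (snd c ` (fst c \<inter> U)) (\<lambda>y. birep M c \<pi> y \<xi> \<eta>))"

text \<open>The Schouten bracket of two bivector fields in coordinates: the value of
  \<open>[\<pi>, \<rho>]\<close> on constant covectors \<open>\<xi>, \<eta>, \<zeta>\<close> is the cyclic sum of the derivatives of
  \<open>\<pi>(\<xi>, \<eta>)\<close> along \<open>\<rho>\<^sup>\<sharp> \<zeta>\<close> and of \<open>\<rho>(\<xi>, \<eta>)\<close> along \<open>\<pi>\<^sup>\<sharp> \<zeta>\<close>. This is the bilinear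
  extension of
  \<open>[X \<and> Y, Z \<and> W] = [X,Z] \<and> Y \<and> W - [X,W] \<and> Y \<and> Z - [Y,Z] \<and> X \<and> W + [Y,W] \<and> X \<and> Z\<close>.\<close>

definition schouten_bracket ::
  "('a, 'm::real_inner) mfd \<Rightarrow> ('a \<Rightarrow> 'm bivector) \<Rightarrow> ('a \<Rightarrow> 'm bivector) \<Rightarrow>
   'a \<Rightarrow> ('m \<Rightarrow>\<^sub>L real) \<Rightarrow> ('m \<Rightarrow>\<^sub>L real) \<Rightarrow> ('m \<Rightarrow>\<^sub>L real) \<Rightarrow> real"
  where "schouten_bracket M \<pi> \<rho> x \<xi> \<eta> \<zeta> =
    (let D = (\<lambda>\<sigma> \<tau> \<alpha> \<beta> \<gamma>. frechet_derivative (\<lambda>y. birep M (chart_at M x) \<sigma> y \<alpha> \<beta>)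
                (at (coord_at M x)) (sharp (\<tau> x) \<gamma>)) in
      (D \<pi> \<rho> \<xi> \<eta> \<zeta> + D \<pi> \<rho> \<eta> \<zeta> \<xi> + D \<pi> \<rho> \<zeta> \<xi> \<eta>) +
      (D \<rho> \<pi> \<xi> \<eta> \<zeta> + D \<rho> \<pi> \<eta> \<zeta> \<xi> + D \<rho> \<pi> \<zeta> \<xi> \<eta>))"

definition poisson_structure_on :: "('a, 'm::real_inner) mfd \<Rightarrow> 'a set \<Rightarrow> ('a \<Rightarrow> 'm bivector) \<Rightarrow> bool"
  where "poisson_structure_on M U \<pi> \<longleftrightarrow> bivector_field_on M U \<pi> \<and>
    (\<forall>x\<in>U. \<forall>\<xi> \<eta> \<zeta>. schouten_bracket M \<pi> \<pi> x \<xi> \<eta> \<zeta> = 0)"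

end

theory Submission
  imports Defs
begin

text \<open>
  Over a point \<open>q\<close> of \<open>Q\<close> near \<open>m\<^sub>0\<close> let \<open>T\<close> be the inclusion of \<open>T\<^sub>qQ\<close> and \<open>\<sigma> i\<close> a frame of
  \<open>L\<close>. At \<open>m\<^sub>0\<close>, transversality together with maximality of \<open>L\<close> says that
  \<open>(u, a) \<mapsto> (T u - \<Sum> a\<^sub>i pr\<^sub>1 \<sigma>\<^sub>i, \<Sum> a\<^sub>i pr\<^sub>2 \<sigma>\<^sub>i \<circ> T)\<close> is an isomorphism. It remains one near
  \<open>m\<^sub>0\<close>, with smooth inverse, and the preimage of \<open>(0, \<eta>)\<close> gives at once the vector \<open>\<Pi>\<^sub>Q\<^sup>\<sharp> \<eta>\<close>
  and a smooth lift of \<open>L\<^sub>Q\<close> to \<open>L \<inter> (TQ \<oplus> T\<^sup>*M)\<close>. The Courant bracket of two sections lifted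
  in this way is again a lift of an element of \<open>L\<close>, by integrability of \<open>L\<close> and isotropy; so
  \<open>L\<^sub>Q\<close> is closed under brackets. For a graph, this is the Jacobi identity. At \<open>m\<^sub>0\<close> itself the
  vector part of \<open>L\<^sub>Q\<close> lies in \<open>T P \<inter> T Q = 0\<close>.
\<close>

section \<open>Calculus of smooth maps\<close>

text \<open>That \<open>L_Q\<close> is a smooth bundle needs constant rank of L \<inter> (TQ + T*M),
  and that it is a graph needs its intersection with TQ to vanish. The isomorphism settles both at
  once: a zero first component says that the vector part of an element of \<open>L\<close> is
  tangent to \<open>Q\<close>, the second component is its restricted covector, and invertibility is
  an open condition. Two obstacles shape the rest. Integrability of \<open>L\<close> concerns
  sections over all of \<open>M\<close>, whereas sections of \<open>L_Q\<close> live over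
  \<open>Q\<close>, which is only immersed. Extending them would call for slice charts; instead they
  are expanded in a frame of \<open>L\<close> with coefficients on \<open>Q\<close>, and the bracket
  is computed for such expansions. The frame itself must consist of global sections, hence the bump
  functions. The other obstacle is that a tangent vector at \<open>x\<close> is given in a chart
  chosen separately for each \<open>x\<close>. Nothing can be differentiated before transport to a
  fixed chart, so the inverse and the lift are built in one chart of \<open>Q\<close> and one of
  \<open>M\<close> around \<open>m\<^sub>0\<close>, and every other chart is reached through
  Jacobians.\<close>

lemma Ck_on_cong:
  assumes "open S" "\<And>x. x \<in> S \<Longrightarrow> f x = g x" "Ck_on k S f"
  shows "Ck_on k S g"
  using assms(2,3)
proof (induction k arbitrary: f g)
  case 0
  then show ?case using continuous_on_cong[of S S f g] by simp
next
  case (Suc k)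
  have D: "f differentiable (at x)" if "x \<in> S" for x using Suc.prems(2) that by simp
  have "g differentiable (at x)" if "x \<in> S" for x
    using has_derivative_transform_within_open[OF _ assms(1) that, of f _ UNIV g] D[OF that] Suc.prems(1)
    unfolding differentiable_def by blast
  moreover have "Ck_on k S (\<lambda>x. frechet_derivative g (at x) v)" for v
  proof (rule Suc.IH)
    show "Ck_on k S (\<lambda>x. frechet_derivative f (at x) v)" using Suc.prems(2) by simp
    show "frechet_derivative f (at x) v = frechet_derivative g (at x) v" if "x \<in> S" for x
      using frechet_derivative_transform_within_open[OF D[OF that] assms(1) that Suc.prems(1)]
      by simp
  qed
  ultimately show ?case by simp
qed

lemma Ck_on_subset: "Ck_on k S f \<Longrightarrow> T \<subseteq> S \<Longrightarrow> Ck_on k T f"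
  by (induction k arbitrary: f) (auto intro: continuous_on_subset)

lemma Ck_on_Suc_imp: "Ck_on (Suc k) S f \<Longrightarrow> Ck_on k S f"
proof (induction k arbitrary: f)
  case 0
  then show ?case
    by (auto intro!: continuous_at_imp_continuous_on differentiable_imp_continuous_within)
qed auto

text \<open>Differentiability and derivatives at a point depend only on the function near it, and
  continuity on an open set is continuity at each of its points.\<close>

lemma Ck_on_local:
  "(\<And>x. x \<in> S \<Longrightarrow> \<exists>T. open T \<and> x \<in> T \<and> Ck_on k T f) \<Longrightarrow> Ck_on k S f"
proof (induction k arbitrary: f)
  case 0
  have "isCont f x" if "x \<in> S" for x
    using 0[OF that] continuous_on_eq_continuous_at by auto
  then show ?case by (simp add: continuous_at_imp_continuous_on)
next
  case (Suc k)
  have "f differentiable (at x)" if "x \<in> S" for x using Suc.prems[OF that] by auto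
  moreover have "Ck_on k S (\<lambda>x. frechet_derivative f (at x) v)" for v
    using Suc.prems by (intro Suc.IH) (metis Ck_on.simps(2))
  ultimately show ?case by simp
qed

text \<open>Takes any explicit formula for the derivative in place of
  \<open>frechet_derivative\<close>; the closure properties below follow from it by induction on the
  order.\<close>

lemma Ck_on_SucI:
  assumes "open S" "\<And>x. x \<in> S \<Longrightarrow> (f has_derivative f' x) (at x)"
    "\<And>v. Ck_on k S (\<lambda>x. f' x v)"
  shows "Ck_on (Suc k) S f"
proof -
  have "Ck_on k S (\<lambda>x. frechet_derivative f (at x) v)" for v
    by (rule Ck_on_cong[OF assms(1) _ assms(3)[of v]]) (metis assms(2) frechet_derivative_at)
  then show ?thesis using assms(2) by (auto simp: differentiable_def)
qed

lemma Ck_on_SucD: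
  assumes "Ck_on (Suc k) S f" "x \<in> S"
  shows "(f has_derivative frechet_derivative f (at x)) (at x)"
  using assms by (simp add: frechet_derivative_works[symmetric])

lemma Ck_on_const: "open S \<Longrightarrow> Ck_on k S (\<lambda>x. c)"
  by (induction k arbitrary: c) auto

lemma Ck_on_bounded_linear: "bounded_linear f \<Longrightarrow> open S \<Longrightarrow> Ck_on k S f"
proof (cases k)
  case 0
  then show "bounded_linear f \<Longrightarrow> open S \<Longrightarrow> Ck_on k S f"
    by (simp add: linear_continuous_on)
next
  case (Suc n)
  assume "bounded_linear f" "open S"
  then show ?thesis unfolding Suc
    by (intro Ck_on_SucI[where f' = "\<lambda>x. f"] Ck_on_const bounded_linear_imp_has_derivative)
qed

lemma Ck_on_compose_bounded_linear:
  assumes "open S" "bounded_linear F" "Ck_on k S f"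
  shows "Ck_on k S (\<lambda>x. F (f x))"
  using assms(3)
proof (induction k arbitrary: f)
  case 0
  then show ?case using assms(2) by (auto intro: bounded_linear.continuous_on)
next
  case (Suc k)
  show ?case
  proof (rule Ck_on_SucI[OF assms(1)])
    show "((\<lambda>x. F (f x)) has_derivative (\<lambda>v. F (frechet_derivative f (at x) v))) (at x)"
      if "x \<in> S" for x
      by (rule bounded_linear.has_derivative[OF assms(2) Ck_on_SucD[OF Suc.prems that]])
    show "Ck_on k S (\<lambda>x. F (frechet_derivative f (at x) v))" for v
      using Suc.prems by (intro Suc.IH) auto
  qed
qed

lemma Ck_on_add:
  assumes "open S" "Ck_on k S f" "Ck_on k S g"
  shows "Ck_on k S (\<lambda>x. f x + g x)"
  using assms(2,3)
proof (induction k arbitrary: f g)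
  case 0
  then show ?case by (auto intro: continuous_on_add)
next
  case (Suc k)
  show ?case
    by (rule Ck_on_SucI[OF assms(1) has_derivative_add[OF Ck_on_SucD[OF Suc.prems(1)] Ck_on_SucD[OF Suc.prems(2)]]])
      (use Suc in auto)
qed

lemma Ck_on_bilinear:
  assumes "open S" "bounded_bilinear B" "Ck_on k S f" "Ck_on k S g"
  shows "Ck_on k S (\<lambda>x. B (f x) (g x))"
  using assms(3,4)
proof (induction k arbitrary: f g)
  case 0
  then show ?case using assms(2) by (auto intro: bounded_bilinear.continuous_on)
next
  case (Suc k)
  show ?case
  proof (rule Ck_on_SucI[OF assms(1) bounded_bilinear.FDERIV[OF assms(2)]])
    show "(f has_derivative frechet_derivative f (at x)) (at x)"
      "(g has_derivative frechet_derivative g (at x)) (at x)" if "x \<in> S" for x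
      using Suc.prems that by (simp_all add: frechet_derivative_works[symmetric])
    show "Ck_on k S (\<lambda>x. B (f x) (frechet_derivative g (at x) v) + B (frechet_derivative f (at x) v) (g x))" for v
      by (intro Ck_on_add assms(1) Suc.IH Suc.prems[THEN Ck_on_Suc_imp]) (use Suc.prems in auto)
  qed
qed

lemma Ck_on_sum:
  assumes "open S" "\<And>i. i \<in> I \<Longrightarrow> Ck_on k S (f i)"
  shows "Ck_on k S (\<lambda>x. \<Sum>i\<in>I. f i x)"
  using assms(2)
  by (induction I rule: infinite_finite_induct) (auto intro: Ck_on_const Ck_on_add assms(1))

section \<open>Orthonormal bases and derivatives as operators\<close>

text \<open>Plays the role of \<open>Basis\<close> on a finite-dimensional type that is only
  \<open>real_inner\<close>; in dimension 0 it is empty.\<close>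

definition onb :: "'a::real_inner set"
  where "onb = (SOME B. finite B \<and> (\<forall>b\<in>B. \<forall>b'\<in>B. b \<bullet> b' = (if b = b' then 1 else 0)) \<and> span B = UNIV)"

lemma onb:
  assumes "finite_dim TYPE('a::real_inner)"
  shows finite_onb: "finite (onb :: 'a set)"
    and onb_inner: "\<And>b b'. b \<in> onb \<Longrightarrow> b' \<in> onb \<Longrightarrow> b \<bullet> b' = (if b = (b'::'a) then 1 else 0)"
    and onb_expand: "\<And>x::'a. x = (\<Sum>b\<in>onb. (x \<bullet> b) *\<^sub>R b)"
proof -
  obtain B0 :: "'a set" where "finite B0" "span B0 = UNIV" using assms unfolding finite_dim_def by blast
  then obtain C :: "'a set" where C: "finite C" "span C = UNIV" "pairwise orthogonal C"
    using basis_orthogonal[of B0] by auto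
  \<comment> \<open>The orthogonal spanning set \<open>C\<close> may contain 0, which has to go
    before normalising.\<close>
  define B where "B = (\<lambda>x. x /\<^sub>R norm x) ` (C - {0})"
  have "b \<bullet> b' = (if b = b' then 1 else 0)" if bb: "b \<in> B" "b' \<in> B" for b b'
  proof -
    obtain x y where xy: "x \<in> C" "x \<noteq> 0" "y \<in> C" "y \<noteq> 0" "b = x /\<^sub>R norm x" "b' = y /\<^sub>R norm y"
      using bb unfolding B_def by auto
    show ?thesis
    proof (cases "x = y")
      case True
      then show ?thesis using xy by (simp add: dot_square_norm power2_eq_square field_simps)
    next
      case False
      then have "x \<bullet> y = 0" using C(3) xy by (auto simp: pairwise_def orthogonal_def)
      moreover have "b \<bullet> b = 1" using xy by (simp add: dot_square_norm power2_eq_square field_simps)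
      moreover have "b \<bullet> b' = 0" using xy \<open>x \<bullet> y = 0\<close> by simp
      ultimately show ?thesis by auto
    qed
  qed
  moreover have "C \<subseteq> span B"
  proof
    fix x assume x: "x \<in> C"
    show "x \<in> span B"
    proof (cases "x = 0")
      case False
      then have "x /\<^sub>R norm x \<in> span B" using x unfolding B_def by (intro span_base) auto
      then have "norm x *\<^sub>R (x /\<^sub>R norm x) \<in> span B" by (rule span_scale)
      then show ?thesis using False by simp
    qed (simp add: span_zero)
  qed
  then have "span B = UNIV" using C(2) span_mono[of C "span B"] by (auto simp: span_span)
  ultimately have "\<exists>B. finite B \<and> (\<forall>b\<in>B. \<forall>b'\<in>B. b \<bullet> b' = (if b = (b'::'a) then 1 else 0)) \<and> span B = UNIV"
    using C(1) by (intro exI[of _ B]) (simp add: B_def)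
  then have *: "finite (onb::'a set) \<and> (\<forall>b\<in>(onb::'a set). \<forall>b'\<in>onb. b \<bullet> b' = (if b = b' then 1 else 0)) \<and> span (onb::'a set) = UNIV"
    unfolding onb_def by (rule someI_ex)
  then show 1: "finite (onb :: 'a set)"
    and 2: "\<And>b b'. b \<in> onb \<Longrightarrow> b' \<in> onb \<Longrightarrow> b \<bullet> b' = (if b = (b'::'a) then 1 else 0)"
    by blast+
  fix x :: 'a
  obtain u where u: "x = (\<Sum>b\<in>onb. u b *\<^sub>R b)"
    using span_finite[OF 1] * by (metis (no_types, lifting) UNIV_I imageE)
  have "x \<bullet> b = u b" if "b \<in> onb" for b
  proof -
    have "x \<bullet> b = (\<Sum>b'\<in>onb. if b' = b then u b else 0)"
      unfolding u inner_sum_left by (rule sum.cong) (use 2 that in auto)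
    then show ?thesis using 1 that by simp
  qed
  then have "(\<Sum>b\<in>onb. (x \<bullet> b) *\<^sub>R b) = (\<Sum>b\<in>onb. u b *\<^sub>R b)" by (intro sum.cong) simp_all
  then show "x = (\<Sum>b\<in>onb. (x \<bullet> b) *\<^sub>R b)" using u by simp
qed

lemma linear_onb:
  assumes "finite_dim TYPE('a::real_inner)" "linear f"
  shows "f x = (\<Sum>b\<in>(onb::'a set). (x \<bullet> b) *\<^sub>R f b)"
proof -
  have "f x = f (\<Sum>b\<in>onb. (x \<bullet> b) *\<^sub>R b)" using onb_expand[OF assms(1), of x] by (rule arg_cong)
  then show ?thesis by (simp only: linear_sum[OF assms(2)] linear_scale[OF assms(2)])
qed

lemma linear_imp_bounded_linear:
  fixes f :: "'a::real_inner \<Rightarrow> 'b::real_normed_vector"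
  assumes "finite_dim TYPE('a)" "linear f"
  shows "bounded_linear f"
proof -
  have "bounded_linear (\<lambda>x. \<Sum>b\<in>(onb::'a set). (x \<bullet> b) *\<^sub>R f b)"
    by (intro bounded_linear_sum bounded_linear_scaleR_const bounded_linear_inner_left)
  moreover have "(\<lambda>x. \<Sum>b\<in>(onb::'a set). (x \<bullet> b) *\<^sub>R f b) = f"
    by (rule ext, rule linear_onb[OF assms, symmetric])
  ultimately show ?thesis by simp
qed

text \<open>Taking values in a normed space of operators lets the derivative itself be
  differentiated and composed.\<close>

definition fderiv :: "('a::real_normed_vector \<Rightarrow> 'b::real_normed_vector) \<Rightarrow> 'a \<Rightarrow> 'a \<Rightarrow>\<^sub>L 'b"
  where "fderiv f x = Blinfun (frechet_derivative f (at x))"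

lemma fderiv_apply: "f differentiable (at x) \<Longrightarrow> blinfun_apply (fderiv f x) = frechet_derivative f (at x)"
  unfolding fderiv_def
  by (simp add: bounded_linear_Blinfun_apply frechet_derivative_works has_derivative_bounded_linear)

lemma fderiv_works: "f differentiable (at x) \<Longrightarrow> (f has_derivative blinfun_apply (fderiv f x)) (at x)"
  by (simp add: fderiv_apply frechet_derivative_works[symmetric])

lemma fderiv_eqI: "(f has_derivative blinfun_apply A) (at x) \<Longrightarrow> fderiv f x = A"
  unfolding fderiv_def by (metis frechet_derivative_at blinfun_apply_inverse)

text \<open>\<open>Ck_on\<close> controls each directional derivative separately. In finite
  dimension the operator is a finite sum of the derivatives along \<open>onb\<close>, each put
  through a fixed bounded linear map, so it inherits their regularity.\<close>

lemma Ck_on_fderiv: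
  fixes f :: "'a::real_inner \<Rightarrow> 'b::real_normed_vector"
  assumes "finite_dim TYPE('a)" "open S" "Ck_on (Suc k) S f"
  shows "Ck_on k S (fderiv f)"
proof (rule Ck_on_cong[OF assms(2)])
  show "Ck_on k S (\<lambda>x. \<Sum>b\<in>onb. blinfun_scaleR_left (frechet_derivative f (at x) b) o\<^sub>L blinfun_inner_right b)"
  proof (intro Ck_on_sum assms(2))
    fix b :: 'a
    have "bounded_linear (\<lambda>w::'b. blinfun_scaleR_left w o\<^sub>L blinfun_inner_right b)"
      by (intro bounded_linear_intros)
    from Ck_on_compose_bounded_linear[OF assms(2) this]
    show "Ck_on k S (\<lambda>x. blinfun_scaleR_left (frechet_derivative f (at x) b) o\<^sub>L blinfun_inner_right b)"
      using assms(3) by simp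
  qed
next
  fix x assume "x \<in> S"
  then have d: "f differentiable (at x)" using assms(3) by simp
  show "(\<Sum>b\<in>onb. blinfun_scaleR_left (frechet_derivative f (at x) b) o\<^sub>L blinfun_inner_right b) = fderiv f x"
  proof (rule blinfun_eqI)
    fix v
    have "(\<Sum>b\<in>onb. (v \<bullet> b) *\<^sub>R frechet_derivative f (at x) b) = frechet_derivative f (at x) v"
      by (rule linear_onb[OF assms(1) linear_frechet_derivative[OF d], symmetric])
    then show "blinfun_apply (\<Sum>b\<in>onb. blinfun_scaleR_left (frechet_derivative f (at x) b) o\<^sub>L blinfun_inner_right b) v =
        fderiv f x v"
      by (simp add: fderiv_apply[OF d] blinfun.sum_left inner_commute)
  qed
qed

text \<open>In the chain rule the derivative of \<open>f\<close> is taken in a direction that varies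
  with \<open>x\<close>, while the induction hypothesis covers fixed directions. Expanding the
  direction in \<open>onb\<close> turns the derivative into a sum of products of both kinds of
  functions.\<close>

lemma Ck_on_compose:
  fixes f :: "'b::real_inner \<Rightarrow> 'c::real_normed_vector"
  assumes "finite_dim TYPE('b)" "open S" "open T" "g ` S \<subseteq> T" "Ck_on k S g" "Ck_on k T f"
  shows "Ck_on k S (\<lambda>x. f (g x))"
  using assms(5,6)
proof (induction k arbitrary: f)
  case 0
  then show ?case using assms(4) continuous_on_compose2[of T f S g] by simp
next
  case (Suc k)
  show ?case
  proof (rule Ck_on_SucI[OF assms(2)])
    show "((\<lambda>x. f (g x)) has_derivative (\<lambda>v. \<Sum>b\<in>onb. (frechet_derivative g (at x) v \<bullet> b) *\<^sub>R frechet_derivative f (at (g x)) b)) (at x)"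
      if "x \<in> S" for x
    proof -
      have df: "f differentiable (at (g x))" using Suc.prems that assms(4) by auto
      have "((\<lambda>x. f (g x)) has_derivative (\<lambda>v. frechet_derivative f (at (g x)) (frechet_derivative g (at x) v))) (at x)"
        using has_derivative_compose[OF Ck_on_SucD[OF Suc.prems(1) that]] df by (simp add: frechet_derivative_works)
      then show ?thesis by (simp add: linear_onb[OF assms(1) linear_frechet_derivative[OF df], symmetric])
    qed
    show "Ck_on k S (\<lambda>x. \<Sum>b\<in>onb. (frechet_derivative g (at x) v \<bullet> b) *\<^sub>R frechet_derivative f (at (g x)) b)" for v
    proof (intro Ck_on_sum assms(2) Ck_on_bilinear[OF _ bounded_bilinear_scaleR])
      fix b :: 'b
      show "Ck_on k S (\<lambda>x. frechet_derivative g (at x) v \<bullet> b)"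
        using Suc.prems(1) by (intro Ck_on_compose_bounded_linear[OF assms(2) bounded_linear_inner_left]) simp
      show "Ck_on k S (\<lambda>x. frechet_derivative f (at (g x)) b)"
        using Suc.prems by (intro Suc.IH Ck_on_Suc_imp[OF Suc.prems(1)]) simp
    qed
  qed
qed

lemma smooth_on_cong: "open S \<Longrightarrow> (\<And>x. x \<in> S \<Longrightarrow> f x = g x) \<Longrightarrow> smooth_on S f \<Longrightarrow> smooth_on S g"
  unfolding smooth_on_def using Ck_on_cong by blast

lemma smooth_on_subset: "smooth_on S f \<Longrightarrow> T \<subseteq> S \<Longrightarrow> smooth_on T f"
  unfolding smooth_on_def using Ck_on_subset by blast

lemma smooth_on_local:
  "(\<And>x. x \<in> S \<Longrightarrow> \<exists>T. open T \<and> x \<in> T \<and> smooth_on T f) \<Longrightarrow> smooth_on S f"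
  unfolding smooth_on_def by (intro allI Ck_on_local) blast

lemma smooth_on_const: "open S \<Longrightarrow> smooth_on S (\<lambda>x. c)"
  unfolding smooth_on_def using Ck_on_const by blast

lemma smooth_on_bounded_linear: "bounded_linear f \<Longrightarrow> open S \<Longrightarrow> smooth_on S f"
  unfolding smooth_on_def using Ck_on_bounded_linear by blast

lemma smooth_on_compose_bounded_linear:
  "bounded_linear F \<Longrightarrow> open S \<Longrightarrow> smooth_on S f \<Longrightarrow> smooth_on S (\<lambda>x. F (f x))"
  unfolding smooth_on_def by (rule allI, rule Ck_on_compose_bounded_linear) auto

lemma smooth_on_add: "open S \<Longrightarrow> smooth_on S f \<Longrightarrow> smooth_on S g \<Longrightarrow> smooth_on S (\<lambda>x. f x + g x)"
  unfolding smooth_on_def using Ck_on_add by blast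

lemma smooth_on_minus: "open S \<Longrightarrow> smooth_on S f \<Longrightarrow> smooth_on S (\<lambda>x. - f x)"
  by (rule smooth_on_compose_bounded_linear[OF bounded_linear_minus[OF bounded_linear_ident]])

lemma smooth_on_diff: "open S \<Longrightarrow> smooth_on S f \<Longrightarrow> smooth_on S g \<Longrightarrow> smooth_on S (\<lambda>x. f x - g x)"
  using smooth_on_add[of S f "\<lambda>x. - g x"] smooth_on_minus[of S g] by simp

lemma smooth_on_bilinear:
  "bounded_bilinear B \<Longrightarrow> open S \<Longrightarrow> smooth_on S f \<Longrightarrow> smooth_on S g \<Longrightarrow> smooth_on S (\<lambda>x. B (f x) (g x))"
  unfolding smooth_on_def by (rule allI, rule Ck_on_bilinear) auto

lemmas smooth_on_scaleR = smooth_on_bilinear[OF bounded_bilinear_scaleR]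
  and smooth_on_inner = smooth_on_bilinear[OF bounded_bilinear_inner]
  and smooth_on_blinfun_apply = smooth_on_bilinear[OF bounded_bilinear_blinfun_apply]
  and smooth_on_blinfun_compose = smooth_on_bilinear[OF bounded_bilinear_blinfun_compose]

lemma smooth_on_sum: "open S \<Longrightarrow> (\<And>i. i \<in> I \<Longrightarrow> smooth_on S (f i)) \<Longrightarrow> smooth_on S (\<lambda>x. \<Sum>i\<in>I. f i x)"
  unfolding smooth_on_def by (rule allI, rule Ck_on_sum) auto

lemma smooth_on_fderiv:
  "finite_dim TYPE('a::real_inner) \<Longrightarrow> open S \<Longrightarrow> smooth_on S f \<Longrightarrow> smooth_on (S::'a set) (fderiv f)"
  unfolding smooth_on_def by (rule allI, rule Ck_on_fderiv) auto

lemma smooth_on_compose: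
  fixes f :: "'b::real_inner \<Rightarrow> 'c::real_normed_vector"
  shows "finite_dim TYPE('b) \<Longrightarrow> open S \<Longrightarrow> open T \<Longrightarrow> g ` S \<subseteq> T \<Longrightarrow> smooth_on S g \<Longrightarrow> smooth_on T f \<Longrightarrow>
    smooth_on S (\<lambda>x. f (g x))"
  unfolding smooth_on_def by (rule allI, rule Ck_on_compose) auto

lemma smooth_on_differentiable: "smooth_on S f \<Longrightarrow> x \<in> S \<Longrightarrow> f differentiable (at x)"
  unfolding smooth_on_def by (meson Ck_on.simps(2))

lemma smooth_on_has_derivative: "smooth_on S f \<Longrightarrow> x \<in> S \<Longrightarrow> (f has_derivative blinfun_apply (fderiv f x)) (at x)"
  by (rule fderiv_works[OF smooth_on_differentiable])

lemma smooth_on_continuous: "smooth_on S f \<Longrightarrow> continuous_on S f"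
  unfolding smooth_on_def by (metis Ck_on.simps(1))

section \<open>Symmetry of second derivatives\<close>

lemma has_real_derivative_line:
  fixes f :: "'a::real_normed_vector \<Rightarrow> real"
  assumes "(f has_derivative f') (at (p + s *\<^sub>R u))"
  shows "((\<lambda>s. f (p + s *\<^sub>R u)) has_real_derivative f' u) (at s)"
proof -
  have "((\<lambda>s. p + s *\<^sub>R u) has_derivative (\<lambda>r. r *\<^sub>R u)) (at s)"
    by (auto intro!: derivative_eq_intros)
  from has_derivative_compose[OF this assms]
  have "((\<lambda>s. f (p + s *\<^sub>R u)) has_derivative (\<lambda>r. f' (r *\<^sub>R u))) (at s)" by simp
  moreover have "(\<lambda>r. f' (r *\<^sub>R u)) = (*) (f' u)"
    using has_derivative_linear[OF assms] by (auto simp: linear_scale)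
  ultimately show ?thesis unfolding has_field_derivative_def by simp
qed

text \<open>Two applications of the mean value theorem, along \<open>u\<close> and then along
  \<open>v\<close>. The left side is symmetric in \<open>u\<close> and \<open>v\<close>, so
  exchanging them represents the same number by the other mixed derivative.\<close>

lemma second_difference:
  fixes f :: "'a::real_normed_vector \<Rightarrow> real"
  assumes f: "Ck_on (Suc (Suc 0)) S f" and h: "0 < h"
    and S: "\<And>s t. 0 \<le> s \<Longrightarrow> s \<le> h \<Longrightarrow> 0 \<le> t \<Longrightarrow> t \<le> h \<Longrightarrow> x + s *\<^sub>R u + t *\<^sub>R v \<in> S"
  shows "\<exists>s t. 0 < s \<and> s < h \<and> 0 < t \<and> t < h \<and>
    f (x + h *\<^sub>R u + h *\<^sub>R v) - f (x + h *\<^sub>R u) - f (x + h *\<^sub>R v) + f x =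
    h * h * frechet_derivative (\<lambda>x. frechet_derivative f (at x) u) (at (x + s *\<^sub>R u + t *\<^sub>R v)) v"
proof -
  define fu where "fu = (\<lambda>x. frechet_derivative f (at x) u)"
  have df: "(f has_derivative frechet_derivative f (at y)) (at y)" if "y \<in> S" for y
    by (rule Ck_on_SucD[OF f that])
  have dfu: "(fu has_derivative frechet_derivative fu (at y)) (at y)" if "y \<in> S" for y
    by (rule Ck_on_SucD[OF _ that, of 0]) (use f in \<open>simp add: fu_def\<close>)
  have S0: "x + s *\<^sub>R u \<in> S" if "0 \<le> s" "s \<le> h" for s
    using S[OF that, of 0] h by simp
  have "\<exists>s. 0 < s \<and> s < h \<and> (f (x + h *\<^sub>R v + h *\<^sub>R u) - f (x + h *\<^sub>R u)) - (f (x + h *\<^sub>R v + 0 *\<^sub>R u) - f (x + 0 *\<^sub>R u)) =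
      (h - 0) * (fu (x + h *\<^sub>R v + s *\<^sub>R u) - fu (x + s *\<^sub>R u))"
  proof (rule MVT2[OF h])
    fix s assume s: "0 \<le> s" "s \<le> h"
    have "x + h *\<^sub>R v + s *\<^sub>R u \<in> S" using S[OF s, of h] h by (simp add: algebra_simps)
    from has_real_derivative_line[OF df[OF this]] has_real_derivative_line[OF df[OF S0[OF s]]]
    show "((\<lambda>s. f (x + h *\<^sub>R v + s *\<^sub>R u) - f (x + s *\<^sub>R u)) has_real_derivative
        fu (x + h *\<^sub>R v + s *\<^sub>R u) - fu (x + s *\<^sub>R u)) (at s)"
      unfolding fu_def by (rule DERIV_diff)
  qed
  then obtain s where s: "0 < s" "s < h" and e1: "f (x + h *\<^sub>R v + h *\<^sub>R u) - f (x + h *\<^sub>R u) - f (x + h *\<^sub>R v) + f x =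
      h * (fu (x + h *\<^sub>R v + s *\<^sub>R u) - fu (x + s *\<^sub>R u))" by auto
  have "\<exists>t. 0 < t \<and> t < h \<and> fu (x + s *\<^sub>R u + h *\<^sub>R v) - fu (x + s *\<^sub>R u + 0 *\<^sub>R v) =
      (h - 0) * frechet_derivative fu (at (x + s *\<^sub>R u + t *\<^sub>R v)) v"
    by (rule MVT2[OF h], rule has_real_derivative_line, rule dfu, rule S) (use s in auto)
  then obtain t where t: "0 < t" "t < h" and e2: "fu (x + s *\<^sub>R u + h *\<^sub>R v) - fu (x + s *\<^sub>R u) =
      h * frechet_derivative fu (at (x + s *\<^sub>R u + t *\<^sub>R v)) v" by auto
  have "f (x + h *\<^sub>R u + h *\<^sub>R v) - f (x + h *\<^sub>R u) - f (x + h *\<^sub>R v) + f x =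
      h * h * frechet_derivative fu (at (x + s *\<^sub>R u + t *\<^sub>R v)) v"
    using e1 e2 by (simp add: add_ac)
  then show ?thesis using s t unfolding fu_def by blast
qed

lemma second_derivative_commute_real:
  fixes f :: "'a::real_normed_vector \<Rightarrow> real"
  assumes f: "Ck_on (Suc (Suc 0)) S f" and S: "open S" "x \<in> S"
  shows "frechet_derivative (\<lambda>x. frechet_derivative f (at x) u) (at x) v =
    frechet_derivative (\<lambda>x. frechet_derivative f (at x) v) (at x) u" (is "?a x = ?b x")
proof (rule ccontr)
  assume ne: "?a x \<noteq> ?b x"
  \<comment> \<open>Half the gap: two values within \<open>e\<close> of \<open>?a x\<close> and of
    \<open>?b x\<close> cannot coincide.\<close>
  define e where "e = \<bar>?a x - ?b x\<bar> / 2"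
  have e: "e > 0" using ne e_def by auto
  have "isCont ?a x" "isCont ?b x"
    using f S by (auto simp: continuous_on_eq_continuous_at)
  moreover have "\<forall>\<^sub>F y in nhds x. dist (g y) (g x) < e" if "isCont g x" for g :: "'a \<Rightarrow> real"
    using tendstoD[OF that[unfolded isCont_def tendsto_at_iff_tendsto_nhds] e] .
  ultimately have "\<forall>\<^sub>F y in nhds x. dist (?a y) (?a x) < e \<and> dist (?b y) (?b x) < e \<and> y \<in> S"
    using S by (intro eventually_conj) (auto simp: eventually_nhds_in_open)
  then obtain d where d: "d > 0" and
    D: "\<And>y. dist y x < d \<Longrightarrow> dist (?a y) (?a x) < e \<and> dist (?b y) (?b x) < e \<and> y \<in> S"
    unfolding eventually_nhds_metric by blast
  \<comment> \<open>With \<open>h = d / (2 * c)\<close> the parallelogram with sides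
    \<open>h *\<^sub>R u\<close> and \<open>h *\<^sub>R v\<close> stays within distance
    \<open>d\<close> of \<open>x\<close>. The summand 1 keeps \<open>c\<close> positive when
    \<open>u\<close> and \<open>v\<close> vanish.\<close>
  define c where "c = norm u + norm v + 1"
  define h where "h = d / (2 * c)"
  have pos: "c > 0" by (simp add: c_def add_nonneg_pos)
  then have h: "h > 0" using d by (simp add: h_def)
  have hd: "h * (norm u + norm v) < d"
  proof -
    have "h * (norm u + norm v) \<le> h * c" using h by (simp add: c_def)
    also have "\<dots> = d / 2" using pos by (simp add: h_def)
    finally show ?thesis using d by simp
  qed
  have near: "dist (x + s *\<^sub>R u + t *\<^sub>R v) x < d" if "0 \<le> s" "s \<le> h" "0 \<le> t" "t \<le> h" for s t
  proof -
    have "norm (s *\<^sub>R u + t *\<^sub>R v) \<le> s * norm u + t * norm v"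
      using norm_triangle_ineq[of "s *\<^sub>R u" "t *\<^sub>R v"] that by simp
    also have "\<dots> \<le> h * norm u + h * norm v" using that by (intro add_mono mult_right_mono) auto
    finally show ?thesis using hd by (simp add: dist_norm algebra_simps)
  qed
  obtain s t where st: "0 < s" "s < h" "0 < t" "t < h"
    "f (x + h *\<^sub>R u + h *\<^sub>R v) - f (x + h *\<^sub>R u) - f (x + h *\<^sub>R v) + f x = h * h * ?a (x + s *\<^sub>R u + t *\<^sub>R v)"
    using second_difference[OF f h, of x u v] near D by blast
  have near': "x + s *\<^sub>R v + t *\<^sub>R u \<in> S" if "0 \<le> s" "s \<le> h" "0 \<le> t" "t \<le> h" for s t
    using near[of t s] D that by (simp add: algebra_simps)
  obtain s' t' where st': "0 < s'" "s' < h" "0 < t'" "t' < h"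
    "f (x + h *\<^sub>R v + h *\<^sub>R u) - f (x + h *\<^sub>R v) - f (x + h *\<^sub>R u) + f x = h * h * ?b (x + s' *\<^sub>R v + t' *\<^sub>R u)"
    using second_difference[OF f h, of x v u] near' by blast
  have "h * h * ?a (x + s *\<^sub>R u + t *\<^sub>R v) = h * h * ?b (x + t' *\<^sub>R u + s' *\<^sub>R v)"
  proof -
    have "x + h *\<^sub>R v + h *\<^sub>R u = x + h *\<^sub>R u + h *\<^sub>R v" "x + t' *\<^sub>R u + s' *\<^sub>R v = x + s' *\<^sub>R v + t' *\<^sub>R u"
      by simp_all
    then show ?thesis using st(5) st'(5) by (simp only:)
  qed
  then have eq: "?a (x + s *\<^sub>R u + t *\<^sub>R v) = ?b (x + t' *\<^sub>R u + s' *\<^sub>R v)" using h by simp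
  have "dist (?a (x + s *\<^sub>R u + t *\<^sub>R v)) (?a x) < e" using D[OF near[of s t]] st by simp
  moreover have "dist (?b (x + t' *\<^sub>R u + s' *\<^sub>R v)) (?b x) < e" using D[OF near[of t' s']] st' by simp
  ultimately have "\<bar>?a x - ?b x\<bar> < 2 * e" unfolding eq dist_real_def by linarith
  then show False by (simp add: e_def)
qed

text \<open>Taking inner products with a fixed \<open>w\<close> reduces the claim to real-valued
  functions, and these products determine the vector.\<close>

lemma fderiv_fderiv_commute:
  fixes f :: "'a::real_inner \<Rightarrow> 'b::real_inner"
  assumes fd: "finite_dim TYPE('a)" and S: "open S" "x \<in> S" and f: "smooth_on S f"
  shows "fderiv (fderiv f) x u v = fderiv (fderiv f) x v u"
proof -
  have sb: "smooth_on S (fderiv f)" by (rule smooth_on_fderiv[OF fd S(1) f])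
  have D2: "frechet_derivative (\<lambda>x. frechet_derivative (\<lambda>x. f x \<bullet> w) (at x) u) (at x) v = fderiv (fderiv f) x v u \<bullet> w"
    for u v w
  proof -
    have fe: "fderiv f y u \<bullet> w = frechet_derivative (\<lambda>x. f x \<bullet> w) (at y) u" if "y \<in> S" for y
      using frechet_derivative_at[OF bounded_linear.has_derivative[OF bounded_linear_inner_left
            smooth_on_has_derivative[OF f that], of w]] by metis
    have "((\<lambda>y. fderiv f y u \<bullet> w) has_derivative (\<lambda>v. fderiv (fderiv f) x v u \<bullet> w)) (at x)"
      by (intro bounded_linear.has_derivative[OF bounded_linear_inner_left]
          bounded_linear.has_derivative[OF blinfun.bounded_linear_left] smooth_on_has_derivative[OF sb S(2)])
    from has_derivative_transform_within_open[OF this S fe]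
    show ?thesis by (metis frechet_derivative_at)
  qed
  have "smooth_on S (\<lambda>x. f x \<bullet> w)" for w
    by (rule smooth_on_compose_bounded_linear[OF bounded_linear_inner_left S(1) f])
  then have "Ck_on (Suc (Suc 0)) S (\<lambda>x. f x \<bullet> w)" for w unfolding smooth_on_def by blast
  from second_derivative_commute_real[OF this S]
  have "fderiv (fderiv f) x u v \<bullet> w = fderiv (fderiv f) x v u \<bullet> w" for w
    unfolding D2 by simp
  then show ?thesis by (metis inner_commute vector_eq_rdot)
qed

section \<open>Smooth inverses and coordinates in a moving basis\<close>

text \<open>A product rule for a factor \<open>f\<close> that is merely continuous: as
  \<open>g\<close> vanishes at \<open>x\<close> it is O(|y - x|), and multiplied by
  \<open>f y - f x\<close> it becomes o(|y - x|). This allows a product with an operator inverse to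
  be differentiated before the inverse is known to be differentiable.\<close>

lemma has_derivative_bilinear_at_zero:
  assumes "bounded_bilinear B" "isCont f x" "(g has_derivative g') (at x)" "g x = 0"
  shows "((\<lambda>y. B (f y) (g y)) has_derivative (\<lambda>v. B (f x) (g' v))) (at x)"
proof -
  interpret bounded_bilinear B by fact
  obtain K where K: "K > 0" "\<And>a b. norm (B a b) \<le> norm a * norm b * K" using pos_bounded by blast
  obtain C where C: "C > 0" "\<And>v. norm (g' v) \<le> norm v * C"
    using bounded_linear.pos_bounded[OF has_derivative_bounded_linear[OF assms(3)]] by blast
  have "((\<lambda>y. B (f y - f x) (g y)) has_derivative (\<lambda>v. 0)) (at x)"
    unfolding has_derivative_iff_norm
  proof
    have r: "((\<lambda>y. norm (g y - g x - g' (y - x)) / norm (y - x)) \<longlongrightarrow> 0) (at x)"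
      using assms(3) unfolding has_derivative_iff_norm by blast
    have "((\<lambda>y. norm (f y - f x) * (norm (g y - g x - g' (y - x)) / norm (y - x) + C) * K) \<longlongrightarrow>
        norm (f x - f x) * (0 + C) * K) (at x)"
      using assms(2) by (intro tendsto_intros r) (auto simp: isCont_def)
    then have lim: "((\<lambda>y. norm (f y - f x) * (norm (g y - g x - g' (y - x)) / norm (y - x) + C) * K) \<longlongrightarrow> 0) (at x)"
      by simp
    have "norm (norm (B (f y - f x) (g y) - B (f x - f x) (g x) - 0) / norm (y - x)) \<le>
        norm (f y - f x) * (norm (g y - g x - g' (y - x)) / norm (y - x) + C) * K" if "y \<noteq> x" for y
    proof -
      have n: "norm (y - x) > 0" using that by simp
      have "norm (g y) \<le> norm (g y - g x - g' (y - x)) + norm (g' (y - x))"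
        using norm_triangle_sub[of "g y" "g' (y - x)"] assms(4) by simp
      also have "\<dots> \<le> norm (g y - g x - g' (y - x)) + norm (y - x) * C" using C(2) by simp
      finally have "norm (B (f y - f x) (g y)) \<le> norm (f y - f x) * (norm (g y - g x - g' (y - x)) + norm (y - x) * C) * K"
        using K(1) order_trans[OF K(2)] by (meson mult_left_mono mult_right_mono norm_ge_zero less_imp_le)
      then have "norm (B (f y - f x) (g y)) / norm (y - x) \<le>
        norm (f y - f x) * (norm (g y - g x - g' (y - x)) + norm (y - x) * C) * K / norm (y - x)"
        by (rule divide_right_mono) simp
      also have "\<dots> = norm (f y - f x) * (norm (g y - g x - g' (y - x)) / norm (y - x) + C) * K"
        using n by (simp add: field_simps)
      finally show ?thesis by (simp add: zero_left)
    qed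
    then show "((\<lambda>y. norm (B (f y - f x) (g y) - B (f x - f x) (g x) - 0) / norm (y - x)) \<longlongrightarrow> 0) (at x)"
      by (intro Lim_null_comparison[OF _ lim]) (auto simp: eventually_at_filter)
  qed simp
  from has_derivative_add[OF bounded_linear.has_derivative[OF bounded_linear_right assms(3)] this, of "f x"]
  show ?thesis by (simp add: add_left[symmetric])
qed

text \<open>From \<open>R y = R x - R y (T y - T x) R x\<close> and continuity of \<open>R\<close>,
  \<open>has_derivative_bilinear_at_zero\<close> gives DR = - R DT R. The right side is of class C^k
  as soon as \<open>R\<close> is, so regularity climbs by induction.\<close>

lemma smooth_on_operator_inverse:
  fixes T R :: "'a::real_normed_vector \<Rightarrow> 'e::real_normed_vector \<Rightarrow>\<^sub>L 'e"
  assumes U: "open U" and T: "smooth_on U T" and R: "continuous_on U R"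
    and RT: "\<And>x. x \<in> U \<Longrightarrow> R x o\<^sub>L T x = id_blinfun"
    and TR: "\<And>x. x \<in> U \<Longrightarrow> T x o\<^sub>L R x = id_blinfun"
  shows "smooth_on U R"
proof -
  have R': "(R has_derivative (\<lambda>v. - (R x o\<^sub>L (frechet_derivative T (at x) v o\<^sub>L R x)))) (at x)"
    if x: "x \<in> U" for x
  proof -
    have "(T has_derivative frechet_derivative T (at x)) (at x)"
      using smooth_on_differentiable[OF T x] by (simp add: frechet_derivative_works)
    then have "((\<lambda>y. (T y - T x) o\<^sub>L R x) has_derivative (\<lambda>v. frechet_derivative T (at x) v o\<^sub>L R x)) (at x)"
      by (intro bounded_linear.has_derivative[OF bounded_bilinear.bounded_linear_left[OF bounded_bilinear_blinfun_compose]])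
        (auto intro!: derivative_eq_intros)
    moreover have "isCont R x" using R U x by (simp add: continuous_on_eq_continuous_at)
    ultimately have "((\<lambda>y. R y o\<^sub>L ((T y - T x) o\<^sub>L R x)) has_derivative
        (\<lambda>v. R x o\<^sub>L (frechet_derivative T (at x) v o\<^sub>L R x))) (at x)"
      by (intro has_derivative_bilinear_at_zero[OF bounded_bilinear_blinfun_compose]) auto
    then have "((\<lambda>y. R x - (R y o\<^sub>L ((T y - T x) o\<^sub>L R x))) has_derivative
        (\<lambda>v. 0 - (R x o\<^sub>L (frechet_derivative T (at x) v o\<^sub>L R x)))) (at x)"
      by (rule has_derivative_diff[OF has_derivative_const])
    then have "((\<lambda>y. R x - (R y o\<^sub>L ((T y - T x) o\<^sub>L R x))) has_derivative
        (\<lambda>v. - (R x o\<^sub>L (frechet_derivative T (at x) v o\<^sub>L R x)))) (at x)" by simp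
    then show ?thesis
    proof (rule has_derivative_transform_within_open[OF _ U x])
      fix y assume y: "y \<in> U"
      have a: "R y (T y e) = e" "T x (R x e) = e" for e
        using RT[OF y] TR[OF x] by (metis blinfun_apply_blinfun_compose blinfun_apply_id_blinfun)+
      show "R x - (R y o\<^sub>L ((T y - T x) o\<^sub>L R x)) = R y"
        by (rule blinfun_eqI) (simp add: blinfun.bilinear_simps a)
    qed
  qed
  have "Ck_on k U R" for k
  proof (induction k)
    case (Suc k)
    show ?case
    proof (rule Ck_on_SucI[OF U R'])
      show "Ck_on k U (\<lambda>x. - (R x o\<^sub>L (frechet_derivative T (at x) v o\<^sub>L R x)))" for v
        using T[unfolded smooth_on_def, rule_format, of "Suc k"]
        by (intro Ck_on_compose_bounded_linear[OF U bounded_linear_minus[OF bounded_linear_ident]]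
            Ck_on_bilinear[OF U bounded_bilinear_blinfun_compose] Suc) simp
    qed
  qed (simp add: R)
  then show ?thesis unfolding smooth_on_def by blast
qed

text \<open>Dimension count: a vector outside the range would enlarge the image of a basis to an
  independent set with one element too many.\<close>

lemma linear_inj_imp_surj_finite:
  fixes T :: "'e::real_vector \<Rightarrow> 'e"
  assumes "linear T" "inj T" "finite W" "span W = (UNIV :: 'e set)"
  shows "surj T"
proof (rule ccontr)
  obtain B :: "'e set" where "independent B" "UNIV \<subseteq> span B"
    using maximal_independent_subset[of "UNIV :: 'e set"] by metis
  then have B: "independent B" "span B = UNIV" by auto
  then have fB: "finite B" using independent_span_bound[OF assms(3)] assms(4) by blast
  have iTB: "independent (T ` B)"
    using linear_independent_injective_image[OF assms(1) B(1)] assms(2) by (simp add: inj_on_subset)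
  assume "\<not> surj T"
  then obtain e where e: "e \<notin> range T" by blast
  have "span (T ` B) = range T" using linear_span_image[OF assms(1)] B(2) by metis
  then have "independent (insert e (T ` B))" using e iTB by (metis independent_insertI)
  then have "card (insert e (T ` B)) \<le> card B"
    using independent_span_bound[OF fB] B(2) by blast
  moreover have "e \<notin> T ` B" using e by blast
  then have "card (insert e (T ` B)) = Suc (card B)"
    using fB card_image[of T B] inj_on_subset[OF assms(2)] by simp
  ultimately show False by simp
qed

text \<open>The operator \<open>T y\<close> that sends the basis at \<open>y\<^sub>0\<close> to the family at \<open>y\<close> is close to the
  identity, hence invertible, and the coordinates at \<open>y\<close> are those at \<open>y\<^sub>0\<close> of the preimage.\<close>

lemma smooth_coordinates:
  fixes w :: "'j \<Rightarrow> 'a::real_normed_vector \<Rightarrow> 'e::real_normed_vector" and c :: "'j \<Rightarrow> 'e \<Rightarrow>\<^sub>L real"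
  assumes J: "finite J" and U: "open U" "y\<^sub>0 \<in> U" and w: "\<And>j. j \<in> J \<Longrightarrow> smooth_on U (w j)"
    and c1: "\<And>e. (\<Sum>j\<in>J. c j e *\<^sub>R w j y\<^sub>0) = e"
    and c2: "\<And>a i. i \<in> J \<Longrightarrow> c i (\<Sum>j\<in>J. a j *\<^sub>R w j y\<^sub>0) = a i"
  obtains V \<kappa> where "open V" "y\<^sub>0 \<in> V" "V \<subseteq> U" "\<And>j. smooth_on V (\<kappa> j)"
    "\<And>y e. y \<in> V \<Longrightarrow> (\<Sum>j\<in>J. blinfun_apply (\<kappa> j y) e *\<^sub>R w j y) = e"
    "\<And>y a i. y \<in> V \<Longrightarrow> i \<in> J \<Longrightarrow> blinfun_apply (\<kappa> i y) (\<Sum>j\<in>J. a j *\<^sub>R w j y) = a i"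
proof -
  define T where "T y = (\<Sum>j\<in>J. blinfun_scaleR_left (w j y) o\<^sub>L c j)" for y
  have T_apply: "T y e = (\<Sum>j\<in>J. c j e *\<^sub>R w j y)" for y e
    by (simp add: T_def blinfun.sum_left)
  have "bounded_linear (\<lambda>x::'e. blinfun_scaleR_left x o\<^sub>L c j)" for j
    by (intro bounded_linear_intros)
  then have Tsm: "smooth_on U T" unfolding T_def
    by (intro smooth_on_sum U(1) smooth_on_compose_bounded_linear[OF _ U(1) w])
  \<comment> \<open>Distance below 1/2 from the identity gives
    \<open>norm e \<le> 2 * norm (T y e)\<close>. This yields injectivity and the bound 2 on the
    inverse.\<close>
  define V where "V = {y \<in> U. norm (T y - id_blinfun) < 1/2}"
  have "V = U \<inter> (\<lambda>y. norm (T y - id_blinfun)) -` {..<1/2}" unfolding V_def by auto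
  moreover have "open \<dots>"
    by (intro continuous_open_preimage continuous_intros smooth_on_continuous[OF Tsm] U(1))
  ultimately have oV: "open V" by simp
  have "T y\<^sub>0 = id_blinfun" by (rule blinfun_eqI) (simp add: T_apply c1)
  then have y0V: "y\<^sub>0 \<in> V" using U(2) by (simp add: V_def)
  have VU: "V \<subseteq> U" unfolding V_def by auto
  have below: "norm e \<le> 2 * norm (T y e)" if "y \<in> V" for y e
  proof -
    have "norm ((T y - id_blinfun) e) \<le> 1/2 * norm e"
      using norm_blinfun[of "T y - id_blinfun" e] mult_right_mono[of "norm (T y - id_blinfun)" "1/2" "norm e"] that
      unfolding V_def by simp
    moreover have "norm e \<le> norm (T y e) + norm ((T y - id_blinfun) e)"
      using norm_triangle_sub[of e "T y e"] by (simp add: blinfun.diff_left norm_minus_commute)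
    ultimately show ?thesis by simp
  qed
  have linT: "linear (blinfun_apply (T y))" for y
    by (rule bounded_linear.linear) (rule blinfun.bounded_linear_right)
  have injT: "inj (blinfun_apply (T y))" if "y \<in> V" for y
    unfolding linear_injective_0[OF linT] using below[OF that] by (metis norm_le_zero_iff mult_zero_right norm_zero)
  have span: "span ((\<lambda>j. w j y\<^sub>0) ` J) = UNIV"
  proof -
    have "e \<in> span ((\<lambda>j. w j y\<^sub>0) ` J)" for e
      by (subst c1[of e, symmetric]) (intro span_sum span_scale span_base imageI)
    then show ?thesis by blast
  qed
  have surjT: "surj (blinfun_apply (T y))" if "y \<in> V" for y
    using linear_inj_imp_surj_finite[OF linT injT[OF that] _ span] J by simp
  define R where "R y = Blinfun (inv (blinfun_apply (T y)))" for y
  have invT: "T y (inv (blinfun_apply (T y)) e) = e" if "y \<in> V" for y e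
    using surjT[OF that] by (rule surj_f_inv_f)
  have bl: "bounded_linear (inv (blinfun_apply (T y)))" if "y \<in> V" for y
  proof (rule bounded_linear_intro[where K = 2])
    note inj = injT[OF that, THEN injD]
    show "inv (blinfun_apply (T y)) (a + b) = inv (blinfun_apply (T y)) a + inv (blinfun_apply (T y)) b" for a b
      by (rule inj) (simp add: invT[OF that] blinfun.add_right)
    show "inv (blinfun_apply (T y)) (r *\<^sub>R b) = r *\<^sub>R inv (blinfun_apply (T y)) b" for r b
      by (rule inj) (simp add: invT[OF that] blinfun.scaleR_right)
    show "norm (inv (blinfun_apply (T y)) e) \<le> norm e * 2" for e
      using below[OF that, of "inv (blinfun_apply (T y)) e"] by (simp add: invT[OF that])
  qed
  have R_apply: "blinfun_apply (R y) = inv (blinfun_apply (T y))" if "y \<in> V" for y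
    unfolding R_def by (rule bounded_linear_Blinfun_apply[OF bl[OF that]])
  have TR: "T y (R y e) = e" and RT: "R y (T y e) = e" if "y \<in> V" for y e
    using invT[OF that] inv_f_f[OF injT[OF that]] by (simp_all add: R_apply[OF that])
  have nR: "norm (R y) \<le> 2" if "y \<in> V" for y
  proof (rule norm_blinfun_bound)
    show "norm (R y e) \<le> 2 * norm e" for e using below[OF that, of "R y e"] by (simp add: TR[OF that])
  qed simp
  have "continuous_on V R"
    unfolding continuous_on_def
  proof
    fix x assume x: "x \<in> V"
    \<comment> \<open>The difference of the inverses is \<open>R y (T x - T y) R x\<close>; the
      constant 4 is the product of the two bounds 2.\<close>
    have le: "norm (R y - R x) \<le> 4 * norm (T x - T y)" if y: "y \<in> V" for y
    proof -
      have "R y - R x = R y o\<^sub>L ((T x - T y) o\<^sub>L R x)"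
        by (rule blinfun_eqI) (simp add: blinfun.bilinear_simps RT[OF y] TR[OF x])
      then have "norm (R y - R x) \<le> norm (R y) * norm ((T x - T y) o\<^sub>L R x)"
        using norm_blinfun_compose[of "R y" "(T x - T y) o\<^sub>L R x"] by simp
      also have "\<dots> \<le> norm (R y) * (norm (T x - T y) * norm (R x))"
        by (intro mult_left_mono norm_blinfun_compose norm_ge_zero)
      also have "\<dots> \<le> 2 * (norm (T x - T y) * 2)"
        by (intro mult_mono nR x y) auto
      finally show ?thesis by simp
    qed
    have "((\<lambda>y. 4 * norm (T x - T y)) \<longlongrightarrow> 4 * norm (T x - T x)) (at x within V)"
      using continuous_on_subset[OF smooth_on_continuous[OF Tsm] VU] x
      by (intro tendsto_intros) (auto simp: continuous_on_def)
    then have lim: "((\<lambda>y. 4 * norm (T x - T y)) \<longlongrightarrow> 0) (at x within V)" by simp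
    have "\<forall>\<^sub>F y in at x within V. norm (R y - R x) \<le> 4 * norm (T x - T y)"
      unfolding eventually_at_filter by (intro always_eventually allI impI le)
    from Lim_null_comparison[OF this lim] have "((\<lambda>y. R y - R x) \<longlongrightarrow> 0) (at x within V)" .
    then show "(R \<longlongrightarrow> R x) (at x within V)" by (simp add: LIM_zero_iff)
  qed
  then have Rsm: "smooth_on V R"
    by (rule smooth_on_operator_inverse[OF oV smooth_on_subset[OF Tsm VU]])
      (auto intro!: blinfun_eqI simp: RT TR)
  show ?thesis
  proof (rule that[OF oV y0V VU])
    show "smooth_on V (\<lambda>y. c j o\<^sub>L R y)" for j
      by (intro smooth_on_blinfun_compose oV Rsm smooth_on_const)
    show "(\<Sum>j\<in>J. (c j o\<^sub>L R y) e *\<^sub>R w j y) = e" if "y \<in> V" for y e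
      using TR[OF that, of e] by (simp add: T_apply)
    show "(c i o\<^sub>L R y) (\<Sum>j\<in>J. a j *\<^sub>R w j y) = a i" if y: "y \<in> V" and i: "i \<in> J" for y a i
    proof -
      have "T y (\<Sum>j\<in>J. a j *\<^sub>R w j y\<^sub>0) = (\<Sum>j\<in>J. a j *\<^sub>R w j y)"
        unfolding T_apply by (rule sum.cong) (simp_all add: c2)
      then have "R y (\<Sum>j\<in>J. a j *\<^sub>R w j y) = (\<Sum>j\<in>J. a j *\<^sub>R w j y\<^sub>0)"
        using RT[OF y] by metis
      then show ?thesis using c2[OF i] by simp
    qed
  qed
qed

section \<open>Bump functions and compact balls\<close>

text \<open>\<open>flat_exp 0\<close> is the classical flat function exp(-1/t). The powers of 1/t
  make the family closed under differentiation up to linear combinations, so smoothness follows by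
  an induction that keeps \<open>n\<close> arbitrary.\<close>

definition flat_exp :: "nat \<Rightarrow> real \<Rightarrow> real"
  where "flat_exp n t = (if t > 0 then inverse t ^ n * exp (- inverse t) else 0)"

lemma flat_exp_tendsto_0: "(flat_exp n \<longlongrightarrow> 0) (at 0)"
proof (rule filterlim_split_at)
  show "(flat_exp n \<longlongrightarrow> 0) (at_left 0)"
    by (rule tendsto_eventually) (auto simp: flat_exp_def eventually_at_filter)
  have "((\<lambda>t. inverse t ^ n / exp (inverse t)) \<longlongrightarrow> (0::real)) (at_right 0)"
    by (rule filterlim_compose[OF tendsto_power_div_exp_0 filterlim_inverse_at_top_right])
  then show "(flat_exp n \<longlongrightarrow> 0) (at_right 0)"
    by (rule Lim_transform_eventually) (auto simp: flat_exp_def eventually_at_filter exp_minus field_simps)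
qed

lemma flat_exp_deriv:
  "(flat_exp n has_real_derivative (flat_exp (n + 2) t - real n * flat_exp (n + 1) t)) (at t)"
proof -
  consider "t > 0" | "t < 0" | "t = 0" by linarith
  then show ?thesis
  proof cases
    case 1
    have d: "((\<lambda>t. inverse t ^ n * exp (- inverse t)) has_real_derivative (flat_exp (n + 2) t - real n * flat_exp (n + 1) t)) (at t)"
    proof -
      have "(inverse has_real_derivative - (inverse t * inverse t)) (at t)"
        using DERIV_inverse[of t UNIV] 1 by (simp add: power2_eq_square)
      from DERIV_mult[OF DERIV_power[OF this, of n] DERIV_chain2[OF DERIV_exp DERIV_minus[OF this]]]
      show ?thesis
        by (rule DERIV_cong) (cases n; use 1 in \<open>simp add: flat_exp_def algebra_simps\<close>)
    qed
    show ?thesis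
      by (rule has_field_derivative_transform_within_open[OF d, of "{0<..}"]) (use 1 in \<open>auto simp: flat_exp_def\<close>)
  next
    case 2
    show ?thesis
      by (rule has_field_derivative_transform_within_open[of "\<lambda>t. 0" _ _ "{..<0}"])
        (use 2 in \<open>auto simp: flat_exp_def\<close>)
  next
    case 3
    \<comment> \<open>The difference quotient at 0 is again a member of the family,
      \<open>flat_exp (Suc n)\<close>.\<close>
    have "((\<lambda>h. flat_exp n h / h) \<longlongrightarrow> 0) (at 0)"
      by (rule Lim_transform_eventually[OF flat_exp_tendsto_0[of "Suc n"]])
        (auto simp: flat_exp_def eventually_at_filter field_simps)
    then show ?thesis using 3 by (simp add: DERIV_def flat_exp_def)
  qed
qed

lemma smooth_on_flat_exp: "open S \<Longrightarrow> smooth_on S (flat_exp n)"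
proof -
  assume S: "open S"
  have "Ck_on k S (flat_exp n)" for k
  proof (induction k arbitrary: n)
    case 0
    then show ?case
      using flat_exp_deriv by (auto intro!: continuous_at_imp_continuous_on DERIV_isCont)
  next
    case (Suc k)
    show ?case
    proof (rule Ck_on_SucI[OF S])
      show "(flat_exp n has_derivative (\<lambda>v. v * flat_exp (n + 2) t + (- v * real n) * flat_exp (n + 1) t)) (at t)" for t
      proof -
        have "(\<lambda>v. v * flat_exp (n + 2) t + (- v * real n) * flat_exp (n + 1) t) =
            (*) (flat_exp (n + 2) t - real n * flat_exp (n + 1) t)" by (auto simp: algebra_simps)
        then show ?thesis using flat_exp_deriv[of n t] by (simp only: has_field_derivative_def)
      qed
      show "Ck_on k S (\<lambda>t. v * flat_exp (n + 2) t + (- v * real n) * flat_exp (n + 1) t)" for v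
        by (intro Ck_on_add S Ck_on_compose_bounded_linear[OF S bounded_linear_mult_right] Suc)
    qed
  qed
  then show ?thesis unfolding smooth_on_def by blast
qed

lemma finite_dim_real: "finite_dim TYPE(real)"
proof -
  have "x \<in> span {1::real}" for x :: real
    using span_scale[of 1 "{1::real}" x] by (simp add: span_base)
  then show ?thesis unfolding finite_dim_def by (intro exI[of _ "{1::real}"]) auto
qed

text \<open>The flat function is applied to \<open>r\<^sup>2\<close> minus the squared distance,
  since the square, unlike the distance, is smooth at the centre.\<close>

lemma smooth_bump:
  fixes y\<^sub>0 :: "'a::real_inner"
  assumes "r > 0"
  obtains b :: "'a \<Rightarrow> real" where "smooth_on UNIV b" "\<And>y. dist y\<^sub>0 y < r \<Longrightarrow> b y > 0" "\<And>y. dist y\<^sub>0 y \<ge> r \<Longrightarrow> b y = 0"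
proof
  let ?b = "\<lambda>y::'a. flat_exp 0 (r\<^sup>2 - (y - y\<^sub>0) \<bullet> (y - y\<^sub>0))"
  have "smooth_on UNIV (\<lambda>y::'a. r\<^sup>2 - (y - y\<^sub>0) \<bullet> (y - y\<^sub>0))"
    by (intro smooth_on_diff smooth_on_inner smooth_on_const smooth_on_bounded_linear[OF bounded_linear_ident] open_UNIV)
  from smooth_on_compose[OF finite_dim_real open_UNIV open_UNIV _ this smooth_on_flat_exp[OF open_UNIV]]
  show "smooth_on UNIV ?b" by simp
  show "?b y > 0" if "dist y\<^sub>0 y < r" for y
    using that assms by (simp add: flat_exp_def dist_norm norm_minus_commute dot_square_norm power_strict_mono)
  show "?b y = 0" if "dist y\<^sub>0 y \<ge> r" for y
    using that assms by (simp add: flat_exp_def dist_norm norm_minus_commute dot_square_norm power_mono not_less)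
qed

text \<open>The ball is a closed subset of the continuous image of a cube of coordinates with
  respect to \<open>onb\<close>. Compactness will make the support of a bump function closed in a
  Hausdorff manifold.\<close>

lemma compact_cball_finite_dim:
  fixes y :: "'a::real_inner"
  assumes "finite_dim TYPE('a)"
  shows "compact (cball y r)"
proof -
  have *: "compact {\<Sum>b\<in>B. t b *\<^sub>R b | t. \<forall>b\<in>B. \<bar>t b\<bar> \<le> r}" if "finite B" for B :: "'a set" and r :: real
    using that
  proof induction
    case (insert b B)
    let ?C = "{\<Sum>b\<in>B. t b *\<^sub>R b | t. \<forall>b\<in>B. \<bar>t b\<bar> \<le> r}"
    define C where "C = ?C"
    let ?Y = "{\<Sum>b\<in>insert b B. t b *\<^sub>R b | t. \<forall>b\<in>insert b B. \<bar>t b\<bar> \<le> r}"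
    have "compact ((\<lambda>p. fst p *\<^sub>R b + snd p) ` ({-r..r} \<times> C))"
      unfolding C_def by (intro compact_continuous_image compact_Times insert.IH continuous_intros compact_Icc)
    also have "(\<lambda>p. fst p *\<^sub>R b + snd p) ` ({-r..r} \<times> C) = ?Y"
    proof (intro equalityI image_subsetI subsetI)
      fix p assume "p \<in> {-r..r} \<times> C"
      then have s: "\<bar>fst p\<bar> \<le> r" and "snd p \<in> C" by auto
      then obtain t where t: "\<forall>b\<in>B. \<bar>t b\<bar> \<le> r" "snd p = (\<Sum>b\<in>B. t b *\<^sub>R b)"
        unfolding C_def by blast
      have "(\<Sum>b\<in>B. t b *\<^sub>R b) = (\<Sum>b'\<in>B. (t(b := fst p)) b' *\<^sub>R b')"
        using insert.hyps by (intro sum.cong) auto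
      then show "fst p *\<^sub>R b + snd p \<in> ?Y"
        using s t insert.hyps by (intro CollectI exI[of _ "t(b := fst p)"]) auto
    next
      fix z assume "z \<in> ?Y"
      then obtain t where t: "z = t b *\<^sub>R b + (\<Sum>b\<in>B. t b *\<^sub>R b)" "\<forall>b\<in>insert b B. \<bar>t b\<bar> \<le> r"
        using insert.hyps by auto
      then have "(\<Sum>b\<in>B. t b *\<^sub>R b) \<in> C" unfolding C_def by auto
      then show "z \<in> (\<lambda>p. fst p *\<^sub>R b + snd p) ` ({-r..r} \<times> C)"
        using t by (intro image_eqI[of _ _ "(t b, \<Sum>b\<in>B. t b *\<^sub>R b)"]) auto
    qed
    finally show ?case .
  qed simp
  have "cball (0::'a) r \<subseteq> {\<Sum>b\<in>onb. t b *\<^sub>R b | t. \<forall>b\<in>onb. \<bar>t b\<bar> \<le> r}"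
  proof
    fix x :: 'a assume x: "x \<in> cball 0 r"
    have "\<bar>x \<bullet> b\<bar> \<le> r" if "b \<in> onb" for b
    proof -
      have "norm b = 1" using onb_inner[OF assms that that] by (simp add: norm_eq_sqrt_inner)
      then show ?thesis using Cauchy_Schwarz_ineq2[of x b] x by simp
    qed
    then show "x \<in> {\<Sum>b\<in>onb. t b *\<^sub>R b | t. \<forall>b\<in>onb. \<bar>t b\<bar> \<le> r}"
      using onb_expand[OF assms, of x] by blast
  qed
  then have "compact (cball (0::'a) r)"
    using compact_Int_closed[OF *[OF finite_onb[OF assms]] closed_cball, of r 0 r] by (simp add: Int_absorb1)
  then have "compact ((+) y ` cball 0 r)" by (rule compact_translation)
  then show ?thesis by simp
qed

section \<open>The Courant bracket in coordinates and its pullback\<close>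

text \<open>\<open>blinfun.prod_left (Y y) o\<^sub>L fderiv \<alpha> y\<close> is w \<mapsto>
  (D\<alpha> w)(Y), so the last parenthesis is the contraction of d\<alpha> with \<open>Y\<close>.
  The two terms before it form the Lie derivative of \<beta> along \<open>X\<close>.\<close>

definition coord_courant :: "('a::real_inner \<Rightarrow> 'a) \<Rightarrow> ('a \<Rightarrow> 'a \<Rightarrow>\<^sub>L real) \<Rightarrow> ('a \<Rightarrow> 'a) \<Rightarrow> ('a \<Rightarrow> 'a \<Rightarrow>\<^sub>L real) \<Rightarrow>
    'a \<Rightarrow> 'a \<times> ('a \<Rightarrow>\<^sub>L real)"
  where "coord_courant X \<alpha> Y \<beta> y = (fderiv Y y (X y) - fderiv X y (Y y),
    fderiv \<beta> y (X y) + (\<beta> y o\<^sub>L fderiv X y) - (fderiv \<alpha> y (Y y) - (blinfun.prod_left (Y y) o\<^sub>L fderiv \<alpha> y)))"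

text \<open>The product rule applied to both sides of \<open>rel\<close>. The second derivative of
  \<phi> enters here and in \<open>derivative_of_pullback\<close>; in the bracket these terms cancel
  by symmetry.\<close>

lemma derivative_along:
  fixes \<phi> :: "'q::real_inner \<Rightarrow> 'm::real_inner" and X :: "'i \<Rightarrow> 'm \<Rightarrow> 'm"
  assumes fd: "finite_dim TYPE('q)" and S: "open S" "y \<in> S" and \<phi>: "smooth_on S \<phi>"
    and f: "\<And>i. i \<in> I \<Longrightarrow> (f i has_derivative f' i) (at y)"
    and X: "\<And>i. i \<in> I \<Longrightarrow> X i differentiable (at (\<phi> y))"
    and X0: "X0 differentiable (at y)"
    and rel: "\<And>y'. y' \<in> S \<Longrightarrow> fderiv \<phi> y' (X0 y') = (\<Sum>i\<in>I. f i y' *\<^sub>R X i (\<phi> y'))"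
  shows "fderiv (fderiv \<phi>) y v (X0 y) + fderiv \<phi> y (fderiv X0 y v) =
    (\<Sum>i\<in>I. f' i v *\<^sub>R X i (\<phi> y) + f i y *\<^sub>R fderiv (X i) (\<phi> y) (fderiv \<phi> y v))"
proof -
  have "((\<lambda>y'. fderiv \<phi> y' (X0 y')) has_derivative (\<lambda>v. fderiv \<phi> y (fderiv X0 y v) + fderiv (fderiv \<phi>) y v (X0 y))) (at y)"
    by (rule blinfun.FDERIV[OF smooth_on_has_derivative[OF smooth_on_fderiv[OF fd S(1) \<phi>] S(2)] fderiv_works[OF X0]])
  from has_derivative_transform_within_open[OF this S rel]
  have 1: "((\<lambda>y'. \<Sum>i\<in>I. f i y' *\<^sub>R X i (\<phi> y')) has_derivative
      (\<lambda>v. fderiv \<phi> y (fderiv X0 y v) + fderiv (fderiv \<phi>) y v (X0 y))) (at y)" .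
  have 2: "((\<lambda>y'. \<Sum>i\<in>I. f i y' *\<^sub>R X i (\<phi> y')) has_derivative
      (\<lambda>v. \<Sum>i\<in>I. f i y *\<^sub>R fderiv (X i) (\<phi> y) (fderiv \<phi> y v) + f' i v *\<^sub>R X i (\<phi> y))) (at y)"
    by (intro has_derivative_sum has_derivative_scaleR f
        has_derivative_compose[OF smooth_on_has_derivative[OF \<phi> S(2)] fderiv_works[OF X]])
  show ?thesis using fun_cong[OF has_derivative_unique[OF 1 2], of v] by (simp add: add.commute)
qed

lemma derivative_of_pullback:
  fixes \<phi> :: "'q::real_inner \<Rightarrow> 'm::real_inner" and \<alpha> :: "'i \<Rightarrow> 'm \<Rightarrow> 'm \<Rightarrow>\<^sub>L real"
  assumes fd: "finite_dim TYPE('q)" and S: "open S" "y \<in> S" and \<phi>: "smooth_on S \<phi>"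
    and f: "\<And>i. i \<in> I \<Longrightarrow> (f i has_derivative f' i) (at y)"
    and \<alpha>: "\<And>i. i \<in> I \<Longrightarrow> \<alpha> i differentiable (at (\<phi> y))"
    and rel: "\<And>y'. y' \<in> S \<Longrightarrow> \<alpha>0 y' = (\<Sum>i\<in>I. f i y' *\<^sub>R (\<alpha> i (\<phi> y') o\<^sub>L fderiv \<phi> y'))"
  shows "fderiv \<alpha>0 y u v = (\<Sum>i\<in>I. f' i u * \<alpha> i (\<phi> y) (fderiv \<phi> y v) +
    f i y * fderiv (\<alpha> i) (\<phi> y) (fderiv \<phi> y u) (fderiv \<phi> y v) + f i y * \<alpha> i (\<phi> y) (fderiv (fderiv \<phi>) y u v))"
proof -
  have "((\<lambda>y'. \<Sum>i\<in>I. f i y' *\<^sub>R (\<alpha> i (\<phi> y') o\<^sub>L fderiv \<phi> y')) has_derivative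
      (\<lambda>u. \<Sum>i\<in>I. f i y *\<^sub>R ((\<alpha> i (\<phi> y) o\<^sub>L fderiv (fderiv \<phi>) y u) + (fderiv (\<alpha> i) (\<phi> y) (fderiv \<phi> y u) o\<^sub>L fderiv \<phi> y)) +
        f' i u *\<^sub>R (\<alpha> i (\<phi> y) o\<^sub>L fderiv \<phi> y))) (at y)" (is "(_ has_derivative ?D) _")
    by (intro has_derivative_sum has_derivative_scaleR f
        bounded_bilinear.FDERIV[OF bounded_bilinear_blinfun_compose]
        has_derivative_compose[OF smooth_on_has_derivative[OF \<phi> S(2)] fderiv_works[OF \<alpha>]]
        smooth_on_has_derivative[OF smooth_on_fderiv[OF fd S(1) \<phi>] S(2)])
  from has_derivative_transform_within_open[OF this S rel[symmetric]]
  have 1: "(\<alpha>0 has_derivative ?D) (at y)" .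
  then have "\<alpha>0 differentiable (at y)" unfolding differentiable_def by blast
  from has_derivative_unique[OF fderiv_works[OF this] 1]
  show ?thesis by (simp add: blinfun.sum_left blinfun.bilinear_simps algebra_simps)
qed

text \<open>Sections over \<open>Q\<close> need not be extended to \<open>M\<close>: it suffices to write them as combinations,
  with coefficients on \<open>Q\<close>, of sections over \<open>M\<close>. The terms in \<open>df\<close> vanish by isotropy.\<close>

lemma coord_courant_pullback:
  fixes \<phi> :: "'q::real_inner \<Rightarrow> 'm::real_inner"
    and X :: "'i \<Rightarrow> 'm \<Rightarrow> 'm" and \<alpha> :: "'i \<Rightarrow> 'm \<Rightarrow> 'm \<Rightarrow>\<^sub>L real"
    and Y :: "'j \<Rightarrow> 'm \<Rightarrow> 'm" and \<beta> :: "'j \<Rightarrow> 'm \<Rightarrow> 'm \<Rightarrow>\<^sub>L real"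
  assumes fd: "finite_dim TYPE('q)" and S: "open S" "y \<in> S" and \<phi>: "smooth_on S \<phi>"
    and f: "\<And>i. i \<in> I \<Longrightarrow> (f i has_derivative f' i) (at y)"
    and g: "\<And>j. j \<in> J \<Longrightarrow> (g j has_derivative g' j) (at y)"
    and X: "\<And>i. i \<in> I \<Longrightarrow> X i differentiable (at (\<phi> y))" "\<And>i. i \<in> I \<Longrightarrow> \<alpha> i differentiable (at (\<phi> y))"
    and Y: "\<And>j. j \<in> J \<Longrightarrow> Y j differentiable (at (\<phi> y))" "\<And>j. j \<in> J \<Longrightarrow> \<beta> j differentiable (at (\<phi> y))"
    and X0: "X0 differentiable (at y)" and Y0: "Y0 differentiable (at y)"
    and rel: "\<And>y'. y' \<in> S \<Longrightarrow> fderiv \<phi> y' (X0 y') = (\<Sum>i\<in>I. f i y' *\<^sub>R X i (\<phi> y'))"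
      "\<And>y'. y' \<in> S \<Longrightarrow> \<alpha>0 y' = (\<Sum>i\<in>I. f i y' *\<^sub>R (\<alpha> i (\<phi> y') o\<^sub>L fderiv \<phi> y'))"
      "\<And>y'. y' \<in> S \<Longrightarrow> fderiv \<phi> y' (Y0 y') = (\<Sum>j\<in>J. g j y' *\<^sub>R Y j (\<phi> y'))"
      "\<And>y'. y' \<in> S \<Longrightarrow> \<beta>0 y' = (\<Sum>j\<in>J. g j y' *\<^sub>R (\<beta> j (\<phi> y') o\<^sub>L fderiv \<phi> y'))"
    and iso: "\<And>i j v. i \<in> I \<Longrightarrow> j \<in> J \<Longrightarrow> f' i v * (\<beta> j (\<phi> y) (X i (\<phi> y)) + \<alpha> i (\<phi> y) (Y j (\<phi> y))) = 0"
  shows "fderiv \<phi> y (fst (coord_courant X0 \<alpha>0 Y0 \<beta>0 y)) =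
      (\<Sum>j\<in>J. g' j (X0 y) *\<^sub>R Y j (\<phi> y)) - (\<Sum>i\<in>I. f' i (Y0 y) *\<^sub>R X i (\<phi> y)) +
      (\<Sum>i\<in>I. \<Sum>j\<in>J. (f i y * g j y) *\<^sub>R fst (coord_courant (X i) (\<alpha> i) (Y j) (\<beta> j) (\<phi> y)))" (is ?A)
    and "snd (coord_courant X0 \<alpha>0 Y0 \<beta>0 y) =
      ((\<Sum>j\<in>J. g' j (X0 y) *\<^sub>R \<beta> j (\<phi> y)) - (\<Sum>i\<in>I. f' i (Y0 y) *\<^sub>R \<alpha> i (\<phi> y)) +
      (\<Sum>i\<in>I. \<Sum>j\<in>J. (f i y * g j y) *\<^sub>R snd (coord_courant (X i) (\<alpha> i) (Y j) (\<beta> j) (\<phi> y)))) o\<^sub>L fderiv \<phi> y" (is ?B)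
proof -
  define z P D2 u w where defs: "z = \<phi> y" "P = fderiv \<phi> y" "D2 = fderiv (fderiv \<phi>) y" "u = X0 y" "w = Y0 y"
  have sym: "D2 a b = D2 b a" for a b
    unfolding defs by (rule fderiv_fderiv_commute[OF fd S \<phi>])
  have Pu: "P u = (\<Sum>i\<in>I. f i y *\<^sub>R X i z)" and Pw: "P w = (\<Sum>j\<in>J. g j y *\<^sub>R Y j z)"
    using rel(1,3)[OF S(2)] by (simp_all add: defs)
  have \<beta>0: "\<beta>0 y a = (\<Sum>j\<in>J. g j y * \<beta> j z (P a))" for a
    using rel(4)[OF S(2)] by (simp add: defs blinfun.sum_left blinfun.scaleR_left)
  have E1: "P (fderiv X0 y v) = (\<Sum>i\<in>I. f' i v *\<^sub>R X i z) + (\<Sum>i\<in>I. f i y *\<^sub>R fderiv (X i) z (P v)) - D2 v u" for v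
    using derivative_along[OF fd S \<phi> f X(1) X0 rel(1), of v]
    by (simp add: defs sum.distrib algebra_simps)
  have E2: "P (fderiv Y0 y v) = (\<Sum>j\<in>J. g' j v *\<^sub>R Y j z) + (\<Sum>j\<in>J. g j y *\<^sub>R fderiv (Y j) z (P v)) - D2 v w" for v
    using derivative_along[OF fd S \<phi> g Y(1) Y0 rel(3), of v]
    by (simp add: defs sum.distrib algebra_simps)
  have E3: "fderiv \<alpha>0 y a b = (\<Sum>i\<in>I. f' i a * \<alpha> i z (P b)) + (\<Sum>i\<in>I. f i y * fderiv (\<alpha> i) z (P a) (P b)) +
      (\<Sum>i\<in>I. f i y * \<alpha> i z (D2 a b))" for a b
    using derivative_of_pullback[OF fd S \<phi> f X(2) rel(2), of a b]
    by (simp add: defs sum.distrib)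
  have E4: "fderiv \<beta>0 y a b = (\<Sum>j\<in>J. g' j a * \<beta> j z (P b)) + (\<Sum>j\<in>J. g j y * fderiv (\<beta> j) z (P a) (P b)) +
      (\<Sum>j\<in>J. g j y * \<beta> j z (D2 a b))" for a b
    using derivative_of_pullback[OF fd S \<phi> g Y(2) rel(4), of a b]
    by (simp add: defs sum.distrib)
  have YX: "(\<Sum>j\<in>J. g j y *\<^sub>R fderiv (Y j) z (P u)) = (\<Sum>i\<in>I. \<Sum>j\<in>J. (f i y * g j y) *\<^sub>R fderiv (Y j) z (X i z))"
    unfolding Pu by (subst sum.swap)
      (simp add: blinfun.sum_right blinfun.scaleR_right scaleR_sum_right mult.commute)
  have XY: "(\<Sum>i\<in>I. f i y *\<^sub>R fderiv (X i) z (P w)) = (\<Sum>i\<in>I. \<Sum>j\<in>J. (f i y * g j y) *\<^sub>R fderiv (X i) z (Y j z))"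
    unfolding Pw by (simp add: blinfun.sum_right blinfun.scaleR_right scaleR_sum_right)
  show ?A
  proof -
    have "P (fst (coord_courant X0 \<alpha>0 Y0 \<beta>0 y)) = P (fderiv Y0 y u) - P (fderiv X0 y w)"
      by (simp add: coord_courant_def defs blinfun.diff_right)
    also have "\<dots> = (\<Sum>j\<in>J. g' j u *\<^sub>R Y j z) - (\<Sum>i\<in>I. f' i w *\<^sub>R X i z) +
        ((\<Sum>i\<in>I. \<Sum>j\<in>J. (f i y * g j y) *\<^sub>R fderiv (Y j) z (X i z)) -
         (\<Sum>i\<in>I. \<Sum>j\<in>J. (f i y * g j y) *\<^sub>R fderiv (X i) z (Y j z)))"
      \<comment> \<open>\<open>D2 u w\<close> and \<open>D2 w u\<close> enter with opposite signs
        and cancel.\<close>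
      unfolding E1 E2 YX XY using sym[of u w] by simp
    also have "(\<Sum>i\<in>I. \<Sum>j\<in>J. (f i y * g j y) *\<^sub>R fderiv (Y j) z (X i z)) -
         (\<Sum>i\<in>I. \<Sum>j\<in>J. (f i y * g j y) *\<^sub>R fderiv (X i) z (Y j z)) =
        (\<Sum>i\<in>I. \<Sum>j\<in>J. (f i y * g j y) *\<^sub>R fst (coord_courant (X i) (\<alpha> i) (Y j) (\<beta> j) z))"
      by (simp add: coord_courant_def sum_subtractf scaleR_diff_right)
    finally show ?thesis by (simp add: defs)
  qed
  show ?B
  proof (rule blinfun_eqI)
    fix v
    define p where "p = P v"
    have Bu: "(\<Sum>j\<in>J. g j y * fderiv (\<beta> j) z (P u) p) = (\<Sum>i\<in>I. \<Sum>j\<in>J. f i y * g j y * fderiv (\<beta> j) z (X i z) p)"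
      unfolding Pu by (subst sum.swap)
        (simp add: blinfun.sum_right blinfun.sum_left blinfun.bilinear_simps sum_distrib_left mult_ac)
    have Aw: "(\<Sum>i\<in>I. f i y * fderiv (\<alpha> i) z (P w) p) = (\<Sum>i\<in>I. \<Sum>j\<in>J. f i y * g j y * fderiv (\<alpha> i) z (Y j z) p)"
      unfolding Pw
      by (simp add: blinfun.sum_right blinfun.sum_left blinfun.bilinear_simps sum_distrib_left mult_ac)
    have Ap: "(\<Sum>i\<in>I. f i y * fderiv (\<alpha> i) z p (P w)) = (\<Sum>i\<in>I. \<Sum>j\<in>J. f i y * g j y * fderiv (\<alpha> i) z p (Y j z))"
      unfolding Pw
      by (simp add: blinfun.sum_right blinfun.sum_left blinfun.bilinear_simps sum_distrib_left mult_ac)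
    have Af: "(\<Sum>i\<in>I. f' i v * \<alpha> i z (P w)) = (\<Sum>i\<in>I. \<Sum>j\<in>J. g j y * (f' i v * \<alpha> i z (Y j z)))"
      unfolding Pw
      by (simp add: blinfun.sum_right blinfun.sum_left blinfun.bilinear_simps sum_distrib_left mult_ac)
    have Bf: "(\<Sum>j\<in>J. g j y * \<beta> j z (\<Sum>i\<in>I. f' i v *\<^sub>R X i z)) =
        (\<Sum>i\<in>I. \<Sum>j\<in>J. g j y * (f' i v * \<beta> j z (X i z)))"
      by (subst sum.swap)
        (simp add: blinfun.sum_right blinfun.sum_left blinfun.bilinear_simps sum_distrib_left mult_ac)
    have BX: "(\<Sum>j\<in>J. g j y * \<beta> j z (\<Sum>i\<in>I. f i y *\<^sub>R fderiv (X i) z p)) =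
        (\<Sum>i\<in>I. \<Sum>j\<in>J. f i y * g j y * \<beta> j z (fderiv (X i) z p))"
      by (subst sum.swap)
        (simp add: blinfun.sum_right blinfun.sum_left blinfun.bilinear_simps sum_distrib_left mult_ac)
    have "(\<Sum>i\<in>I. \<Sum>j\<in>J. g j y * (f' i v * \<alpha> i z (Y j z))) + (\<Sum>i\<in>I. \<Sum>j\<in>J. g j y * (f' i v * \<beta> j z (X i z))) =
        (\<Sum>i\<in>I. \<Sum>j\<in>J. g j y * (f' i v * (\<beta> j z (X i z) + \<alpha> i z (Y j z))))"
      by (simp add: sum.distrib[symmetric] algebra_simps)
    \<comment> \<open>The rule is [f s, t] = f [s, t] - Y(f) s + 2 <s, t> df, with \<open>Y\<close>
      the vector part of \<open>t\<close>; an anomaly df arises from the first argument alone, so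
      \<open>iso\<close> mentions \<open>f'\<close> and not \<open>g'\<close>. Keeping the factor
      \<open>f' i v\<close> in \<open>iso\<close> makes it hold without isotropy for constant
      coefficients, which is the case of a change of charts.\<close>
    also have "\<dots> = 0" using iso by (intro sum.neutral ballI) (simp add: defs)
    finally have van: "(\<Sum>i\<in>I. f' i v * \<alpha> i z (P w)) + (\<Sum>j\<in>J. g j y * \<beta> j z (\<Sum>i\<in>I. f' i v *\<^sub>R X i z)) = 0"
      unfolding Af Bf .
    have b0: "\<beta>0 y (fderiv X0 y v) = (\<Sum>j\<in>J. g j y * \<beta> j z (\<Sum>i\<in>I. f' i v *\<^sub>R X i z)) +
        (\<Sum>j\<in>J. g j y * \<beta> j z (\<Sum>i\<in>I. f i y *\<^sub>R fderiv (X i) z p)) - (\<Sum>j\<in>J. g j y * \<beta> j z (D2 v u))"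
      unfolding \<beta>0 E1 p_def
      by (simp add: blinfun.add_right blinfun.diff_right algebra_simps sum.distrib sum_subtractf)
    have "snd (coord_courant X0 \<alpha>0 Y0 \<beta>0 y) v = fderiv \<beta>0 y u v + \<beta>0 y (fderiv X0 y v) - fderiv \<alpha>0 y w v + fderiv \<alpha>0 y v w"
      by (simp add: coord_courant_def defs blinfun.bilinear_simps blinfun.prod_left.rep_eq)
    also have "\<dots> = (\<Sum>j\<in>J. g' j u * \<beta> j z p) - (\<Sum>i\<in>I. f' i w * \<alpha> i z p) +
      ((\<Sum>i\<in>I. \<Sum>j\<in>J. f i y * g j y * fderiv (\<beta> j) z (X i z) p) +
       (\<Sum>i\<in>I. \<Sum>j\<in>J. f i y * g j y * \<beta> j z (fderiv (X i) z p)) -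
       (\<Sum>i\<in>I. \<Sum>j\<in>J. f i y * g j y * fderiv (\<alpha> i) z (Y j z) p) +
       (\<Sum>i\<in>I. \<Sum>j\<in>J. f i y * g j y * fderiv (\<alpha> i) z p (Y j z)))"
      \<comment> \<open>The four terms in \<open>D2\<close> cancel in pairs, those with \<beta> and
        those with \<alpha>; \<open>van\<close> removes the terms in \<open>f' i v\<close>.\<close>
      unfolding E3 E4 b0 p_def[symmetric] Bu Aw Ap BX sym[of v u] sym[of v w] using van by simp
    also have "(\<Sum>i\<in>I. \<Sum>j\<in>J. f i y * g j y * fderiv (\<beta> j) z (X i z) p) +
       (\<Sum>i\<in>I. \<Sum>j\<in>J. f i y * g j y * \<beta> j z (fderiv (X i) z p)) -
       (\<Sum>i\<in>I. \<Sum>j\<in>J. f i y * g j y * fderiv (\<alpha> i) z (Y j z) p) +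
       (\<Sum>i\<in>I. \<Sum>j\<in>J. f i y * g j y * fderiv (\<alpha> i) z p (Y j z)) =
       (\<Sum>i\<in>I. \<Sum>j\<in>J. f i y * g j y * snd (coord_courant (X i) (\<alpha> i) (Y j) (\<beta> j) z) p)"
      by (simp add: coord_courant_def blinfun.bilinear_simps blinfun.prod_left.rep_eq algebra_simps sum.distrib sum_subtractf)
    finally show "snd (coord_courant X0 \<alpha>0 Y0 \<beta>0 y) v = (((\<Sum>j\<in>J. g' j (X0 y) *\<^sub>R \<beta> j (\<phi> y)) - (\<Sum>i\<in>I. f' i (Y0 y) *\<^sub>R \<alpha> i (\<phi> y)) +
      (\<Sum>i\<in>I. \<Sum>j\<in>J. (f i y * g j y) *\<^sub>R snd (coord_courant (X i) (\<alpha> i) (Y j) (\<beta> j) (\<phi> y)))) o\<^sub>L fderiv \<phi> y) v"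
      by (simp add: defs p_def blinfun.bilinear_simps blinfun.sum_left)
  qed
qed

section \<open>Charts and Jacobians\<close>

lemma blinfun_compose_assoc: "(A o\<^sub>L B) o\<^sub>L C = A o\<^sub>L (B o\<^sub>L C)"
  by (rule blinfun_eqI) simp

text \<open>For charts of one manifold this is a change of charts; for charts of \<open>N\<close>
  and of \<open>M\<close> it is the coordinate form of the inclusion. A single chain rule
  \<open>jac_comp\<close> then covers both and their mixtures.\<close>

definition transition :: "('a, 'n) chart \<Rightarrow> ('a, 'm) chart \<Rightarrow> 'n \<Rightarrow> 'm"
  where "transition c d = snd d \<circ> cinv c"

definition jac :: "('a, 'n::real_inner) chart \<Rightarrow> ('a, 'm::real_inner) chart \<Rightarrow> 'a \<Rightarrow> 'n \<Rightarrow>\<^sub>L 'm"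
  where "jac c d x = fderiv (transition c d) (snd c x)"

text \<open>No injectivity of the tangent maps is asked for here; changes of charts are the case \<open>N = M\<close>.\<close>

definition submfd :: "('a, 'n::real_inner) mfd \<Rightarrow> ('a, 'm::real_inner) mfd \<Rightarrow> bool"
  where "submfd N M \<longleftrightarrow> smooth_manifold N \<and> smooth_manifold M \<and> smooth_map N M id"

lemma smooth_manifoldD:
  assumes "smooth_manifold (M :: ('a, 'm::real_inner) mfd)"
  shows "finite_dim TYPE('m)" "Hausdorff_space (mtop M)" "(\<Union>c\<in>atlas M. fst c) = topspace (mtop M)"
  using assms unfolding smooth_manifold_def by blast+

lemma chart_domain:
  assumes "smooth_manifold M" "c \<in> atlas M"
  shows "openin (mtop M) (fst c)" "fst c \<subseteq> topspace (mtop M)"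
  using assms openin_subset unfolding smooth_manifold_def by blast+

lemma chart_homeomorphic:
  assumes "smooth_manifold M" "c \<in> atlas M"
  shows "homeomorphic_map (subtopology (mtop M) (fst c)) (top_of_set (snd c ` fst c)) (snd c)" "open (snd c ` fst c)"
  using assms unfolding smooth_manifold_def by blast+

lemma chart_inj:
  assumes "smooth_manifold M" "c \<in> atlas M"
  shows "inj_on (snd c) (fst c)"
  using homeomorphic_imp_injective_map[OF chart_homeomorphic(1)[OF assms]] chart_domain(2)[OF assms]
  by (simp add: topspace_subtopology Int_absorb1)

lemma cinv_chart:
  assumes "smooth_manifold M" "c \<in> atlas M" "x \<in> fst c"
  shows "cinv c (snd c x) = x"
  unfolding cinv_def by (rule inv_into_f_f[OF chart_inj[OF assms(1,2)] assms(3)])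

lemma open_chart_image:
  assumes "smooth_manifold M" "c \<in> atlas M" "openin (mtop M) U"
  shows "open (snd c ` (fst c \<inter> U))"
proof -
  have "openin (subtopology (mtop M) (fst c)) (fst c \<inter> U)"
    using assms(3) by (auto simp: openin_subtopology)
  then have "openin (top_of_set (snd c ` fst c)) (snd c ` (fst c \<inter> U))"
    using homeomorphic_imp_open_map[OF chart_homeomorphic(1)[OF assms(1,2)]] unfolding open_map_def by blast
  then show ?thesis using chart_homeomorphic(2)[OF assms(1,2)] openin_open_trans by blast
qed

lemma openin_chart_preimage:
  assumes "smooth_manifold M" "c \<in> atlas M" "open S"
  shows "openin (mtop M) {x \<in> fst c. snd c x \<in> S}"
proof -
  have "continuous_map (subtopology (mtop M) (fst c)) (top_of_set (snd c ` fst c)) (snd c)"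
    by (rule homeomorphic_imp_continuous_map[OF chart_homeomorphic(1)[OF assms(1,2)]])
  moreover have "openin (top_of_set (snd c ` fst c)) (snd c ` fst c \<inter> S)"
    using assms(3) by (auto simp: openin_subtopology)
  ultimately have "openin (subtopology (mtop M) (fst c))
      {x \<in> topspace (subtopology (mtop M) (fst c)). snd c x \<in> snd c ` fst c \<inter> S}"
    by (rule openin_continuous_map_preimage)
  also have "{x \<in> topspace (subtopology (mtop M) (fst c)). snd c x \<in> snd c ` fst c \<inter> S} = {x \<in> fst c. snd c x \<in> S}"
    using chart_domain(2)[OF assms(1,2)] by auto
  finally show ?thesis using chart_domain(1)[OF assms(1,2)] by (rule openin_trans_full)
qed

lemma chart_at:
  assumes "smooth_manifold M" "x \<in> topspace (mtop M)"
  shows "chart_at M x \<in> atlas M" "x \<in> fst (chart_at M x)"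
proof -
  have "\<exists>c. c \<in> atlas M \<and> x \<in> fst c" using assms smooth_manifoldD(3) by blast
  from someI_ex[OF this] show "chart_at M x \<in> atlas M" "x \<in> fst (chart_at M x)"
    unfolding chart_at_def by auto
qed

lemma submfdD:
  assumes "submfd N M"
  shows "smooth_manifold N" "smooth_manifold M" "topspace (mtop N) \<subseteq> topspace (mtop M)"
    "continuous_map (mtop N) (mtop M) id"
  using assms continuous_map_image_subset_topspace[of "mtop N" "mtop M" id]
  unfolding submfd_def smooth_map_def by auto

lemma submfd_openin:
  assumes "submfd N M" "openin (mtop M) U"
  shows "openin (mtop N) (topspace (mtop N) \<inter> U)"
proof -
  have "openin (mtop N) {x \<in> topspace (mtop N). id x \<in> U}"
    by (rule openin_continuous_map_preimage[OF submfdD(4)[OF assms(1)] assms(2)])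
  also have "{x \<in> topspace (mtop N). id x \<in> U} = topspace (mtop N) \<inter> U" by auto
  finally show ?thesis .
qed

lemma submfd_refl:
  assumes M: "smooth_manifold M"
  shows "submfd M M"
proof -
  have "smooth_on (snd c ` (fst c \<inter> fst d)) (snd d \<circ> cinv c)" if "c \<in> atlas M" "d \<in> atlas M" for c d
    using M that unfolding smooth_manifold_def by blast
  then show ?thesis using M by (simp add: submfd_def smooth_map_def)
qed

lemma transition_chart: "smooth_manifold N \<Longrightarrow> c \<in> atlas N \<Longrightarrow> x \<in> fst c \<Longrightarrow> transition c d (snd c x) = snd d x"
  by (simp add: transition_def cinv_chart)

lemma smooth_on_transition:
  assumes "submfd N M" "c \<in> atlas N" "d \<in> atlas M"
  shows "open (snd c ` (fst c \<inter> fst d))" "smooth_on (snd c ` (fst c \<inter> fst d)) (transition c d)"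
proof -
  have "fst c \<inter> (topspace (mtop N) \<inter> fst d) = fst c \<inter> fst d"
    using chart_domain(2)[OF submfdD(1)[OF assms(1)] assms(2)] by auto
  then show "open (snd c ` (fst c \<inter> fst d))"
    using open_chart_image[OF submfdD(1)[OF assms(1)] assms(2)
        submfd_openin[OF assms(1) chart_domain(1)[OF submfdD(2)[OF assms(1)] assms(3)]]] by simp
  show "smooth_on (snd c ` (fst c \<inter> fst d)) (transition c d)"
    using assms unfolding submfd_def smooth_map_def transition_def by simp
qed

lemma transition_differentiable:
  assumes "submfd N M" "c \<in> atlas N" "d \<in> atlas M" "x \<in> fst c" "x \<in> fst d"
  shows "transition c d differentiable (at (snd c x))"
  by (rule smooth_on_differentiable[OF smooth_on_transition(2)[OF assms(1-3)]]) (use assms in blast)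

lemma jac_comp:
  assumes "submfd N\<^sub>1 N\<^sub>2" "submfd N\<^sub>2 N\<^sub>3" "c \<in> atlas N\<^sub>1" "d \<in> atlas N\<^sub>2" "e \<in> atlas N\<^sub>3"
    "x \<in> fst c" "x \<in> fst d" "x \<in> fst e"
  shows "jac d e x o\<^sub>L jac c d x = jac c e x"
proof -
  note N1 = submfdD(1)[OF assms(1)] and N2 = submfdD(1)[OF assms(2)]
  have "(transition d e has_derivative jac d e x) (at (transition c d (snd c x)))"
    using fderiv_works[OF transition_differentiable[OF assms(2,4,5,7,8)]]
    by (simp add: transition_chart[OF N1 assms(3,6)] jac_def)
  from has_derivative_compose[OF fderiv_works[OF transition_differentiable[OF assms(1,3,4,6,7)]] this]
  have 1: "((\<lambda>y. transition d e (transition c d y)) has_derivative blinfun_apply (jac d e x o\<^sub>L jac c d x)) (at (snd c x))"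
    by (simp add: jac_def o_def blinfun_compose.rep_eq)
  have "(transition c e has_derivative blinfun_apply (jac d e x o\<^sub>L jac c d x)) (at (snd c x))"
  proof (rule has_derivative_transform_within_open[OF 1 smooth_on_transition(1)[OF assms(1,3,4)]])
    show "snd c x \<in> snd c ` (fst c \<inter> fst d)" using assms by blast
    show "transition d e (transition c d y) = transition c e y" if "y \<in> snd c ` (fst c \<inter> fst d)" for y
      using that by (auto simp: transition_chart[OF N1 assms(3)] transition_chart[OF N2 assms(4)])
  qed
  then show ?thesis unfolding jac_def[of c e] by (rule fderiv_eqI[symmetric])
qed

lemma jac_id:
  assumes "smooth_manifold M" "c \<in> atlas M" "x \<in> fst c"
  shows "jac c c x = id_blinfun"
  unfolding jac_def
proof (rule fderiv_eqI, rule has_derivative_transform_within_open[of "\<lambda>y. y"])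
  show "open (snd c ` fst c)" by (rule chart_homeomorphic(2)[OF assms(1,2)])
  show "snd c x \<in> snd c ` fst c" using assms(3) by blast
  show "y = transition c c y" if "y \<in> snd c ` fst c" for y
    using that by (auto simp: transition_chart[OF assms(1,2)])
qed simp

lemma jac_inverse:
  assumes "smooth_manifold M" "c \<in> atlas M" "d \<in> atlas M" "x \<in> fst c" "x \<in> fst d"
  shows "jac d c x o\<^sub>L jac c d x = id_blinfun" "jac d c x (jac c d x v) = v"
proof -
  show "jac d c x o\<^sub>L jac c d x = id_blinfun"
    using jac_comp[OF submfd_refl submfd_refl, OF assms(1) assms(1) assms(2) assms(3) assms(2) assms(4) assms(5) assms(4)]
      jac_id[OF assms(1,2,4)] by simp
  then show "jac d c x (jac c d x v) = v"
    by (metis blinfun_apply_blinfun_compose blinfun_apply_id_blinfun)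
qed

lemma smooth_on_jac:
  assumes "submfd N M" "c \<in> atlas N" "d \<in> atlas M"
  shows "smooth_on (snd c ` (fst c \<inter> fst d)) (fderiv (transition c d))"
  by (rule smooth_on_fderiv[OF smooth_manifoldD(1)[OF submfdD(1)[OF assms(1)]] smooth_on_transition[OF assms]])

lemma tmap_eq_jac:
  assumes "submfd N M" "x \<in> topspace (mtop N)"
  shows "tmap N M id x = blinfun_apply (jac (chart_at N x) (chart_at M x) x)"
proof -
  have "x \<in> topspace (mtop M)" using assms submfdD(3) by blast
  note cM = chart_at[OF submfdD(2)[OF assms(1)] this] and cN = chart_at[OF submfdD(1)[OF assms(1)] assms(2)]
  show ?thesis
    using fderiv_apply[OF transition_differentiable[OF assms(1) cN(1) cM(1) cN(2) cM(2)]]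
    by (simp add: tmap_def jac_def transition_def coord_at_def id_comp fun.map_id0 comp_def)
qed

lemma tchart_eq_jac:
  assumes "smooth_manifold M" "c \<in> atlas M" "x \<in> fst c"
  shows "tchart M c x = blinfun_apply (jac (chart_at M x) c x)"
    "Blinfun (tchart M c x) = jac (chart_at M x) c x"
    "Blinfun (inv (tchart M c x)) = jac c (chart_at M x) x"
proof -
  have "x \<in> topspace (mtop M)" using chart_domain(2) assms by blast
  note cM = chart_at[OF assms(1) this]
  show 1: "tchart M c x = blinfun_apply (jac (chart_at M x) c x)"
    using fderiv_apply[OF transition_differentiable[OF submfd_refl[OF assms(1)] cM(1) assms(2) cM(2) assms(3)]]
    by (simp add: tchart_def jac_def transition_def coord_at_def)
  then show "Blinfun (tchart M c x) = jac (chart_at M x) c x" by (simp add: blinfun_apply_inverse)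
  have "inv (blinfun_apply (jac (chart_at M x) c x)) = blinfun_apply (jac c (chart_at M x) x)"
    by (rule inv_equality)
      (rule jac_inverse(2)[OF assms(1) cM(1) assms(2) cM(2) assms(3)]
        jac_inverse(2)[OF assms(1,2) cM(1) assms(3) cM(2)])+
  then show "Blinfun (inv (tchart M c x)) = jac c (chart_at M x) x"
    unfolding 1 by (simp add: blinfun_apply_inverse)
qed

text \<open>Coordinates in the chart \<open>c\<close> of an element of the fibre of \<open>TM \<oplus> T\<^sup>*M\<close> at \<open>x\<close>.\<close>

definition tcoord :: "('a, 'm::real_inner) mfd \<Rightarrow> ('a, 'm) chart \<Rightarrow> 'a \<Rightarrow> 'm \<times> ('m \<Rightarrow>\<^sub>L real) \<Rightarrow> 'm \<times> ('m \<Rightarrow>\<^sub>L real)"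
  where "tcoord M c x p = (jac (chart_at M x) c x (fst p), snd p o\<^sub>L jac c (chart_at M x) x)"

lemma vrep_covrep_chart:
  assumes "smooth_manifold M" "c \<in> atlas M" "x \<in> fst c"
  shows "vrep M c (fst \<circ> s) (snd c x) = fst (tcoord M c x (s x))"
    "covrep M c (snd \<circ> s) (snd c x) = snd (tcoord M c x (s x))"
  using assms
  by (simp_all add: vrep_def tcoord_def cinv_chart tchart_eq_jac(1))
    (simp add: covrep_def cinv_chart tchart_eq_jac(3))

lemma tcoord_change:
  assumes "smooth_manifold M" "c \<in> atlas M" "d \<in> atlas M" "x \<in> fst c" "x \<in> fst d"
  shows "fst (tcoord M d x p) = jac c d x (fst (tcoord M c x p))"
    "snd (tcoord M c x p) = snd (tcoord M d x p) o\<^sub>L jac c d x"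
proof -
  have x: "x \<in> topspace (mtop M)" using chart_domain(2) assms by blast
  note cM = chart_at[OF assms(1) x] and i = submfd_refl[OF assms(1)]
  show "fst (tcoord M d x p) = jac c d x (fst (tcoord M c x p))"
    unfolding tcoord_def jac_comp[OF i i cM(1) assms(2,3) cM(2) assms(4,5), symmetric] by simp
  show "snd (tcoord M c x p) = snd (tcoord M d x p) o\<^sub>L jac c d x"
    unfolding tcoord_def jac_comp[OF i i assms(2,3) cM(1) assms(4,5) cM(2), symmetric]
    by (simp add: blinfun_compose_assoc)
qed

lemma tcoord_chart_at:
  assumes "smooth_manifold M" "x \<in> topspace (mtop M)"
  shows "tcoord M (chart_at M x) x p = p"
  using jac_id[OF assms(1) chart_at[OF assms]] by (cases p) (auto simp: tcoord_def intro: blinfun_eqI)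

lemma linear_tcoord: "linear (tcoord M c x)"
  by (rule linearI) (auto simp: tcoord_def blinfun.bilinear_simps intro!: blinfun_eqI)

lemma inj_tcoord:
  assumes "smooth_manifold M" "c \<in> atlas M" "x \<in> fst c"
  shows "inj (tcoord M c x)"
proof (rule injI)
  have x: "x \<in> topspace (mtop M)" using chart_domain(2) assms by blast
  note cM = chart_at[OF assms(1) x]
  fix p q assume "tcoord M c x p = tcoord M c x q"
  then have "tcoord M (chart_at M x) x p = tcoord M (chart_at M x) x q"
    using tcoord_change[OF assms(1) cM(1) assms(2) cM(2) assms(3)]
      tcoord_change[OF assms(1,2) cM(1) assms(3) cM(2)]
    by (metis prod_eq_iff)
  then show "p = q" using tcoord_chart_at[OF assms(1) x] by simp
qed

lemma pairing_tcoord: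
  assumes "smooth_manifold M" "c \<in> atlas M" "x \<in> fst c"
  shows "pairing (tcoord M c x p) (tcoord M c x q) = pairing p q"
proof -
  have x: "x \<in> topspace (mtop M)" using chart_domain(2) assms by blast
  note cM = chart_at[OF assms(1) x]
  show ?thesis
    by (simp add: pairing_def tcoord_def jac_inverse[OF assms(1) cM(1) assms(2) cM(2) assms(3)])
qed

text \<open>\<open>induced_structure\<close> refers to the charts chosen at each single point. The
  Jacobians of the inclusion in two pairs of charts are intertwined by the changes of charts, so the
  same description holds in fixed charts of \<open>Q\<close> and \<open>M\<close>, where smoothness
  can be discussed.\<close>

lemma tcoord_induced:
  assumes QM: "submfd Q M" and c: "c \<in> atlas Q" "x \<in> fst c" and d: "d \<in> atlas M" "x \<in> fst d"
  shows "tcoord Q c x ` induced_structure M L Q x =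
    {(u, \<zeta> o\<^sub>L jac c d x) | u \<zeta>. (jac c d x u, \<zeta>) \<in> tcoord M d x ` L x}" (is "?A = ?B")
proof -
  note Q = submfdD(1)[OF QM] and M = submfdD(2)[OF QM]
  have xQ: "x \<in> topspace (mtop Q)" using chart_domain(2)[OF Q c(1)] c(2) by blast
  then have xM: "x \<in> topspace (mtop M)" using submfdD(3)[OF QM] by blast
  note cQ = chart_at[OF Q xQ] and cM = chart_at[OF M xM]
  define e where "e = chart_at Q x"
  define e' where "e' = chart_at M x"
  note cQ = cQ[folded e_def] and cM = cM[folded e'_def]
  have T: "Blinfun (tmap Q M id x) = jac e e' x" "tmap Q M id x = blinfun_apply (jac e e' x)"
    using tmap_eq_jac[OF QM xQ] by (simp_all add: blinfun_apply_inverse e_def e'_def)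
  have comm: "jac e' d x o\<^sub>L jac e e' x = jac c d x o\<^sub>L jac e c x"
    using jac_comp[OF QM submfd_refl[OF M] cQ(1) cM(1) d(1) cQ(2) cM(2) d(2)]
      jac_comp[OF submfd_refl[OF Q] QM cQ(1) c(1) d(1) cQ(2) c(2) d(2)] by simp
  have comm': "jac e e' x o\<^sub>L jac c e x = jac d e' x o\<^sub>L jac c d x"
    using jac_comp[OF QM submfd_refl[OF M] c(1) d(1) cM(1) c(2) d(2) cM(2)]
      jac_comp[OF submfd_refl[OF Q] QM c(1) cQ(1) cM(1) c(2) cQ(2) cM(2)] by simp
  show ?thesis
  proof (intro equalityI subsetI)
    fix p assume "p \<in> ?A"
    then obtain u \<xi> where u: "(jac e e' x u, \<xi>) \<in> L x" "p = tcoord Q c x (u, \<xi> o\<^sub>L jac e e' x)"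
      unfolding induced_structure_def T(1) unfolding T(2) by auto
    have "tcoord M d x (jac e e' x u, \<xi>) = (jac c d x (jac e c x u), \<xi> o\<^sub>L jac d e' x)"
      using arg_cong[OF comm, of "\<lambda>A. blinfun_apply A u"] by (simp add: tcoord_def e'_def)
    moreover have "p = (jac e c x u, (\<xi> o\<^sub>L jac d e' x) o\<^sub>L jac c d x)"
      using comm' by (simp add: u(2) tcoord_def e_def[symmetric] blinfun_compose_assoc)
    ultimately show "p \<in> ?B" using u(1) by (metis (mono_tags, lifting) image_eqI mem_Collect_eq)
  next
    fix p assume "p \<in> ?B"
    then obtain u l where l: "l \<in> L x" "fst (tcoord M d x l) = jac c d x u" "p = (u, snd (tcoord M d x l) o\<^sub>L jac c d x)"
      by (auto simp: image_iff prod_eq_iff)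
    have "jac e e' x (jac c e x u) = jac d e' x (jac c d x u)"
      using arg_cong[OF comm', of "\<lambda>A. blinfun_apply A u"] by simp
    also have "\<dots> = fst l"
      unfolding l(2)[symmetric] tcoord_def
      by (simp add: jac_inverse[OF M cM(1) d(1) cM(2) d(2)] e'_def[symmetric])
    finally have "(jac c e x u, snd l o\<^sub>L jac e e' x) \<in> induced_structure M L Q x"
      unfolding induced_structure_def T(1) unfolding T(2) using l(1) by (intro CollectI exI[of _ "jac c e x u"] exI[of _ "snd l"]) simp
    moreover have "tcoord Q c x (jac c e x u, snd l o\<^sub>L jac e e' x) = p"
      using comm' by (simp add: l(3) tcoord_def e_def[symmetric] e'_def[symmetric] blinfun_compose_assoc
          jac_inverse[OF Q c(1) cQ(1) c(2) cQ(2)])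
    ultimately show "p \<in> ?A" by (metis imageI)
  qed
qed

section \<open>Integrability in charts\<close>

text \<open>Smoothness near \<open>x\<close> makes the maps under \<open>Blinfun\<close> and
  \<open>frechet_derivative\<close> genuine bounded operators, so the pointwise definition can be
  read as an operator formula.\<close>

lemma courant_bracket_eq_coord:
  fixes M :: "('a, 'm::real_inner) mfd"
  assumes M: "smooth_manifold M" and x: "x \<in> topspace (mtop M)"
    and "openin (mtop M) U" "x \<in> U" "smooth_section M U s" "smooth_section M U t"
  defines "e \<equiv> chart_at M x"
  shows "courant_bracket M s t x =
    coord_courant (vrep M e (fst \<circ> s)) (covrep M e (snd \<circ> s)) (vrep M e (fst \<circ> t)) (covrep M e (snd \<circ> t)) (snd e x)"
proof -
  note cM = chart_at[OF M x, folded e_def]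
  have y: "snd e x \<in> snd e ` (fst e \<inter> U)" using cM(2) assms(4) by blast
  have d: "vrep M e (fst \<circ> s) differentiable (at (snd e x))" "covrep M e (snd \<circ> s) differentiable (at (snd e x))"
    "vrep M e (fst \<circ> t) differentiable (at (snd e x))" "covrep M e (snd \<circ> t) differentiable (at (snd e x))"
    using assms(5,6) cM(1) unfolding smooth_section_def by (auto intro!: smooth_on_differentiable[OF _ y])
  have v: "vrep M e (fst \<circ> s) (snd e x) = fst (s x)" "covrep M e (snd \<circ> s) (snd e x) = snd (s x)" for s
    using vrep_covrep_chart[OF M cM] tcoord_chart_at[OF M x] by (simp_all add: e_def)
  define A where "A = fderiv (covrep M e (snd \<circ> s)) (snd e x)"
  have "ext_derivative M (snd \<circ> s) x w = blinfun_apply (A w - (blinfun.prod_left w o\<^sub>L A))" for w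
    by (rule ext) (simp add: ext_derivative_def A_def fderiv_apply[OF d(2)] coord_at_def e_def[symmetric] Let_def
        blinfun.diff_left blinfun.prod_left.rep_eq)
  then have "Blinfun (ext_derivative M (snd \<circ> s) x w) = A w - (blinfun.prod_left w o\<^sub>L A)" for w
    by (simp add: blinfun_apply_inverse)
  then show ?thesis
    by (simp add: courant_bracket_def coord_courant_def lie_bracket_def lie_derivative_def Let_def v A_def
        coord_at_def e_def[symmetric] fderiv_apply[OF d(1)] fderiv_apply[OF d(3)] fderiv_apply[OF d(4)]
        fderiv_def[of "vrep M e (fst \<circ> s)", symmetric])
qed

text \<open>Independence of the chart. It is the pullback formula for a change of charts, with
  one-element index sets and constant coefficient 1, whose zero derivative makes the isotropy
  condition trivial.\<close>

lemma courant_bracket_tcoord: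
  fixes M :: "('a, 'm::real_inner) mfd"
  assumes M: "smooth_manifold M" and U: "openin (mtop M) U" "x \<in> U"
    and s: "smooth_section M U s" and t: "smooth_section M U t"
    and c: "c \<in> atlas M" "x \<in> fst c"
  shows "tcoord M c x (courant_bracket M s t x) =
    coord_courant (vrep M c (fst \<circ> s)) (covrep M c (snd \<circ> s)) (vrep M c (fst \<circ> t)) (covrep M c (snd \<circ> t)) (snd c x)"
proof -
  have x: "x \<in> topspace (mtop M)" using U openin_subset by blast
  define e where "e = chart_at M x"
  note e = chart_at[OF M x, folded e_def]
  note i = submfd_refl[OF M] and fd = smooth_manifoldD(1)[OF M]
  define S where "S = snd e ` (fst e \<inter> (fst c \<inter> U))"
  have S: "open S" "snd e x \<in> S"
    using open_chart_image[OF M e(1) openin_Int[OF chart_domain(1)[OF M c(1)] U(1)]] e c U by (auto simp: S_def)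
  have \<phi>: "smooth_on S (transition e c)"
    by (rule smooth_on_subset[OF smooth_on_transition(2)[OF i e(1) c(1)]]) (auto simp: S_def)
  have \<phi>x: "transition e c (snd e x) = snd c x" by (rule transition_chart[OF M e])
  have dc: "vrep M c (fst \<circ> r) differentiable (at (snd c x))" "covrep M c (snd \<circ> r) differentiable (at (snd c x))"
    if "smooth_section M U r" for r
    using that c U unfolding smooth_section_def by (auto intro!: smooth_on_differentiable)
  have de: "vrep M e (fst \<circ> r) differentiable (at (snd e x))" if "smooth_section M U r" for r
    using that e U unfolding smooth_section_def by (auto intro!: smooth_on_differentiable)
  have rel: "fderiv (transition e c) y (vrep M e (fst \<circ> r) y) = vrep M c (fst \<circ> r) (transition e c y)"
    "covrep M e (snd \<circ> r) y = covrep M c (snd \<circ> r) (transition e c y) o\<^sub>L fderiv (transition e c) y" if y: "y \<in> S" for y r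
  proof -
    obtain q where q: "q \<in> fst e" "q \<in> fst c" "y = snd e q" using y S_def by blast
    show "fderiv (transition e c) y (vrep M e (fst \<circ> r) y) = vrep M c (fst \<circ> r) (transition e c y)"
      "covrep M e (snd \<circ> r) y = covrep M c (snd \<circ> r) (transition e c y) o\<^sub>L fderiv (transition e c) y"
      using tcoord_change[OF M e(1) c(1) q(1,2)]
      by (simp_all add: q(3) transition_chart[OF M e(1) q(1)] vrep_covrep_chart[OF M e(1) q(1)]
          vrep_covrep_chart[OF M c(1) q(2)] jac_def)
  qed
  note pb = coord_courant_pullback[OF fd S \<phi>, where I = "{()}" and J = "{()}" and f = "\<lambda>_ _. 1" and g = "\<lambda>_ _. 1"
      and f' = "\<lambda>_ _. 0" and g' = "\<lambda>_ _. 0" and X = "\<lambda>_. vrep M c (fst \<circ> s)" and \<alpha> = "\<lambda>_. covrep M c (snd \<circ> s)"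
      and Y = "\<lambda>_. vrep M c (fst \<circ> t)" and \<beta> = "\<lambda>_. covrep M c (snd \<circ> t)"
      and ?X0.0 = "vrep M e (fst \<circ> s)" and ?\<alpha>0.0 = "covrep M e (snd \<circ> s)"
      and ?Y0.0 = "vrep M e (fst \<circ> t)" and ?\<beta>0.0 = "covrep M e (snd \<circ> t)", unfolded \<phi>x]
  define Z where "Z = courant_bracket M s t x"
  define Z' where "Z' = coord_courant (vrep M c (fst \<circ> s)) (covrep M c (snd \<circ> s)) (vrep M c (fst \<circ> t)) (covrep M c (snd \<circ> t)) (snd c x)"
  have Z: "Z = coord_courant (vrep M e (fst \<circ> s)) (covrep M e (snd \<circ> s)) (vrep M e (fst \<circ> t)) (covrep M e (snd \<circ> t)) (snd e x)"
    unfolding Z_def e_def by (rule courant_bracket_eq_coord[OF M x U s t])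
  have 1: "jac e c x (fst Z) = fst Z'"
    unfolding Z Z'_def jac_def
    by (subst pb(1)) (simp_all add: dc s t de rel)
  have 2: "snd Z = snd Z' o\<^sub>L jac e c x"
    unfolding Z Z'_def jac_def
    by (subst pb(2)) (simp_all add: dc s t de rel)
  have "snd Z' = snd Z o\<^sub>L jac c e x"
    unfolding 2 blinfun_compose_assoc jac_inverse(1)[OF M c(1) e(1) c(2) e(2)]
    by (rule blinfun_eqI) simp
  then show ?thesis
    using 1 by (simp add: tcoord_def Z_def[symmetric] Z'_def[symmetric] e_def[symmetric] prod_eq_iff)
qed

lemma smooth_on_coord_courant:
  fixes X :: "'m::real_inner \<Rightarrow> 'm"
  assumes fd: "finite_dim TYPE('m)" and S: "open S"
    and "smooth_on S X" "smooth_on S \<alpha>" "smooth_on S Y" "smooth_on S \<beta>"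
  shows "smooth_on S (\<lambda>y. fst (coord_courant X \<alpha> Y \<beta> y))" "smooth_on S (\<lambda>y. snd (coord_courant X \<alpha> Y \<beta> y))"
proof -
  note b = assms(3-6)[THEN smooth_on_fderiv[OF fd S]]
  show "smooth_on S (\<lambda>y. fst (coord_courant X \<alpha> Y \<beta> y))"
    unfolding coord_courant_def fst_conv by (intro smooth_on_diff smooth_on_blinfun_apply S b assms)
  show "smooth_on S (\<lambda>y. snd (coord_courant X \<alpha> Y \<beta> y))"
    unfolding coord_courant_def snd_conv
    by (intro smooth_on_diff smooth_on_add smooth_on_blinfun_compose smooth_on_blinfun_apply S b assms
        smooth_on_compose_bounded_linear[OF blinfun.bounded_linear_prod_left])
qed

lemma smooth_section_courant_bracket:
  fixes M :: "('a, 'm::real_inner) mfd"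
  assumes M: "smooth_manifold M" and U: "openin (mtop M) U"
    and s: "smooth_section M U s" and t: "smooth_section M U t"
  shows "smooth_section M U (courant_bracket M s t)"
  unfolding smooth_section_def
proof
  fix c assume c: "c \<in> atlas M"
  define S where "S = snd c ` (fst c \<inter> U)"
  have S: "open S" unfolding S_def by (rule open_chart_image[OF M c U])
  let ?l = "coord_courant (vrep M c (fst \<circ> s)) (covrep M c (snd \<circ> s)) (vrep M c (fst \<circ> t)) (covrep M c (snd \<circ> t))"
  have "smooth_on S (vrep M c (fst \<circ> s))" "smooth_on S (covrep M c (snd \<circ> s))"
    "smooth_on S (vrep M c (fst \<circ> t))" "smooth_on S (covrep M c (snd \<circ> t))"
    using s t c unfolding smooth_section_def S_def by blast+
  note l = smooth_on_coord_courant[OF smooth_manifoldD(1)[OF M] S this]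
  have eq: "fst (?l y) = vrep M c (fst \<circ> courant_bracket M s t) y \<and> snd (?l y) = covrep M c (snd \<circ> courant_bracket M s t) y"
    if y: "y \<in> S" for y
  proof -
    obtain q where q: "q \<in> fst c" "q \<in> U" "y = snd c q" using y S_def by blast
    show ?thesis unfolding q(3) vrep_covrep_chart[OF M c q(1)]
      by (simp add: courant_bracket_tcoord[OF M U q(2) s t c q(1)])
  qed
  show "smooth_on (snd c ` (fst c \<inter> U)) (vrep M c (fst \<circ> courant_bracket M s t)) \<and>
    smooth_on (snd c ` (fst c \<inter> U)) (covrep M c (snd \<circ> courant_bracket M s t))"
    unfolding S_def[symmetric] using smooth_on_cong[OF S _ l(1)] smooth_on_cong[OF S _ l(2)] eq by blast
qed

section \<open>Frames of \<open>L\<close> by global sections\<close>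

lemma independent_family:
  assumes "finite I" "inj_on f I" "independent (f ` I)" "(\<Sum>i\<in>I. a i *\<^sub>R f i) = 0" "i \<in> I"
  shows "a i = 0"
proof -
  have "(\<Sum>v\<in>f ` I. a (inv_into I f v) *\<^sub>R v) = (\<Sum>i\<in>I. a i *\<^sub>R f i)"
    unfolding sum.reindex[OF assms(2)] by (rule sum.cong) (simp_all add: inv_into_f_f[OF assms(2)])
  then have "a (inv_into I f (f i)) = 0"
    by (intro independentD[OF assms(3) finite_imageI[OF assms(1)] subset_refl, of "\<lambda>v. a (inv_into I f v)"]) (use assms in auto)
  then show ?thesis by (simp add: inv_into_f_f[OF assms(2,5)])
qed

lemma span_family:
  assumes "finite I" "v \<in> span (f ` I)"
  obtains a where "v = (\<Sum>i\<in>I. a i *\<^sub>R f i)"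
proof -
  have "\<exists>a. v = (\<Sum>i\<in>I. a i *\<^sub>R f i)"
    using assms(2)
  proof (induction rule: span_induct_alt)
    case base
    show ?case by (rule exI[of _ "\<lambda>_. 0"]) simp
  next
    case (step c x y)
    then obtain i a where i: "i \<in> I" "x = f i" "y = (\<Sum>i\<in>I. a i *\<^sub>R f i)" by blast
    have "(\<Sum>j\<in>I. (a j + (if j = i then c else 0)) *\<^sub>R f j) = (\<Sum>j\<in>I. a j *\<^sub>R f j) + (\<Sum>j\<in>I. if j = i then c *\<^sub>R f j else 0)"
      unfolding sum.distrib[symmetric] by (rule sum.cong) (auto simp: algebra_simps)
    also have "\<dots> = c *\<^sub>R x + y" using assms(1) i by simp
    finally show ?case by metis
  qed
  then show ?thesis using that by blast
qed

lemma maximal_isotropicD: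
  assumes "maximal_isotropic W"
  shows "subspace W" "\<And>a b. a \<in> W \<Longrightarrow> b \<in> W \<Longrightarrow> pairing a b = 0"
  using assms unfolding maximal_isotropic_def isotropic_def by blast+

text \<open>Integrability is a condition on global sections; multiplying a local frame by a bump function
  makes it available locally.\<close>

lemma global_frame:
  fixes M :: "('a, 'm::real_inner) mfd"
  assumes M: "smooth_manifold M" and L: "dirac_structure M L" and x: "x \<in> topspace (mtop M)"
  obtains W k \<sigma> where "openin (mtop M) W" "x \<in> W" "\<And>i. i < k \<Longrightarrow> \<sigma> i \<in> sections M (topspace (mtop M)) L"
    "\<And>q l. q \<in> W \<Longrightarrow> l \<in> L q \<Longrightarrow> \<exists>a. l = (\<Sum>i<k::nat. a i *\<^sub>R \<sigma> i q)"
    "\<And>q a i. q \<in> W \<Longrightarrow> (\<Sum>i<k. a i *\<^sub>R \<sigma> i q) = 0 \<Longrightarrow> i < k \<Longrightarrow> a i = 0"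
proof -
  have "smooth_subbundle_on M (topspace (mtop M)) L" using L unfolding dirac_structure_on_def by blast
  from this[unfolded smooth_subbundle_on_def, THEN bspec, OF x]
  obtain V k s where "openin (mtop M) V \<and> x \<in> V \<and> V \<subseteq> topspace (mtop M) \<and>
      (\<forall>i<k::nat. smooth_section M V (s i)) \<and>
      (\<forall>y\<in>V. inj_on (\<lambda>i. s i y) {..<k} \<and> independent ((\<lambda>i. s i y) ` {..<k}) \<and>
              span ((\<lambda>i. s i y) ` {..<k}) = L y)" by (elim exE)
  then have V: "openin (mtop M) V" "x \<in> V" and s: "\<And>i. i < k \<Longrightarrow> smooth_section M V (s i)"
    and fr: "\<And>q. q \<in> V \<Longrightarrow> inj_on (\<lambda>i. s i q) {..<k} \<and> independent ((\<lambda>i. s i q) ` {..<k}) \<and>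
        span ((\<lambda>i. s i q) ` {..<k}) = L q"
    by simp_all
  have subL: "subspace (L q)" if "q \<in> topspace (mtop M)" for q
    using L that maximal_isotropicD(1) unfolding dirac_structure_on_def by blast
  define c where "c = chart_at M x"
  note c = chart_at[OF M x, folded c_def] and fd = smooth_manifoldD(1)[OF M]
  have "open (snd c ` (fst c \<inter> V))" by (rule open_chart_image[OF M c(1) V(1)])
  moreover have "snd c x \<in> snd c ` (fst c \<inter> V)" using c V by blast
  ultimately obtain r where r: "r > 0" "cball (snd c x) r \<subseteq> snd c ` (fst c \<inter> V)"
    using open_contains_cball by blast
  obtain b :: "'m \<Rightarrow> real" where b: "smooth_on UNIV b" "\<And>y. dist (snd c x) y < r \<Longrightarrow> b y > 0"
    "\<And>y. dist (snd c x) y \<ge> r \<Longrightarrow> b y = 0"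
    using smooth_bump[OF r(1)] by blast
  define K where "K = {q \<in> fst c. snd c q \<in> cball (snd c x) r}"
  have Kimg: "snd c ` K = cball (snd c x) r" using r(2) unfolding K_def by auto
  have KV: "K \<subseteq> V"
  proof
    fix q assume q: "q \<in> K"
    then obtain q' where "q' \<in> fst c" "q' \<in> V" "snd c q = snd c q'" using r(2) unfolding K_def by blast
    then show "q \<in> V" using q inj_onD[OF chart_inj[OF M c(1)], of q q'] unfolding K_def by auto
  qed
  \<comment> \<open>\<open>K\<close> is compact in the chart, hence compact in \<open>M\<close> and,
    by the Hausdorff property, closed there. Its complement is then an open set on which the
    extension by zero is smooth.\<close>
  have "compactin (top_of_set (snd c ` fst c)) (snd c ` K)"
    unfolding compactin_subtopology compactin_euclidean_iff Kimg
    using compact_cball_finite_dim[OF fd] r(2) by blast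
  then have "compactin (subtopology (mtop M) (fst c)) K"
    using homeomorphic_map_compactness[OF chart_homeomorphic(1)[OF M c(1)], of K] chart_domain(2)[OF M c(1)]
    by (auto simp: K_def)
  then have "compactin (mtop M) K" by (simp add: compactin_subtopology)
  then have Kcl: "closedin (mtop M) K" by (rule compactin_imp_closedin[OF smooth_manifoldD(2)[OF M]])
  define \<sigma> where "\<sigma> i q = (if q \<in> fst c \<inter> V then b (snd c q) *\<^sub>R s i q else 0)" for i q
  have \<sigma>0: "\<sigma> i q = 0" if "q \<notin> K" for i q
    using that b(3)[of "snd c q"] by (auto simp: \<sigma>_def K_def)
  have smooth: "smooth_section M (topspace (mtop M)) (\<sigma> i)" if i: "i < k" for i
    unfolding smooth_section_def
  proof
    fix d assume d: "d \<in> atlas M"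
    have "\<exists>T. open T \<and> y \<in> T \<and> smooth_on T (vrep M d (fst \<circ> \<sigma> i)) \<and> smooth_on T (covrep M d (snd \<circ> \<sigma> i))"
      if y: "y \<in> snd d ` fst d" for y
    proof -
      obtain q where q: "q \<in> fst d" "y = snd d q" using y by blast
      show ?thesis
      proof (cases "q \<in> fst c \<inter> V")
        case True
        define T where "T = snd d ` (fst d \<inter> (fst c \<inter> V))"
        have T: "open T" unfolding T_def
          by (rule open_chart_image[OF M d openin_Int[OF chart_domain(1)[OF M c(1)] V(1)]])
        have "smooth_on T (transition d c)"
          by (rule smooth_on_subset[OF smooth_on_transition(2)[OF submfd_refl[OF M] d c(1)]]) (auto simp: T_def)
        then have bT: "smooth_on T (\<lambda>z. b (transition d c z))"
          by (rule smooth_on_compose[OF fd T open_UNIV subset_UNIV _ b(1)])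
        have sT: "smooth_on T (vrep M d (fst \<circ> s i))" "smooth_on T (covrep M d (snd \<circ> s i))"
          using s[OF i] d unfolding smooth_section_def T_def by (auto intro: smooth_on_subset)
        have eq: "b (transition d c z) *\<^sub>R vrep M d (fst \<circ> s i) z = vrep M d (fst \<circ> \<sigma> i) z \<and>
          b (transition d c z) *\<^sub>R covrep M d (snd \<circ> s i) z = covrep M d (snd \<circ> \<sigma> i) z" if "z \<in> T" for z
        proof -
          obtain p where p: "p \<in> fst d" "p \<in> fst c" "p \<in> V" "z = snd d p" using \<open>z \<in> T\<close> T_def by blast
          show ?thesis
            unfolding p(4) vrep_covrep_chart[OF M d p(1)] transition_chart[OF M d p(1)]
            using p by (simp add: \<sigma>_def linear_scale[OF linear_tcoord])
        qed
        have "smooth_on T (vrep M d (fst \<circ> \<sigma> i))" "smooth_on T (covrep M d (snd \<circ> \<sigma> i))"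
          by (rule smooth_on_cong[OF T _ smooth_on_scaleR[OF T bT sT(1)]], use eq in blast,
              rule smooth_on_cong[OF T _ smooth_on_scaleR[OF T bT sT(2)]], use eq in blast)
        moreover have "y \<in> T" using True q unfolding T_def by blast
        ultimately show ?thesis using T by blast
      next
        case False
        then have "q \<notin> K" using KV unfolding K_def by blast
        define T where "T = snd d ` (fst d \<inter> (topspace (mtop M) - K))"
        have T: "open T" unfolding T_def
          by (rule open_chart_image[OF M d]) (use Kcl in \<open>simp add: closedin_def\<close>)
        have eq: "0 = vrep M d (fst \<circ> \<sigma> i) z \<and> 0 = covrep M d (snd \<circ> \<sigma> i) z" if "z \<in> T" for z
        proof -
          obtain p where p: "p \<in> fst d" "p \<notin> K" "z = snd d p" using \<open>z \<in> T\<close> T_def by blast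
          show ?thesis
            unfolding p(3) vrep_covrep_chart[OF M d p(1)] \<sigma>0[OF p(2)] linear_0[OF linear_tcoord] by simp
        qed
        have "smooth_on T (vrep M d (fst \<circ> \<sigma> i))" "smooth_on T (covrep M d (snd \<circ> \<sigma> i))"
          by (rule smooth_on_cong[OF T _ smooth_on_const[OF T]], use eq in blast,
              rule smooth_on_cong[OF T _ smooth_on_const[OF T]], use eq in blast)
        moreover have "y \<in> T"
          using \<open>q \<notin> K\<close> q chart_domain(2)[OF M d] unfolding T_def by blast
        ultimately show ?thesis using T by blast
      qed
    qed
    then have "smooth_on (snd d ` fst d) (vrep M d (fst \<circ> \<sigma> i))" "smooth_on (snd d ` fst d) (covrep M d (snd \<circ> \<sigma> i))"
      by (auto intro!: smooth_on_local)
    moreover have "fst d \<inter> topspace (mtop M) = fst d" using chart_domain(2)[OF M d] by blast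
    ultimately show "smooth_on (snd d ` (fst d \<inter> topspace (mtop M))) (vrep M d (fst \<circ> \<sigma> i)) \<and>
        smooth_on (snd d ` (fst d \<inter> topspace (mtop M))) (covrep M d (snd \<circ> \<sigma> i))" by simp
  qed
  have inL: "\<sigma> i q \<in> L q" if "i < k" "q \<in> topspace (mtop M)" for i q
  proof (cases "q \<in> fst c \<inter> V")
    case True
    then have "s i q \<in> L q" using fr[of q] that(1) span_base[of "s i q" "(\<lambda>i. s i q) ` {..<k}"] by auto
    then show ?thesis using True subspace_scale[OF subL[OF that(2)]] by (simp add: \<sigma>_def)
  next
    case False
    then show ?thesis unfolding \<sigma>_def using subspace_0[OF subL[OF that(2)]] by auto
  qed
  \<comment> \<open>On the open ball the bump function is positive, so multiplying by it preserves
    the frame; coefficients are merely divided by its value.\<close>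
  define W where "W = {q \<in> fst c. snd c q \<in> ball (snd c x) r}"
  have W: "q \<in> V" "b (snd c q) > 0" "\<And>i. \<sigma> i q = b (snd c q) *\<^sub>R s i q" if "q \<in> W" for q
  proof -
    have "q \<in> K" using that by (auto simp: W_def K_def)
    then show "q \<in> V" using KV by blast
    then show "\<And>i. \<sigma> i q = b (snd c q) *\<^sub>R s i q" using that by (simp add: \<sigma>_def W_def)
    show "b (snd c q) > 0" using that b(2) by (simp add: W_def)
  qed
  show ?thesis
  proof (rule that[of W k \<sigma>])
    show "openin (mtop M) W" unfolding W_def by (rule openin_chart_preimage[OF M c(1) open_ball])
    show "x \<in> W" using c r(1) by (simp add: W_def)
    show "\<sigma> i \<in> sections M (topspace (mtop M)) L" if "i < k" for i
      using smooth[OF that] inL[OF that] by (simp add: sections_def)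
    show "\<exists>a. l = (\<Sum>i<k. a i *\<^sub>R \<sigma> i q)" if q: "q \<in> W" and l: "l \<in> L q" for q l
    proof -
      have "l \<in> span ((\<lambda>i. s i q) ` {..<k})" using fr[OF W(1)[OF q]] l by simp
      then obtain a where a: "l = (\<Sum>i<k. a i *\<^sub>R s i q)" using span_family[of "{..<k}"] by blast
      show ?thesis
        by (rule exI[of _ "\<lambda>i. a i / b (snd c q)"]) (use W(2)[OF q] in \<open>simp add: a W(3)[OF q]\<close>)
    qed
    show "a i = 0" if q: "q \<in> W" and 0: "(\<Sum>i<k. a i *\<^sub>R \<sigma> i q) = 0" and i: "i < k" for q a i
    proof -
      have "a i * b (snd c q) = 0"
        by (rule independent_family[of "{..<k}" "\<lambda>i. s i q" "\<lambda>i. a i * b (snd c q)"])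
          (use fr[OF W(1)[OF q]] 0 i in \<open>simp_all add: W(3)[OF q]\<close>)
      then show ?thesis using W(2)[OF q] by simp
    qed
  qed
qed

section \<open>The induced structure\<close>

text \<open>Restricting covectors along \<open>T\<close> and pushing vectors forward by
  \<open>T\<close> are adjoint, so the pairing is the one already computed in \<open>L q\<close>.
  Maximality comes later, from \<open>graph_maximal_isotropic\<close>.\<close>

lemma induced_structure_isotropic:
  fixes Q :: "('a, 'q::real_inner) mfd" and M :: "('a, 'm::real_inner) mfd"
  assumes "isotropic (L q)" "bounded_linear (tmap Q M id q)"
  shows "isotropic (induced_structure M L Q q)"
proof -
  define T where "T = Blinfun (tmap Q M id q)"
  have T: "tmap Q M id q = blinfun_apply T"
    by (simp add: T_def bounded_linear_Blinfun_apply[OF assms(2)])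
  define W where "W = induced_structure M L Q q"
  have W: "W = {(u, \<xi> o\<^sub>L T) | u \<xi>. (T u, \<xi>) \<in> L q}"
    unfolding W_def induced_structure_def T_def[symmetric] unfolding T ..
  have S: "subspace (L q)" and iso: "\<And>a b. a \<in> L q \<Longrightarrow> b \<in> L q \<Longrightarrow> pairing a b = 0"
    using assms(1) unfolding isotropic_def by blast+
  have "subspace W"
  proof (rule subspaceI)
    show "0 \<in> W" unfolding W
      using subspace_0[OF S] by (intro CollectI exI[of _ 0]) (auto simp: zero_prod_def intro: blinfun_eqI)
    fix x y assume "x \<in> W"
    then obtain u \<xi> where x: "x = (u, \<xi> o\<^sub>L T)" "(T u, \<xi>) \<in> L q" unfolding W by blast
    have "r *\<^sub>R x = (r *\<^sub>R u, (r *\<^sub>R \<xi>) o\<^sub>L T)" "(T (r *\<^sub>R u), r *\<^sub>R \<xi>) \<in> L q" for r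
      using subspace_scale[OF S x(2), of r] by (auto simp: x(1) blinfun.bilinear_simps intro: blinfun_eqI)
    then show "r *\<^sub>R x \<in> W" for r unfolding W by blast
    assume "y \<in> W"
    then obtain v \<eta> where y: "y = (v, \<eta> o\<^sub>L T)" "(T v, \<eta>) \<in> L q" unfolding W by blast
    have "x + y = (u + v, (\<xi> + \<eta>) o\<^sub>L T)" "(T (u + v), \<xi> + \<eta>) \<in> L q"
      using subspace_add[OF S x(2) y(2)] by (auto simp: x(1) y(1) blinfun.bilinear_simps intro: blinfun_eqI)
    then show "x + y \<in> W" unfolding W by blast
  qed
  moreover have "pairing a b = 0" if ab: "a \<in> W" "b \<in> W" for a b
  proof -
    obtain u \<xi> v \<eta> where a: "a = (u, \<xi> o\<^sub>L T)" "(T u, \<xi>) \<in> L q" and b: "b = (v, \<eta> o\<^sub>L T)" "(T v, \<eta>) \<in> L q"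
      using ab unfolding W by blast
    have "pairing a b = pairing (T u, \<xi>) (T v, \<eta>)" by (simp add: a b pairing_def)
    then show ?thesis using iso a(2) b(2) by simp
  qed
  ultimately show ?thesis unfolding isotropic_def W_def by blast
qed

section \<open>Isotropic subspaces projecting onto the cotangent space\<close>

definition graph_vector :: "('m::real_inner \<times> ('m \<Rightarrow>\<^sub>L real)) set \<Rightarrow> ('m \<Rightarrow>\<^sub>L real) \<Rightarrow> 'm"
  where "graph_vector W \<xi> = (THE u. (u, \<xi>) \<in> W)"

definition graph_bivector :: "('m::real_inner \<times> ('m \<Rightarrow>\<^sub>L real)) set \<Rightarrow> 'm bivector"
  where "graph_bivector W \<xi> \<eta> = blinfun_apply \<eta> (graph_vector W \<xi>)"

lemma vector_eq_functionals: "(\<And>\<beta>::'m::real_inner \<Rightarrow>\<^sub>L real. blinfun_apply \<beta> u = blinfun_apply \<beta> v) \<Longrightarrow> u = v"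
  by (metis blinfun_inner_right.rep_eq vector_eq_ldot)

context
  fixes W :: "('m::real_inner \<times> ('m \<Rightarrow>\<^sub>L real)) set"
  assumes iso: "isotropic W" and total: "\<And>\<xi>. \<exists>u. (u, \<xi>) \<in> W"
begin

lemma graph_subspace: "subspace W" using iso unfolding isotropic_def by blast

lemma graph_pairing: "a \<in> W \<Longrightarrow> b \<in> W \<Longrightarrow> pairing a b = 0" using iso unfolding isotropic_def by blast

text \<open>Pairing with an element over \<beta>, which exists by \<open>total\<close>, fixes the
  value of \<beta> on the vector; functionals separate vectors.\<close>

lemma graph_unique:
  assumes "(u, \<xi>) \<in> W" "(v, \<xi>) \<in> W"
  shows "u = v"
proof (rule vector_eq_functionals)
  fix \<beta>
  obtain w where "(w, \<beta>) \<in> W" using total by blast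
  then show "blinfun_apply \<beta> u = blinfun_apply \<beta> v"
    using graph_pairing[OF assms(1)] graph_pairing[OF assms(2)] unfolding pairing_def by force
qed

lemma graph_vector_iff: "(u, \<xi>) \<in> W \<longleftrightarrow> u = graph_vector W \<xi>"
  using theI'[of "\<lambda>u. (u, \<xi>) \<in> W"] total[of \<xi>] graph_unique unfolding graph_vector_def by blast

lemma graph_vector_in: "(graph_vector W \<xi>, \<xi>) \<in> W"
  by (simp add: graph_vector_iff)

lemma linear_graph_vector: "linear (graph_vector W)"
proof (rule linearI)
  show "graph_vector W (\<xi> + \<eta>) = graph_vector W \<xi> + graph_vector W \<eta>" for \<xi> \<eta>
    using subspace_add[OF graph_subspace graph_vector_in graph_vector_in, of \<xi> \<eta>]
    by (simp add: graph_vector_iff)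
  show "graph_vector W (r *\<^sub>R \<xi>) = r *\<^sub>R graph_vector W \<xi>" for r \<xi>
    using subspace_scale[OF graph_subspace graph_vector_in, of r \<xi>] by (simp add: graph_vector_iff)
qed

text \<open>An element of a larger isotropic subspace is orthogonal to the whole graph, and this
  already determines its vector from its covector, as in \<open>graph_unique\<close>.\<close>

lemma graph_maximal_isotropic: "maximal_isotropic W"
  unfolding maximal_isotropic_def
proof (intro conjI iso allI impI)
  fix W' assume W': "isotropic W' \<and> W \<subseteq> W'"
  have "(v, \<xi>) \<in> W" if v: "(v, \<xi>) \<in> W'" for v \<xi>
  proof -
    have "v = graph_vector W \<xi>"
    proof (rule vector_eq_functionals)
      fix \<beta>
      have "pairing (v, \<xi>) (graph_vector W \<beta>, \<beta>) = 0"
        using W' v graph_vector_in[of \<beta>] unfolding isotropic_def by blast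
      moreover have "pairing (graph_vector W \<xi>, \<xi>) (graph_vector W \<beta>, \<beta>) = 0"
        by (intro graph_pairing graph_vector_in)
      ultimately show "blinfun_apply \<beta> v = blinfun_apply \<beta> (graph_vector W \<xi>)" by (simp add: pairing_def)
    qed
    then show ?thesis by (simp add: graph_vector_iff)
  qed
  then show "W' = W" using W' by auto
qed

lemma graph_bivector_skew: "graph_bivector W \<xi> \<eta> = - graph_bivector W \<eta> \<xi>"
  using graph_pairing[OF graph_vector_in[of \<xi>] graph_vector_in[of \<eta>]]
  by (simp add: pairing_def graph_bivector_def)

lemma is_bivector_graph_bivector: "is_bivector (graph_bivector W)"
  unfolding is_bivector_def
proof (intro conjI allI)
  show "linear (graph_bivector W \<alpha>)" for \<alpha>
    by (rule linearI) (simp_all add: graph_bivector_def blinfun.bilinear_simps)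
  show "linear (\<lambda>\<alpha>. graph_bivector W \<alpha> \<beta>)" for \<beta>
    by (rule linearI) (simp_all add: graph_bivector_def linear_add[OF linear_graph_vector]
        linear_scale[OF linear_graph_vector] blinfun.bilinear_simps)
  show "graph_bivector W \<alpha> \<alpha> = 0" for \<alpha>
    using graph_bivector_skew[of \<alpha> \<alpha>] by simp
qed

lemma sharp_graph_bivector: "sharp (graph_bivector W) \<xi> = graph_vector W \<xi>"
  unfolding sharp_def graph_bivector_def
  by (rule the_equality) (auto intro: vector_eq_functionals)

lemma bivector_graph_graph_bivector: "bivector_graph (graph_bivector W) = W"
  unfolding bivector_graph_def sharp_graph_bivector using graph_vector_iff by auto

text \<open>\<open>A\<close> will be the Jacobian from the chart chosen at a point to a fixed chart.
  The covectors are then those with constant coordinates in the fixed chart, so the basis varies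
  smoothly with the point.\<close>

lemma graph_basis:
  fixes A :: "'m \<Rightarrow>\<^sub>L 'm"
  assumes fd: "finite_dim TYPE('m)" and AB: "A o\<^sub>L B = id_blinfun" "B o\<^sub>L A = id_blinfun"
  defines "\<Psi> \<equiv> \<lambda>v. (graph_vector W (blinfun_inner_right v o\<^sub>L A), blinfun_inner_right v o\<^sub>L A)"
  shows "inj \<Psi>" "independent (\<Psi> ` onb)" "span (\<Psi> ` onb) = W"
proof -
  have l: "blinfun_inner_right (u + v) o\<^sub>L A = (blinfun_inner_right u o\<^sub>L A) + (blinfun_inner_right v o\<^sub>L A)"
    "blinfun_inner_right (r *\<^sub>R u) o\<^sub>L A = r *\<^sub>R (blinfun_inner_right u o\<^sub>L A)" for u v r
    by (rule blinfun_eqI; simp add: blinfun.bilinear_simps inner_add_left)+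
  have lin: "linear \<Psi>"
    by (rule linearI) (simp_all only: \<Psi>_def l linear_add[OF linear_graph_vector]
        linear_scale[OF linear_graph_vector] add_Pair scaleR_Pair)
  have A: "A (B v) = v" "B (A v) = v" for v
    using AB by (metis blinfun_apply_blinfun_compose blinfun_apply_id_blinfun)+
  show inj: "inj \<Psi>"
  proof (rule injI)
    fix u v assume "\<Psi> u = \<Psi> v"
    then have "(blinfun_inner_right u o\<^sub>L A) (B w) = (blinfun_inner_right v o\<^sub>L A) (B w)" for w
      unfolding \<Psi>_def by simp
    then have "u \<bullet> w = v \<bullet> w" for w by (simp add: A)
    then show "u = v" using vector_eq_rdot by blast
  qed
  have "0 \<notin> (onb :: 'm set)" using onb_inner[OF fd] by force
  then have "independent (onb :: 'm set)"
    using onb_inner[OF fd] by (intro pairwise_orthogonal_independent) (auto simp: pairwise_def orthogonal_def)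
  then show "independent (\<Psi> ` onb)"
    using linear_independent_injective_image[OF lin] inj by (simp add: inj_on_subset)
  have "v \<in> span onb" for v :: 'm
    by (subst onb_expand[OF fd, of v]) (intro span_sum span_scale span_base)
  then have "span (\<Psi> ` onb) = range \<Psi>"
    using linear_span_image[OF lin, of onb] by auto
  also have "range \<Psi> = W"
  proof (intro equalityI subsetI)
    show "p \<in> W" if "p \<in> range \<Psi>" for p
      using that graph_vector_in unfolding \<Psi>_def by blast
    fix p assume p: "p \<in> W"
    obtain u \<xi> where u: "p = (u, \<xi>)" by (cases p)
    \<comment> \<open>The Riesz representative of \<open>\<xi> o\<^sub>L B\<close>.\<close>
    define v where "v = (\<Sum>b\<in>onb. \<xi> (B b) *\<^sub>R b)"
    have "v \<bullet> A w = \<xi> w" for w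
    proof -
      have "\<xi> w = (\<xi> o\<^sub>L B) (A w)" by (simp add: A)
      also have "\<dots> = (\<Sum>b\<in>onb. (A w \<bullet> b) *\<^sub>R (\<xi> o\<^sub>L B) b)"
        by (rule linear_onb[OF fd bounded_linear.linear[OF blinfun.bounded_linear_right]])
      also have "\<dots> = v \<bullet> A w"
        unfolding v_def inner_sum_left by (rule sum.cong) (simp_all add: inner_commute)
      finally show ?thesis ..
    qed
    then have "blinfun_inner_right v o\<^sub>L A = \<xi>" by (intro blinfun_eqI) simp
    then have "\<Psi> v = p" using p graph_vector_iff by (simp add: \<Psi>_def u)
    then show "p \<in> range \<Psi>" by blast
  qed
  finally show "span (\<Psi> ` onb) = W" .
qed

end

section \<open>The induced structure over a neighbourhood with a smooth lift\<close>

text \<open>\<open>R\<close> is the bivector \<open>\<Pi>\<^sub>Q\<close> in the chart \<open>c\<close>; the \<open>\<kappa> i\<close> are the coefficients of the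
  lift of \<open>L\<^sub>Q\<close> to \<open>L \<inter> (TQ \<oplus> T\<^sup>*M)\<close> in the frame \<open>\<sigma>\<close> of \<open>L\<close>.\<close>

locale induced_lift =
  fixes M :: "('a, 'm::real_inner) mfd" and L :: "'a \<Rightarrow> ('m \<times> ('m \<Rightarrow>\<^sub>L real)) set"
    and Q :: "('a, 'q::real_inner) mfd" and c :: "('a, 'q) chart" and d :: "('a, 'm) chart"
    and V :: "'a set" and k :: nat and \<sigma> :: "nat \<Rightarrow> 'a \<Rightarrow> 'm \<times> ('m \<Rightarrow>\<^sub>L real)"
    and R :: "'q \<Rightarrow> ('q \<Rightarrow>\<^sub>L real) \<Rightarrow>\<^sub>L 'q" and \<kappa> :: "nat \<Rightarrow> 'q \<Rightarrow> ('q \<Rightarrow>\<^sub>L real) \<Rightarrow>\<^sub>L real"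
  assumes QM: "submfd Q M" and L: "dirac_structure M L"
    and c: "c \<in> atlas Q" and d: "d \<in> atlas M"
    and V: "openin (mtop Q) V" and Vc: "V \<subseteq> fst c" and Vd: "V \<subseteq> fst d"
    and \<sigma>: "\<And>i. i < k \<Longrightarrow> \<sigma> i \<in> sections M (topspace (mtop M)) L"
    and frame: "\<And>q l. q \<in> V \<Longrightarrow> l \<in> L q \<Longrightarrow> \<exists>a. l = (\<Sum>i<k. a i *\<^sub>R \<sigma> i q)"
    and smooth_R: "smooth_on (snd c ` V) R" and smooth_\<kappa>: "\<And>i. i < k \<Longrightarrow> smooth_on (snd c ` V) (\<kappa> i)"
    and lift: "\<And>q \<eta>. q \<in> V \<Longrightarrow> jac c d q (R (snd c q) \<eta>) =
        (\<Sum>i<k. \<kappa> i (snd c q) \<eta> *\<^sub>R fst (tcoord M d q (\<sigma> i q)))"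
      "\<And>q \<eta>. q \<in> V \<Longrightarrow> (\<Sum>i<k. \<kappa> i (snd c q) \<eta> *\<^sub>R (snd (tcoord M d q (\<sigma> i q)) o\<^sub>L jac c d q)) = \<eta>"
    and lift_unique: "\<And>q u a. q \<in> V \<Longrightarrow> jac c d q u = (\<Sum>i<k. a i *\<^sub>R fst (tcoord M d q (\<sigma> i q))) \<Longrightarrow>
        u = R (snd c q) (\<Sum>i<k. a i *\<^sub>R (snd (tcoord M d q (\<sigma> i q)) o\<^sub>L jac c d q))"
begin

lemmas Q = submfdD(1)[OF QM] and M = submfdD(2)[OF QM]

abbreviation "LQ \<equiv> induced_structure M L Q"

lemma in_top: "q \<in> V \<Longrightarrow> q \<in> topspace (mtop Q)" "q \<in> V \<Longrightarrow> q \<in> topspace (mtop M)"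
  using openin_subset[OF V] submfdD(3)[OF QM] by blast+

lemma L_max: "q \<in> V \<Longrightarrow> maximal_isotropic (L q)"
  using L in_top(2) unfolding dirac_structure_on_def by blast

lemma \<sigma>_in: "i < k \<Longrightarrow> q \<in> V \<Longrightarrow> \<sigma> i q \<in> L q"
  using \<sigma> in_top(2) unfolding sections_def by blast

lemma L_combination: "q \<in> V \<Longrightarrow> (\<Sum>i<k. a i *\<^sub>R \<sigma> i q) \<in> L q"
  using maximal_isotropicD(1)[OF L_max] \<sigma>_in by (intro subspace_sum subspace_scale) auto

lemma tcoord_combination:
  "tcoord M d q (\<Sum>i<k. a i *\<^sub>R \<sigma> i q) = (\<Sum>i<k. a i *\<^sub>R tcoord M d q (\<sigma> i q))"
  by (simp add: linear_sum[OF linear_tcoord] linear_scale[OF linear_tcoord])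

lemma fst_snd_combination:
  "fst (\<Sum>i\<in>I. a i *\<^sub>R p i) = (\<Sum>i\<in>I. a i *\<^sub>R fst (p i))"
  "snd (\<Sum>i\<in>I. a i *\<^sub>R p i) = (\<Sum>i\<in>I. a i *\<^sub>R snd (p i))"
  by (simp_all add: fst_sum snd_sum)

lemma compose_combination:
  "(\<Sum>i\<in>I. a i *\<^sub>R \<xi> i) o\<^sub>L T = (\<Sum>i\<in>I. a i *\<^sub>R (\<xi> i o\<^sub>L T))"
  by (rule blinfun_eqI) (simp add: blinfun.sum_left blinfun.bilinear_simps)

text \<open>One inclusion writes an element of \<open>L q\<close> in the frame and applies
  \<open>lift_unique\<close>; for the other, the coefficients \<open>\<kappa> i\<close> produce an
  element of \<open>L q\<close> over each covector.\<close>

lemma tcoord_LQ: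
  assumes q: "q \<in> V"
  shows "tcoord Q c q ` LQ q = {(R (snd c q) \<eta>, \<eta>) | \<eta>. True}"
proof -
  have "tcoord Q c q ` LQ q = {(u, \<zeta> o\<^sub>L jac c d q) | u \<zeta>. (jac c d q u, \<zeta>) \<in> tcoord M d q ` L q}"
    by (rule tcoord_induced[OF QM c _ d]) (use q Vc Vd in auto)
  also have "\<dots> = {(R (snd c q) \<eta>, \<eta>) | \<eta>. True}"
  proof (intro equalityI subsetI)
    fix p assume "p \<in> {(u, \<zeta> o\<^sub>L jac c d q) | u \<zeta>. (jac c d q u, \<zeta>) \<in> tcoord M d q ` L q}"
    then obtain u l where l: "l \<in> L q" "jac c d q u = fst (tcoord M d q l)"
      "p = (u, snd (tcoord M d q l) o\<^sub>L jac c d q)"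
      by (auto simp: image_iff prod_eq_iff)
    obtain a where a: "l = (\<Sum>i<k. a i *\<^sub>R \<sigma> i q)" using frame[OF q l(1)] by blast
    have "u = R (snd c q) (snd (tcoord M d q l) o\<^sub>L jac c d q)"
      using lift_unique[OF q, of u a] l(2)
      by (simp add: a tcoord_combination fst_snd_combination compose_combination)
    then show "p \<in> {(R (snd c q) \<eta>, \<eta>) | \<eta>. True}" using l(3) by auto
  next
    fix p assume "p \<in> {(R (snd c q) \<eta>, \<eta>) | \<eta>. True}"
    then obtain \<eta> where p: "p = (R (snd c q) \<eta>, \<eta>)" by blast
    define l where "l = (\<Sum>i<k. \<kappa> i (snd c q) \<eta> *\<^sub>R \<sigma> i q)"
    have l: "l \<in> L q" unfolding l_def by (rule L_combination[OF q])
    have "tcoord M d q l = (jac c d q (R (snd c q) \<eta>), snd (tcoord M d q l))"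
      by (rule prod_eqI) (simp_all add: lift(1)[OF q] l_def tcoord_combination fst_snd_combination)
    moreover have "snd (tcoord M d q l) o\<^sub>L jac c d q = \<eta>"
      using lift(2)[OF q, of \<eta>] by (simp add: l_def tcoord_combination fst_snd_combination compose_combination)
    ultimately show "p \<in> {(u, \<zeta> o\<^sub>L jac c d q) | u \<zeta>. (jac c d q u, \<zeta>) \<in> tcoord M d q ` L q}"
      using l p by (intro CollectI exI[of _ "R (snd c q) \<eta>"] exI[of _ "snd (tcoord M d q l)"])
        (metis imageI)
  qed
  finally show ?thesis .
qed

lemma LQ_iff: "q \<in> V \<Longrightarrow> p \<in> LQ q \<longleftrightarrow> fst (tcoord Q c q p) = R (snd c q) (snd (tcoord Q c q p))"
proof -
  assume q: "q \<in> V"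
  have "p \<in> LQ q \<longleftrightarrow> tcoord Q c q p \<in> tcoord Q c q ` LQ q"
    using inj_image_mem_iff[OF inj_tcoord[OF Q c], of q p "LQ q"] q Vc by auto
  also have "\<dots> \<longleftrightarrow> fst (tcoord Q c q p) = R (snd c q) (snd (tcoord Q c q p))"
    unfolding tcoord_LQ[OF q] by (auto simp: prod_eq_iff)
  finally show ?thesis .
qed

lemma LQ_isotropic: "q \<in> V \<Longrightarrow> isotropic (LQ q)"
  using induced_structure_isotropic[of L q Q M] L_max tmap_eq_jac[OF QM in_top(1)]
  unfolding maximal_isotropic_def by (simp add: blinfun.bounded_linear_right)

lemma LQ_total: "q \<in> V \<Longrightarrow> \<exists>u. (u, \<xi>) \<in> LQ q"
proof -
  assume q: "q \<in> V"
  note e = chart_at[OF Q in_top(1)[OF q]]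
  define \<eta> where "\<eta> = \<xi> o\<^sub>L jac c (chart_at Q q) q"
  have qc: "q \<in> fst c" using q Vc by blast
  define u where "u = jac c (chart_at Q q) q (R (snd c q) \<eta>)"
  have "tcoord Q c q (u, \<xi>) = (R (snd c q) \<eta>, \<eta>)"
    by (simp add: tcoord_def u_def \<eta>_def jac_inverse(2)[OF Q c e(1) qc e(2)])
  then have "(u, \<xi>) \<in> LQ q" using LQ_iff[OF q] by simp
  then show ?thesis by blast
qed

lemmas LQ_graph = LQ_isotropic LQ_total

lemma graph_vector_chart:
  assumes q: "q \<in> V" and c': "c' \<in> atlas Q" "q \<in> fst c'"
  shows "jac (chart_at Q q) c' q (graph_vector (LQ q) \<xi>) =
    jac c c' q (R (snd c q) (\<xi> o\<^sub>L jac c (chart_at Q q) q))"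
proof -
  have qc: "q \<in> fst c" using q Vc by blast
  have "(graph_vector (LQ q) \<xi>, \<xi>) \<in> LQ q" by (rule graph_vector_in[OF LQ_graph[OF q]])
  then have 1: "fst (tcoord Q c q (graph_vector (LQ q) \<xi>, \<xi>)) = R (snd c q) (\<xi> o\<^sub>L jac c (chart_at Q q) q)"
    unfolding LQ_iff[OF q] by (simp add: tcoord_def)
  show ?thesis
    using tcoord_change(1)[OF Q c c'(1) qc c'(2), of "(graph_vector (LQ q) \<xi>, \<xi>)"]
    unfolding 1 by (simp add: tcoord_def)
qed

lemma smooth_transition:
  assumes V': "openin (mtop Q) V'" "V' \<subseteq> V" and c': "c' \<in> atlas Q" and f: "smooth_on (snd c ` V') f"
  shows "smooth_on (snd c' ` (fst c' \<inter> V')) (\<lambda>z. f (transition c' c z))"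
    and "smooth_on (snd c' ` (fst c' \<inter> V')) (\<lambda>z. fderiv (transition c c') (transition c' c z))"
proof -
  note i = submfd_refl[OF Q] and fd = smooth_manifoldD(1)[OF Q]
  have o: "open (snd c' ` (fst c' \<inter> V'))" by (rule open_chart_image[OF Q c' V'(1)])
  have "V' \<subseteq> fst c" using V'(2) Vc by blast
  then have "open (snd c ` V')" using open_chart_image[OF Q c V'(1)] by (simp add: Int_absorb1)
  have t: "smooth_on (snd c' ` (fst c' \<inter> V')) (transition c' c)"
    by (rule smooth_on_subset[OF smooth_on_transition(2)[OF i c' c]]) (use \<open>V' \<subseteq> fst c\<close> in blast)
  have "transition c' c ` snd c' ` (fst c' \<inter> V') \<subseteq> snd c ` V'"
    by (auto simp: transition_chart[OF Q c'])
  from smooth_on_compose[OF fd o \<open>open (snd c ` V')\<close> this t f]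
  show "smooth_on (snd c' ` (fst c' \<inter> V')) (\<lambda>z. f (transition c' c z))" .
  have "transition c' c ` snd c' ` (fst c' \<inter> V') \<subseteq> snd c ` (fst c \<inter> fst c')"
    using \<open>V' \<subseteq> fst c\<close> by (auto simp: transition_chart[OF Q c'])
  from smooth_on_compose[OF fd o smooth_on_transition(1)[OF i c c'] this t smooth_on_jac[OF i c c']]
  show "smooth_on (snd c' ` (fst c' \<inter> V')) (\<lambda>z. fderiv (transition c c') (transition c' c z))" .
qed

text \<open>In the chart \<open>c\<close> the vector part is \<open>R\<close> applied to the
  covector; any other chart is reached by composing with the Jacobian of the change of charts.
  Smooth one-forms thus supply all the sections of \<open>L_Q\<close> needed below.\<close>

lemma smooth_section_graph:
  assumes V': "openin (mtop Q) V'" "V' \<subseteq> V"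
    and \<alpha>: "\<And>c'. c' \<in> atlas Q \<Longrightarrow> smooth_on (snd c' ` (fst c' \<inter> V')) (covrep Q c' \<alpha>)"
  shows "(\<lambda>q. (graph_vector (LQ q) (\<alpha> q), \<alpha> q)) \<in> sections Q V' LQ" (is "?s \<in> _")
proof -
  have "smooth_on (snd c' ` (fst c' \<inter> V')) (vrep Q c' (fst \<circ> ?s))" if c': "c' \<in> atlas Q" for c'
  proof (rule smooth_on_cong)
    show o: "open (snd c' ` (fst c' \<inter> V'))" by (rule open_chart_image[OF Q c' V'(1)])
    have "fst c \<inter> V' = V'" using V'(2) Vc by blast
    then have "smooth_on (snd c ` V') (\<lambda>y. R y (covrep Q c \<alpha> y))" "open (snd c ` V')"
      using \<alpha>[OF c] open_chart_image[OF Q c V'(1)] V'(2)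
      by (auto intro!: smooth_on_blinfun_apply intro: smooth_on_subset[OF smooth_R])
    note smooth_tr = smooth_transition[OF V' c' this(1)]
    show "smooth_on (snd c' ` (fst c' \<inter> V'))
        (\<lambda>z. fderiv (transition c c') (transition c' c z) (R (transition c' c z) (covrep Q c \<alpha> (transition c' c z))))"
      by (intro smooth_on_blinfun_apply o smooth_tr)
    fix z assume z: "z \<in> snd c' ` (fst c' \<inter> V')"
    obtain q where q: "q \<in> fst c'" "q \<in> V'" "z = snd c' q" using z by blast
    have qV: "q \<in> V" and qc: "q \<in> fst c" using q V' Vc by auto
    have "covrep Q c (snd \<circ> ?s) (snd c q) = \<alpha> q o\<^sub>L jac c (chart_at Q q) q"
      unfolding vrep_covrep_chart[OF Q c qc] by (simp add: tcoord_def)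
    then have "covrep Q c \<alpha> (snd c q) = \<alpha> q o\<^sub>L jac c (chart_at Q q) q" by (simp add: comp_def)
    then show "fderiv (transition c c') (transition c' c z) (R (transition c' c z) (covrep Q c \<alpha> (transition c' c z))) = vrep Q c' (fst \<circ> ?s) z"
      unfolding q(3) vrep_covrep_chart[OF Q c' q(1)] transition_chart[OF Q c' q(1)]
      by (simp add: tcoord_def graph_vector_chart[OF qV c' q(1)] jac_def[of c c', symmetric])
  qed
  moreover have "snd \<circ> ?s = \<alpha>" by auto
  ultimately show ?thesis
    using \<alpha> graph_vector_in[OF LQ_graph] V'(2) unfolding sections_def smooth_section_def by auto
qed

text \<open>The one-form has constant coordinates \<xi> in \<open>c\<^sub>0\<close>, and in another
  chart its coordinates are \<xi> composed with a Jacobian. With \<open>c\<^sub>0 = c\<close> it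
  yields a frame of \<open>L_Q\<close>; with the chart chosen at a point, the test sections for the
  Schouten bracket there.\<close>

lemma smooth_constant_covector:
  assumes c\<^sub>0: "c\<^sub>0 \<in> atlas Q" and V': "openin (mtop Q) V'" "V' \<subseteq> fst c\<^sub>0" and c': "c' \<in> atlas Q"
  shows "smooth_on (snd c' ` (fst c' \<inter> V')) (covrep Q c' (\<lambda>q. \<xi> o\<^sub>L jac (chart_at Q q) c\<^sub>0 q))"
proof (rule smooth_on_cong)
  show o: "open (snd c' ` (fst c' \<inter> V'))" by (rule open_chart_image[OF Q c' V'(1)])
  have "smooth_on (snd c' ` (fst c' \<inter> V')) (fderiv (transition c' c\<^sub>0))"
    by (rule smooth_on_subset[OF smooth_on_jac[OF submfd_refl[OF Q] c' c\<^sub>0]]) (use V'(2) in blast)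
  then show "smooth_on (snd c' ` (fst c' \<inter> V')) (\<lambda>z. \<xi> o\<^sub>L fderiv (transition c' c\<^sub>0) z)"
    by (intro smooth_on_blinfun_compose o smooth_on_const)
  fix z assume z: "z \<in> snd c' ` (fst c' \<inter> V')"
  obtain q where q: "q \<in> fst c'" "q \<in> V'" "z = snd c' q" using z by blast
  have "q \<in> topspace (mtop Q)" using q V'(1) openin_subset by blast
  note e = chart_at[OF Q this] and i = submfd_refl[OF Q]
  have q0: "q \<in> fst c\<^sub>0" using q V'(2) by blast
  show "\<xi> o\<^sub>L fderiv (transition c' c\<^sub>0) z = covrep Q c' (\<lambda>q. \<xi> o\<^sub>L jac (chart_at Q q) c\<^sub>0 q) z"
    using jac_comp[OF i i c' e(1) c\<^sub>0 q(1) e(2) q0]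
    by (simp add: q(3) covrep_def cinv_chart[OF Q c' q(1)] tchart_eq_jac(3)[OF Q c' q(1)]
        blinfun_compose_assoc jac_def)
qed

text \<open>The sections over the coordinate covectors of \<open>c\<close> form a frame on all of
  \<open>V\<close> at once; on each fibre this is \<open>graph_basis\<close> with \<open>A\<close>
  the Jacobian into \<open>c\<close>.\<close>

lemma LQ_subbundle: "smooth_subbundle_on Q V LQ"
  unfolding smooth_subbundle_on_def
proof
  fix x assume x: "x \<in> V"
  note fd = smooth_manifoldD(1)[OF Q]
  define n where "n = card (onb :: 'q set)"
  obtain h where h: "bij_betw h {..<n} (onb :: 'q set)"
    using ex_bij_betw_nat_finite[OF finite_onb[OF fd]] by (auto simp: n_def atLeast0LessThan)
  define \<alpha> where "\<alpha> v q = blinfun_inner_right v o\<^sub>L jac (chart_at Q q) c q" for v :: 'q and q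
  define s where "s j q = (graph_vector (LQ q) (\<alpha> (h j) q), \<alpha> (h j) q)" for j q
  have "s j \<in> sections Q V LQ" for j
    unfolding s_def
    by (rule smooth_section_graph[OF V subset_refl]) (unfold \<alpha>_def, rule smooth_constant_covector[OF c V Vc])
  then have "smooth_section Q V (s j)" for j unfolding sections_def by blast
  moreover have "inj_on (\<lambda>j. s j q) {..<n} \<and> independent ((\<lambda>j. s j q) ` {..<n}) \<and>
      span ((\<lambda>j. s j q) ` {..<n}) = LQ q" if q: "q \<in> V" for q
  proof -
    define \<Psi> where "\<Psi> v = (graph_vector (LQ q) (\<alpha> v q), \<alpha> v q)" for v
    note e = chart_at[OF Q in_top(1)[OF q]]
    have qc: "q \<in> fst c" using q Vc by blast
    note B = graph_basis[OF LQ_graph[OF q] fd jac_inverse(1)[OF Q c e(1) qc e(2)]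
        jac_inverse(1)[OF Q e(1) c e(2) qc], folded \<alpha>_def, folded \<Psi>_def]
    have s\<Psi>: "(\<lambda>j. s j q) = \<Psi> \<circ> h" by (auto simp: s_def \<Psi>_def)
    have "inj_on (\<lambda>j. s j q) {..<n}" unfolding s\<Psi>
      using h B(1) by (intro comp_inj_on) (auto simp: bij_betw_def intro: inj_on_subset)
    moreover have "(\<lambda>j. s j q) ` {..<n} = \<Psi> ` onb"
      unfolding s\<Psi> image_comp[symmetric] using h by (simp add: bij_betw_def)
    ultimately show ?thesis using B by simp
  qed
  ultimately show "\<exists>U k s. openin (mtop Q) U \<and> x \<in> U \<and> U \<subseteq> V \<and> (\<forall>i<k::nat. smooth_section Q U (s i)) \<and>
      (\<forall>y\<in>U. inj_on (\<lambda>i. s i y) {..<k} \<and> independent ((\<lambda>i. s i y) ` {..<k}) \<and>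
              span ((\<lambda>i. s i y) ` {..<k}) = LQ y)"
    using V x by (intro exI[of _ V] exI[of _ n] exI[of _ s]) blast
qed

text \<open>The smaller open set \<open>V'\<close> is allowed because \<open>schouten_zero\<close>
  uses sections that live only where a second chart meets \<open>V\<close>.\<close>

lemma LQ_courant_closed:
  assumes V': "openin (mtop Q) V'" "V' \<subseteq> V" and q: "q \<in> V'"
    and s: "s \<in> sections Q V' LQ" and t: "t \<in> sections Q V' LQ"
  shows "courant_bracket Q s t q \<in> LQ q"
proof -
  note fd = smooth_manifoldD(1)[OF Q]
  have qV: "q \<in> V" and qc: "q \<in> fst c" and qd: "q \<in> fst d" using q V' Vc Vd by auto
  have V'c: "V' \<subseteq> fst c" and V'd: "V' \<subseteq> fst d" using V' Vc Vd by auto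
  define S where "S = snd c ` V'"
  have Sc: "snd c ` (fst c \<inter> V') = S" using V'c by (simp add: S_def Int_absorb1)
  have S: "open S" "snd c q \<in> S" using open_chart_image[OF Q c V'(1)] q unfolding Sc by (auto simp: S_def)
  have \<phi>: "smooth_on S (transition c d)"
    by (rule smooth_on_subset[OF smooth_on_transition(2)[OF QM c d]]) (use V'c V'd in \<open>auto simp: S_def\<close>)
  have \<phi>q: "transition c d (snd c q) = snd d q" by (rule transition_chart[OF Q c qc])
  have ss: "smooth_section Q V' s" "smooth_section Q V' t" using s t unfolding sections_def by blast+
  \<comment> \<open>The coefficients, in the frame \<sigma>, of the lift of the section
    \<open>r\<close> to \<open>L\<close>.\<close>
  define f where "f r i y = blinfun_apply (\<kappa> i y) (covrep Q c (snd \<circ> r) y)" for r :: "'a \<Rightarrow> 'q \<times> ('q \<Rightarrow>\<^sub>L real)" and i y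
  have rep: "smooth_on S (vrep Q c (fst \<circ> r))" "smooth_on S (covrep Q c (snd \<circ> r))"
    if "r \<in> sections Q V' LQ" for r
    using that c unfolding sections_def smooth_section_def by (auto simp: Sc)
  have f: "(f r i has_derivative fderiv (f r i) (snd c q)) (at (snd c q))" if "r \<in> sections Q V' LQ" "i \<in> {..<k}" for r i
  proof (rule smooth_on_has_derivative[OF _ S(2)])
    show "smooth_on S (f r i)"
      unfolding f_def using that V'(2)
      by (intro smooth_on_blinfun_apply S(1) rep smooth_on_subset[OF smooth_\<kappa>]) (auto simp: S_def)
  qed
  have rel: "fderiv (transition c d) y (vrep Q c (fst \<circ> r) y) = (\<Sum>i<k. f r i y *\<^sub>R vrep M d (fst \<circ> \<sigma> i) (transition c d y))"
    "covrep Q c (snd \<circ> r) y = (\<Sum>i<k. f r i y *\<^sub>R (covrep M d (snd \<circ> \<sigma> i) (transition c d y) o\<^sub>L fderiv (transition c d) y))"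
    if r: "r \<in> sections Q V' LQ" and y: "y \<in> S" for r y
  proof -
    obtain p where p: "p \<in> V'" "y = snd c p" using y S_def by blast
    have pV: "p \<in> V" and pc: "p \<in> fst c" and pd: "p \<in> fst d" using p V' V'c V'd by auto
    have "r p \<in> LQ p" using r p unfolding sections_def by blast
    then have "vrep Q c (fst \<circ> r) y = R y (covrep Q c (snd \<circ> r) y)"
      unfolding LQ_iff[OF pV] p(2) vrep_covrep_chart[OF Q c pc] .
    then show "fderiv (transition c d) y (vrep Q c (fst \<circ> r) y) = (\<Sum>i<k. f r i y *\<^sub>R vrep M d (fst \<circ> \<sigma> i) (transition c d y))"
      using lift(1)[OF pV, of "covrep Q c (snd \<circ> r) y"]
      by (simp add: f_def p(2) transition_chart[OF Q c pc] vrep_covrep_chart[OF M d pd] jac_def)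
    show "covrep Q c (snd \<circ> r) y = (\<Sum>i<k. f r i y *\<^sub>R (covrep M d (snd \<circ> \<sigma> i) (transition c d y) o\<^sub>L fderiv (transition c d) y))"
      using lift(2)[OF pV, of "covrep Q c (snd \<circ> r) y"]
      by (simp add: f_def p(2) transition_chart[OF Q c pc] vrep_covrep_chart[OF M d pd] jac_def)
  qed
  have s\<sigma>: "smooth_section M (topspace (mtop M)) (\<sigma> i)" if "i < k" for i
    using \<sigma>[OF that] unfolding sections_def by blast
  have d\<sigma>: "vrep M d (fst \<circ> \<sigma> i) differentiable (at (snd d q))" "covrep M d (snd \<circ> \<sigma> i) differentiable (at (snd d q))"
    if "i \<in> {..<k}" for i
    using s\<sigma>[of i] that d qd in_top(2)[OF qV] unfolding smooth_section_def
    by (auto intro!: smooth_on_differentiable)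
  have iso: "fderiv (f s i) (snd c q) v * (covrep M d (snd \<circ> \<sigma> j) (snd d q) (vrep M d (fst \<circ> \<sigma> i) (snd d q)) +
      covrep M d (snd \<circ> \<sigma> i) (snd d q) (vrep M d (fst \<circ> \<sigma> j) (snd d q))) = 0"
    if "i \<in> {..<k}" "j \<in> {..<k}" for i j v
  proof -
    have "pairing (tcoord M d q (\<sigma> i q)) (tcoord M d q (\<sigma> j q)) = 0"
      unfolding pairing_tcoord[OF M d qd] using maximal_isotropicD(2)[OF L_max[OF qV]] \<sigma>_in[OF _ qV] that by auto
    then show ?thesis unfolding vrep_covrep_chart[OF M d qd] by (simp add: pairing_def add.commute)
  qed
  note ds = smooth_on_differentiable[OF rep(1)[OF s] S(2)] and dt = smooth_on_differentiable[OF rep(1)[OF t] S(2)]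
  note pb = coord_courant_pullback[OF fd S \<phi> f[OF s] f[OF t] _ _ _ _ ds dt rel(1)[OF s] rel(2)[OF s] rel(1)[OF t] rel(2)[OF t],
      unfolded \<phi>q, OF _ _ d\<sigma> d\<sigma> _ _ _ _ iso]
  define Z where "Z = coord_courant (vrep Q c (fst \<circ> s)) (covrep Q c (snd \<circ> s)) (vrep Q c (fst \<circ> t)) (covrep Q c (snd \<circ> t)) (snd c q)"
  have Z: "tcoord Q c q (courant_bracket Q s t q) = Z"
    unfolding Z_def by (rule courant_bracket_tcoord[OF Q V'(1) q ss c qc])
  define g' f' where "g' j = fderiv (f t j) (snd c q) (vrep Q c (fst \<circ> s) (snd c q))"
    and "f' j = fderiv (f s j) (snd c q) (vrep Q c (fst \<circ> t) (snd c q))" for j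
  define F where "F i j = f s i (snd c q) * f t j (snd c q)" for i j
  \<comment> \<open>The right side of the pullback formula, read in \<open>L q\<close>: frame
    elements together with brackets of global sections of \<open>L\<close>, which integrability
    keeps in \<open>L q\<close>. The formula says that the bracket over \<open>Q\<close> lifts to
    \<open>l\<close>.\<close>
  define l where "l = (\<Sum>j<k. g' j *\<^sub>R \<sigma> j q) - (\<Sum>i<k. f' i *\<^sub>R \<sigma> i q) +
      (\<Sum>i<k. \<Sum>j<k. F i j *\<^sub>R courant_bracket M (\<sigma> i) (\<sigma> j) q)"
  have cb: "courant_bracket M (\<sigma> i) (\<sigma> j) q \<in> L q" if "i < k" "j < k" for i j
    using L \<sigma> that in_top(2)[OF qV] unfolding dirac_structure_on_def sections_def by blast
  note subL = maximal_isotropicD(1)[OF L_max[OF qV]]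
  have lL: "l \<in> L q" unfolding l_def
    by (intro subspace_add[OF subL] subspace_diff[OF subL] subspace_sum[OF subL] subspace_scale[OF subL] cb \<sigma>_in[OF _ qV]) auto
  have cbt: "tcoord M d q (courant_bracket M (\<sigma> i) (\<sigma> j) q) =
      coord_courant (vrep M d (fst \<circ> \<sigma> i)) (covrep M d (snd \<circ> \<sigma> i)) (vrep M d (fst \<circ> \<sigma> j)) (covrep M d (snd \<circ> \<sigma> j)) (snd d q)"
    if "i < k" "j < k" for i j
    by (rule courant_bracket_tcoord[OF M openin_topspace in_top(2)[OF qV] s\<sigma>[OF that(1)] s\<sigma>[OF that(2)] d qd])
  have tl: "tcoord M d q l = (\<Sum>j<k. g' j *\<^sub>R tcoord M d q (\<sigma> j q)) - (\<Sum>i<k. f' i *\<^sub>R tcoord M d q (\<sigma> i q)) +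
      (\<Sum>i<k. \<Sum>j<k. F i j *\<^sub>R tcoord M d q (courant_bracket M (\<sigma> i) (\<sigma> j) q))"
    unfolding l_def linear_add[OF linear_tcoord] linear_diff[OF linear_tcoord] linear_sum[OF linear_tcoord]
      linear_scale[OF linear_tcoord] ..
  have "jac c d q (fst Z) = (\<Sum>j<k. g' j *\<^sub>R vrep M d (fst \<circ> \<sigma> j) (snd d q)) - (\<Sum>i<k. f' i *\<^sub>R vrep M d (fst \<circ> \<sigma> i) (snd d q)) +
      (\<Sum>i<k. \<Sum>j<k. F i j *\<^sub>R fst (coord_courant (vrep M d (fst \<circ> \<sigma> i)) (covrep M d (snd \<circ> \<sigma> i))
        (vrep M d (fst \<circ> \<sigma> j)) (covrep M d (snd \<circ> \<sigma> j)) (snd d q)))"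
    unfolding Z_def jac_def g'_def f'_def F_def by (rule pb(1))
  also have "\<dots> = fst (tcoord M d q l)"
    unfolding tl by (simp add: fst_sum vrep_covrep_chart[OF M d qd] cbt)
  finally have "fst (tcoord M d q l) = jac c d q (fst Z)" ..
  moreover have "snd Z = ((\<Sum>j<k. g' j *\<^sub>R covrep M d (snd \<circ> \<sigma> j) (snd d q)) - (\<Sum>i<k. f' i *\<^sub>R covrep M d (snd \<circ> \<sigma> i) (snd d q)) +
      (\<Sum>i<k. \<Sum>j<k. F i j *\<^sub>R snd (coord_courant (vrep M d (fst \<circ> \<sigma> i)) (covrep M d (snd \<circ> \<sigma> i))
        (vrep M d (fst \<circ> \<sigma> j)) (covrep M d (snd \<circ> \<sigma> j)) (snd d q)))) o\<^sub>L jac c d q"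
    unfolding Z_def jac_def g'_def f'_def F_def by (rule pb(2))
  then have "snd Z = snd (tcoord M d q l) o\<^sub>L jac c d q"
    unfolding tl by (simp add: snd_sum vrep_covrep_chart[OF M d qd] cbt)
  ultimately have "(jac c d q (fst Z), snd (tcoord M d q l)) = tcoord M d q l"
    "Z = (fst Z, snd (tcoord M d q l) o\<^sub>L jac c d q)" by (simp_all add: prod_eq_iff)
  then have "Z \<in> tcoord Q c q ` LQ q"
    unfolding tcoord_induced[OF QM c qc d qd] using lL by (metis (mono_tags, lifting) image_eqI mem_Collect_eq)
  then show ?thesis
    using inj_image_mem_iff[OF inj_tcoord[OF Q c qc]] unfolding Z[symmetric] by blast
qed

lemma LQ_dirac: "dirac_structure_on Q V LQ"
  unfolding dirac_structure_on_def
proof (intro conjI ballI)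
  show "maximal_isotropic (LQ q)" if "q \<in> V" for q
    by (rule graph_maximal_isotropic[OF LQ_graph[OF that]])
  show "courant_bracket Q s t \<in> sections Q V LQ" if "s \<in> sections Q V LQ" "t \<in> sections Q V LQ" for s t
    using LQ_courant_closed[OF V subset_refl _ that] smooth_section_courant_bracket[OF Q V, of s t] that
    unfolding sections_def by blast
qed (rule V LQ_subbundle)+

abbreviation "\<pi> \<equiv> \<lambda>q. graph_bivector (LQ q)"

text \<open>Expresses the components of \<pi> through vector parts of sections of
  \<open>L_Q\<close>, whose smoothness and derivatives are under control.\<close>

lemma birep_chart:
  assumes c': "c' \<in> atlas Q" and q: "q \<in> V" "q \<in> fst c'"
  shows "birep Q c' \<pi> (snd c' q) \<xi> \<eta> =
    \<eta> (vrep Q c' (fst \<circ> (\<lambda>q. (graph_vector (LQ q) (\<xi> o\<^sub>L jac (chart_at Q q) c' q),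
       \<xi> o\<^sub>L jac (chart_at Q q) c' q))) (snd c' q))"
  unfolding vrep_covrep_chart[OF Q c' q(2)]
  by (simp add: birep_def cinv_chart[OF Q c' q(2)] tchart_eq_jac(2)[OF Q c' q(2)] graph_bivector_def tcoord_def)

lemma constant_covector_section:
  assumes c': "c' \<in> atlas Q"
  shows "(\<lambda>q. (graph_vector (LQ q) (\<xi> o\<^sub>L jac (chart_at Q q) c' q), \<xi> o\<^sub>L jac (chart_at Q q) c' q))
    \<in> sections Q (V \<inter> fst c') LQ"
proof -
  have o: "openin (mtop Q) (V \<inter> fst c')" by (rule openin_Int[OF V chart_domain(1)[OF Q c']])
  show ?thesis
    by (rule smooth_section_graph[OF o Int_lower1]) (rule smooth_constant_covector[OF c' o Int_lower2])
qed

lemma bivector_field: "bivector_field_on Q V \<pi>"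
  unfolding bivector_field_on_def
proof (intro conjI ballI allI)
  show "is_bivector (\<pi> q)" if "q \<in> V" for q
    by (rule is_bivector_graph_bivector[OF LQ_graph[OF that]])
  fix c' and \<xi> \<eta> :: "'q \<Rightarrow>\<^sub>L real" assume c': "c' \<in> atlas Q"
  define s where "s = (\<lambda>q. (graph_vector (LQ q) (\<xi> o\<^sub>L jac (chart_at Q q) c' q), \<xi> o\<^sub>L jac (chart_at Q q) c' q))"
  have o: "open (snd c' ` (fst c' \<inter> V))" by (rule open_chart_image[OF Q c' V])
  have "smooth_on (snd c' ` (fst c' \<inter> (V \<inter> fst c'))) (vrep Q c' (fst \<circ> s))"
    using constant_covector_section[OF c', of \<xi>] c' unfolding s_def sections_def smooth_section_def by blast
  moreover have "fst c' \<inter> (V \<inter> fst c') = fst c' \<inter> V" by blast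
  ultimately have "smooth_on (snd c' ` (fst c' \<inter> V)) (\<lambda>z. \<eta> (vrep Q c' (fst \<circ> s) z))"
    by (intro smooth_on_compose_bounded_linear[OF blinfun.bounded_linear_right o]) simp
  then show "smooth_on (snd c' ` (fst c' \<inter> V)) (\<lambda>z. birep Q c' \<pi> z \<xi> \<eta>)"
    by (rule smooth_on_cong[OF o, rotated]) (auto simp: birep_chart[OF c'] s_def)
qed

text \<open>For sections of \<open>L_Q\<close> over covectors that are constant in the chart at
  \<open>q\<close>, the bracket of two of them lies in \<open>L_Q\<close> and is therefore
  orthogonal to the third. Written out, this orthogonality is the Jacobi identity.\<close>

lemma schouten_zero:
  assumes q: "q \<in> V"
  shows "schouten_bracket Q \<pi> \<pi> q \<xi> \<eta> \<zeta> = 0"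
proof -
  define e where "e = chart_at Q q"
  note e = chart_at[OF Q in_top(1)[OF q], folded e_def]
  define V' where "V' = V \<inter> fst e"
  have V': "openin (mtop Q) V'" "V' \<subseteq> V" "q \<in> V'"
    using openin_Int[OF V chart_domain(1)[OF Q e(1)]] q e(2) by (auto simp: V'_def)
  define S where "S = snd e ` (fst e \<inter> V')"
  have S: "open S" "snd e q \<in> S"
    using open_chart_image[OF Q e(1) V'(1)] V'(3) e(2) by (auto simp: S_def)
  define s where "s \<xi> = (\<lambda>q. (graph_vector (LQ q) (\<xi> o\<^sub>L jac (chart_at Q q) e q), \<xi> o\<^sub>L jac (chart_at Q q) e q))" for \<xi>
  have s: "s \<xi> \<in> sections Q V' LQ" for \<xi>
    unfolding s_def V'_def by (rule constant_covector_section[OF e(1)])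
  then have ss: "smooth_section Q V' (s \<xi>)" for \<xi> unfolding sections_def by blast
  define X where "X \<xi> = vrep Q e (fst \<circ> s \<xi>)" for \<xi>
  have X: "smooth_on S (X \<xi>)" for \<xi>
    using ss e(1) unfolding smooth_section_def S_def X_def by blast
  define y where "y = snd e q"
  have cov: "covrep Q e (snd \<circ> s \<xi>) z = \<xi>" if z: "z \<in> S" for z \<xi>
  proof -
    obtain p where p: "p \<in> fst e" "p \<in> V" "z = snd e p" using z unfolding S_def V'_def by blast
    note ep = chart_at[OF Q in_top(1)[OF p(2)]]
    show ?thesis
      unfolding p(3) vrep_covrep_chart[OF Q e(1) p(1)]
      by (rule blinfun_eqI) (simp add: tcoord_def s_def jac_inverse(2)[OF Q e(1) ep(1) p(1) ep(2)])
  qed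
  \<comment> \<open>With constant covectors only derivatives of the vector parts survive in the
    bracket.\<close>
  have bdcov: "fderiv (covrep Q e (snd \<circ> s \<xi>)) y = 0" for \<xi>
    by (rule fderiv_eqI, rule has_derivative_transform_within_open[of "\<lambda>_. \<xi>" _ _ _ S])
      (use S cov in \<open>auto simp: y_def zero_blinfun.rep_eq[abs_def]\<close>)
  have bi: "\<eta> (X \<xi> z) = birep Q e \<pi> z \<xi> \<eta>" if z: "z \<in> S" for z and \<xi> \<eta> :: "'q \<Rightarrow>\<^sub>L real"
  proof -
    obtain p where p: "p \<in> fst e" "p \<in> V" "z = snd e p" using z unfolding S_def V'_def by blast
    show ?thesis unfolding p(3) birep_chart[OF e(1) p(2,1)] X_def s_def ..
  qed
  have D: "frechet_derivative (\<lambda>z. birep Q e \<pi> z \<xi> \<eta>) (at y) w = \<eta> (fderiv (X \<xi>) y w)" for \<xi> \<eta> :: "'q \<Rightarrow>\<^sub>L real" and w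
  proof -
    have "((\<lambda>z. \<eta> (X \<xi> z)) has_derivative (\<lambda>w. \<eta> (fderiv (X \<xi>) y w))) (at y)"
      by (rule bounded_linear.has_derivative[OF blinfun.bounded_linear_right smooth_on_has_derivative[OF X]])
        (simp add: y_def S)
    from has_derivative_transform_within_open[OF this S(1) _ bi]
    have "((\<lambda>z. birep Q e \<pi> z \<xi> \<eta>) has_derivative (\<lambda>w. \<eta> (fderiv (X \<xi>) y w))) (at y)"
      by (simp add: y_def S)
    then show ?thesis by (metis frechet_derivative_at)
  qed
  have skew: "birep Q e \<pi> z \<xi> \<eta> = - birep Q e \<pi> z \<eta> \<xi>" if z: "z \<in> S" for z and \<xi> \<eta> :: "'q \<Rightarrow>\<^sub>L real"
  proof -
    obtain p where p: "p \<in> fst e" "p \<in> V" "z = snd e p" using z unfolding S_def V'_def by blast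
    show ?thesis
      unfolding birep_def p(3) cinv_chart[OF Q e(1) p(1)] by (rule graph_bivector_skew[OF LQ_graph[OF p(2)]])
  qed
  have Dskew: "\<eta> (fderiv (X \<xi>) y w) = - \<xi> (fderiv (X \<eta>) y w)" for \<xi> \<eta> :: "'q \<Rightarrow>\<^sub>L real" and w
  proof -
    have "((\<lambda>z. \<eta> (X \<xi> z)) has_derivative (\<lambda>w. \<eta> (fderiv (X \<xi>) y w))) (at y)" for \<xi> \<eta> :: "'q \<Rightarrow>\<^sub>L real"
      by (rule bounded_linear.has_derivative[OF blinfun.bounded_linear_right smooth_on_has_derivative[OF X]])
        (simp add: y_def S)
    note h = this
    have "((\<lambda>z. \<eta> (X \<xi> z)) has_derivative (\<lambda>w. - \<xi> (fderiv (X \<eta>) y w))) (at y)"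
    proof (rule has_derivative_transform_within_open[OF has_derivative_minus[OF h] S(1)])
      show "y \<in> S" unfolding y_def by (rule S(2))
      show "- \<xi> (X \<eta> z) = \<eta> (X \<xi> z)" if "z \<in> S" for z
        unfolding bi[OF that] by (rule skew[OF that, symmetric])
    qed
    from has_derivative_unique[OF h this] show ?thesis by (rule fun_cong)
  qed
  have Xq: "X \<xi> y = graph_vector (LQ q) \<xi>" for \<xi>
    unfolding X_def y_def vrep_covrep_chart[OF Q e]
    using jac_id[OF Q e] by (simp add: tcoord_def s_def e_def[symmetric])
      (metis blinfun_apply_id_blinfun blinfun_apply_blinfun_compose blinfun_eqI)
  define B where "B = courant_bracket Q (s \<xi>) (s \<eta>) q"
  have "B \<in> LQ q" unfolding B_def by (rule LQ_courant_closed[OF V' s s])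
  then have "pairing B (s \<zeta> q) = 0"
    using graph_pairing[OF LQ_graph[OF q]] s[of \<zeta>] V'(3) unfolding sections_def by blast
  then have "pairing (tcoord Q e q B) (tcoord Q e q (s \<zeta> q)) = 0"
    by (simp add: pairing_tcoord[OF Q e])
  moreover have "tcoord Q e q B = coord_courant (X \<xi>) (covrep Q e (snd \<circ> s \<xi>)) (X \<eta>) (covrep Q e (snd \<circ> s \<eta>)) y"
    unfolding B_def X_def y_def by (rule courant_bracket_tcoord[OF Q V'(1,3) ss ss e])
  moreover have "tcoord Q e q (s \<zeta> q) = (X \<zeta> y, \<zeta>)"
    using cov[of y \<zeta>] S(2) unfolding X_def y_def vrep_covrep_chart[OF Q e] by (simp add: prod_eq_iff)
  ultimately have jacobi: "\<zeta> (fderiv (X \<eta>) y (X \<xi> y)) - \<zeta> (fderiv (X \<xi>) y (X \<eta> y)) + \<eta> (fderiv (X \<xi>) y (X \<zeta> y)) = 0"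
    using S(2) by (simp add: pairing_def coord_courant_def bdcov cov y_def[symmetric] blinfun.bilinear_simps)
  \<comment> \<open>Skewness moves \<zeta> into the argument of \<open>X\<close> and completes the
    cyclic sum; the Schouten bracket is twice this sum.\<close>
  have "\<eta> (fderiv (X \<xi>) y (X \<zeta> y)) + \<zeta> (fderiv (X \<eta>) y (X \<xi> y)) + \<xi> (fderiv (X \<zeta>) y (X \<eta> y)) = 0"
    using jacobi Dskew[of \<xi> \<zeta> "X \<eta> y"] by simp
  then show ?thesis
    unfolding schouten_bracket_def Let_def e_def[symmetric] coord_at_def y_def[symmetric]
      sharp_graph_bivector[OF LQ_graph[OF q]] Xq[symmetric] D by simp
qed

lemma poisson: "poisson_structure_on Q V \<pi>"
  unfolding poisson_structure_on_def using bivector_field schouten_zero by blast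

end

section \<open>Transversality\<close>

text \<open>Adjoining the line through \<open>p\<close> to \<open>W\<close> leaves it isotropic, so
  maximality says that nothing was added.\<close>

lemma maximal_isotropic_memI:
  assumes W: "maximal_isotropic W" and p: "pairing p p = 0" "\<And>w. w \<in> W \<Longrightarrow> pairing w p = 0"
  shows "p \<in> W"
proof -
  note S = maximal_isotropicD(1)[OF W]
  have bil: "pairing (a + r *\<^sub>R p) (b + t *\<^sub>R p) = pairing a b + t * pairing a p + r * pairing b p + r * t * pairing p p"
    for a b r t
    by (simp add: pairing_def blinfun.bilinear_simps algebra_simps add_divide_distrib)
  define W' where "W' = {w + t *\<^sub>R p | w t. w \<in> W}"
  have "isotropic W'"
    unfolding isotropic_def
  proof (intro conjI ballI subspaceI)
    show "0 \<in> W'" unfolding W'_def using subspace_0[OF S] by (intro CollectI exI[of _ 0]) auto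
    fix x y assume "x \<in> W'" "y \<in> W'"
    then obtain a r b t where a: "x = a + r *\<^sub>R p" "a \<in> W" and b: "y = b + t *\<^sub>R p" "b \<in> W"
      unfolding W'_def by blast
    have "x + y = (a + b) + (r + t) *\<^sub>R p" by (simp add: a b algebra_simps)
    then show "x + y \<in> W'" unfolding W'_def using subspace_add[OF S a(2) b(2)] by blast
    show "pairing x y = 0" unfolding a(1) b(1) bil using p a(2) b(2) maximal_isotropicD(2)[OF W] by simp
  next
    fix c x assume "x \<in> W'"
    then obtain a r where a: "x = a + r *\<^sub>R p" "a \<in> W" unfolding W'_def by blast
    have "c *\<^sub>R x = c *\<^sub>R a + (c * r) *\<^sub>R p" by (simp add: a algebra_simps)
    then show "c *\<^sub>R x \<in> W'" unfolding W'_def using subspace_scale[OF S a(2)] by blast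
  qed
  moreover have "W \<subseteq> W'"
  proof
    fix w assume "w \<in> W"
    then show "w \<in> W'" unfolding W'_def by (intro CollectI exI[of _ w] exI[of _ 0]) simp
  qed
  ultimately have "W' = W" using W unfolding maximal_isotropic_def by blast
  moreover have "p \<in> W'" unfolding W'_def using subspace_0[OF S] by (intro CollectI exI[of _ 0] exI[of _ 1]) simp
  ultimately show ?thesis by simp
qed

section \<open>From the fibre at \<open>m\<^sub>0\<close> to a lift near
  \<open>m\<^sub>0\<close>\<close>

text \<open>Supplies the coordinate functionals that \<open>smooth_coordinates\<close> starts from.
  Independence makes the chosen coordinates unique, hence linear; \<open>bl\<close> then makes them
  continuous.\<close>

lemma dual_coordinates:
  fixes w :: "'j \<Rightarrow> 'e::real_normed_vector"
  assumes J: "finite J" and bl: "\<And>f :: 'e \<Rightarrow> real. linear f \<Longrightarrow> bounded_linear f"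
    and span: "\<And>e. \<exists>a. (\<Sum>j\<in>J. a j *\<^sub>R w j) = e"
    and indep: "\<And>a j. (\<Sum>j\<in>J. a j *\<^sub>R w j) = 0 \<Longrightarrow> j \<in> J \<Longrightarrow> a j = 0"
  obtains c :: "'j \<Rightarrow> 'e \<Rightarrow>\<^sub>L real" where "\<And>e. (\<Sum>j\<in>J. c j e *\<^sub>R w j) = e"
    "\<And>a i. i \<in> J \<Longrightarrow> c i (\<Sum>j\<in>J. a j *\<^sub>R w j) = a i"
proof -
  define A where "A e = (SOME a. (\<Sum>j\<in>J. a j *\<^sub>R w j) = e)" for e
  have A: "(\<Sum>j\<in>J. A e j *\<^sub>R w j) = e" for e
    unfolding A_def by (rule someI_ex[OF span])
  have uniq: "a j = b j" if "(\<Sum>j\<in>J. a j *\<^sub>R w j) = (\<Sum>j\<in>J. b j *\<^sub>R w j)" "j \<in> J" for a b j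
    using indep[of "\<lambda>j. a j - b j" j] that by (simp add: scaleR_diff_left sum_subtractf)
  have "linear (\<lambda>e. A e j)" if j: "j \<in> J" for j
  proof (rule linearI)
    show "A (x + y) j = A x j + A y j" for x y
      using uniq[of "A (x + y)" "\<lambda>j. A x j + A y j" j] j
      by (simp add: A scaleR_add_left sum.distrib)
    show "A (r *\<^sub>R x) j = r *\<^sub>R A x j" for r x
    proof -
      have "(\<Sum>j\<in>J. (r * A x j) *\<^sub>R w j) = r *\<^sub>R (\<Sum>j\<in>J. A x j *\<^sub>R w j)"
        by (simp add: scaleR_sum_right)
      then show ?thesis using uniq[of "A (r *\<^sub>R x)" "\<lambda>j. r * A x j" j] j by (simp add: A)
    qed
  qed
  then have c: "blinfun_apply (Blinfun (\<lambda>e. A e j)) = (\<lambda>e. A e j)" if "j \<in> J" for j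
    using that bl bounded_linear_Blinfun_apply by blast
  show ?thesis
  proof (rule that[of "\<lambda>j. Blinfun (\<lambda>e. A e j)"])
    show "(\<Sum>j\<in>J. blinfun_apply (Blinfun (\<lambda>e. A e j)) e *\<^sub>R w j) = e" for e
      using A[of e] by (simp add: c)
    show "blinfun_apply (Blinfun (\<lambda>e. A e i)) (\<Sum>j\<in>J. a j *\<^sub>R w j) = a i" if "i \<in> J" for a i
      using uniq[OF A that] by (simp add: c[OF that])
  qed
qed

text \<open>The model of T_qM \<times> T_q^*Q carries the operator norm on its second factor and no
  inner product. Covectors are expanded in the functionals dual to \<open>onb\<close> instead, with
  evaluations as coefficients.\<close>

lemma bounded_linear_on_cotangent_sum:
  fixes f :: "'m::real_inner \<times> ('q::real_inner \<Rightarrow>\<^sub>L real) \<Rightarrow> real"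
  assumes "finite_dim TYPE('m)" "finite_dim TYPE('q)" "linear f"
  shows "bounded_linear f"
proof -
  have "linear (\<lambda>v. f (v, 0))"
  proof (rule linearI)
    show "f (u + v, 0) = f (u, 0) + f (v, 0)" for u v using linear_add[OF assms(3), of "(u, 0)" "(v, 0)"] by simp
    show "f (r *\<^sub>R v, 0) = r *\<^sub>R f (v, 0)" for r v using linear_scale[OF assms(3), of r "(v, 0)"] by simp
  qed
  then have 1: "bounded_linear (\<lambda>v. f (v, 0))" by (rule linear_imp_bounded_linear[OF assms(1)])
  have eq: "f p = f (fst p, 0) + (\<Sum>b\<in>onb. snd p b * f (0, blinfun_inner_right b))" for p
  proof -
    have "snd p = (\<Sum>b\<in>onb. snd p b *\<^sub>R blinfun_inner_right b)"
    proof (rule blinfun_eqI)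
      show "snd p v = (\<Sum>b\<in>onb. snd p b *\<^sub>R blinfun_inner_right b) v" for v
        using linear_onb[OF assms(2) bounded_linear.linear[OF blinfun.bounded_linear_right], of "snd p" v]
        by (simp add: blinfun.sum_left blinfun.scaleR_left mult.commute inner_commute)
    qed
    then have "p = (fst p, 0) + (\<Sum>b\<in>onb. snd p b *\<^sub>R (0, blinfun_inner_right b))"
      by (simp add: prod_eq_iff fst_sum snd_sum)
    then have "f p = f ((fst p, 0) + (\<Sum>b\<in>onb. snd p b *\<^sub>R (0, blinfun_inner_right b)))" by (rule arg_cong)
    then show ?thesis
      by (simp only: linear_add[OF assms(3)] linear_sum[OF assms(3)] linear_scale[OF assms(3)] real_scaleR_def)
  qed
  have "bounded_linear (\<lambda>p :: 'm \<times> ('q \<Rightarrow>\<^sub>L real). f (fst p, 0) + (\<Sum>b\<in>onb. blinfun_apply (snd p) b * f (0, blinfun_inner_right b)))"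
    by (intro bounded_linear_add bounded_linear_sum bounded_linear_compose[OF 1 bounded_linear_fst]
        bounded_linear_mult_left[THEN bounded_linear_compose]
        bounded_linear_compose[OF blinfun.bounded_linear_left bounded_linear_snd])
  then show ?thesis unfolding eq[symmetric] .
qed

lemma smooth_on_Pair:
  assumes "open S" "smooth_on S f" "smooth_on S g"
  shows "smooth_on S (\<lambda>x. (f x, g x))"
proof -
  have "bounded_linear (\<lambda>a. (a, 0))" "bounded_linear (\<lambda>b. (0, b))"
    by (intro bounded_linear_Pair bounded_linear_ident bounded_linear_zero)+
  from smooth_on_add[OF assms(1) smooth_on_compose_bounded_linear[OF this(1) assms(1,2)]
      smooth_on_compose_bounded_linear[OF this(2) assms(1,3)]]
  show ?thesis by simp
qed

text \<open>The fibrewise statement: transversality makes \<open>(u, l) \<mapsto> (T u - pr\<^sub>1 l, pr\<^sub>2 l \<circ> T)\<close> an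
  isomorphism from \<open>T\<^sub>qQ \<times> L\<^sub>q\<close> onto \<open>T\<^sub>qM \<times> T\<^sub>q\<^sup>*Q\<close>.\<close>

lemma transversal_fibre:
  fixes T :: "'q::real_inner \<Rightarrow>\<^sub>L 'm::real_inner"
  assumes fd: "finite_dim TYPE('m)" and W: "maximal_isotropic W" and injT: "inj (blinfun_apply T)"
    and sum: "\<And>x. \<exists>p\<in>fst ` W. \<exists>u. x = p + T u" and int: "fst ` W \<inter> range (blinfun_apply T) = {0}"
  shows "\<exists>u. \<exists>l\<in>W. T u - fst l = v \<and> snd l o\<^sub>L T = \<eta>"
    and "\<And>u l. l \<in> W \<Longrightarrow> T u = fst l \<Longrightarrow> snd l o\<^sub>L T = 0 \<Longrightarrow> u = 0 \<and> l = 0"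
proof -
  note S = maximal_isotropicD(1)[OF W] and iso = maximal_isotropicD(2)[OF W]
  have T0: "u = 0" if "T u = 0" for u using injD[OF injT, of u 0] that by simp
  have inW: "p + r \<in> fst ` W" "t *\<^sub>R p \<in> fst ` W" if pr: "p \<in> fst ` W" "r \<in> fst ` W" for p r t
  proof -
    obtain a b where ab: "a \<in> W" "b \<in> W" "p = fst a" "r = fst b" using pr by blast
    show "p + r \<in> fst ` W" by (rule image_eqI[of _ _ "a + b"]) (simp_all add: ab subspace_add[OF S])
    show "t *\<^sub>R p \<in> fst ` W" by (rule image_eqI[of _ _ "t *\<^sub>R a"]) (simp_all add: ab subspace_scale[OF S])
  qed
  have decomp: "u = u'" if "p + T u = p' + T u'" "p \<in> fst ` W" "p' \<in> fst ` W" for p u p' u'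
  proof -
    have "p + (-1) *\<^sub>R p' \<in> fst ` W" using inW that by blast
    moreover have "p + (-1) *\<^sub>R p' = T (u' - u)" using that(1) by (simp add: blinfun.diff_right algebra_simps)
    ultimately have "T (u' - u) = 0" using int by auto
    then show ?thesis using T0[of "u' - u"] by simp
  qed
  \<comment> \<open>The projection of T_qM onto T_qQ along pr_1 \<open>W\<close>.\<close>
  define \<rho> where "\<rho> x = (SOME u. \<exists>p\<in>fst ` W. x = p + T u)" for x
  have \<rho>: "\<exists>p\<in>fst ` W. x = p + T (\<rho> x)" for x
    unfolding \<rho>_def by (rule someI_ex) (use sum in blast)
  have \<rho>I: "\<rho> x = u" if "x = p + T u" "p \<in> fst ` W" for x p u
  proof -
    obtain p' where "p' \<in> fst ` W" "x = p' + T (\<rho> x)" using \<rho>[of x] by blast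
    then show ?thesis using decomp[of p' "\<rho> x" p u] that by simp
  qed
  have lin: "linear \<rho>"
  proof (rule linearI)
    fix x y r
    obtain p p' where p: "p \<in> fst ` W" "x = p + T (\<rho> x)" "p' \<in> fst ` W" "y = p' + T (\<rho> y)" using \<rho> by blast
    have "x + y = (p + T (\<rho> x)) + (p' + T (\<rho> y))" using p(2,4) by (rule arg_cong2)
    also have "\<dots> = (p + p') + T (\<rho> x + \<rho> y)" by (simp add: blinfun.add_right)
    finally show "\<rho> (x + y) = \<rho> x + \<rho> y" by (rule \<rho>I) (rule inW(1)[OF p(1,3)])
    have "r *\<^sub>R x = r *\<^sub>R (p + T (\<rho> x))" using p(2) by (rule arg_cong)
    also have "\<dots> = r *\<^sub>R p + T (r *\<^sub>R \<rho> x)" by (simp add: blinfun.scaleR_right scaleR_add_right)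
    finally show "\<rho> (r *\<^sub>R x) = r *\<^sub>R \<rho> x" by (rule \<rho>I) (rule inW(2)[OF p(1,1)])
  qed
  \<comment> \<open>Such a \<beta> annihilates pr_1 \<open>W\<close>, so \<open>(0, \<beta>)\<close>
    is orthogonal to \<open>W\<close> and to itself.\<close>
  have mem: "(0, \<beta>) \<in> W" if "\<And>p. p \<in> fst ` W \<Longrightarrow> blinfun_apply \<beta> p = 0" for \<beta>
    by (rule maximal_isotropic_memI[OF W]) (use that in \<open>auto simp: pairing_def\<close>)
  show "\<exists>u. \<exists>l\<in>W. T u - fst l = v \<and> snd l o\<^sub>L T = \<eta>"
  proof -
    obtain l0 u where l0: "l0 \<in> W" "v = fst l0 + T u" using sum[of v] by blast
    \<comment> \<open>\<open>- l0\<close> already gives the right vector part. Its covector is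
      corrected by \<omega> \<circ> \<rho>, which annihilates pr_1 \<open>W\<close> and restricts to
      \<omega> on T_qQ.\<close>
    define \<omega> where "\<omega> = \<eta> + (snd l0 o\<^sub>L T)"
    have "bounded_linear \<rho>" by (rule linear_imp_bounded_linear[OF fd lin])
    then have \<beta>: "blinfun_apply (Blinfun \<rho>) = \<rho>" by (simp add: bounded_linear_Blinfun_apply)
    have z: "0 \<in> fst ` W" using subspace_0[OF S] by force
    have "(0, \<omega> o\<^sub>L Blinfun \<rho>) \<in> W"
    proof (rule mem)
      fix p assume "p \<in> fst ` W"
      then have "\<rho> p = 0" by (intro \<rho>I[of p p 0]) simp_all
      then show "blinfun_apply (\<omega> o\<^sub>L Blinfun \<rho>) p = 0" by (simp add: \<beta>)
    qed
    then have l: "(0, \<omega> o\<^sub>L Blinfun \<rho>) - l0 \<in> W" using subspace_diff[OF S] l0(1) by blast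
    have "snd ((0, \<omega> o\<^sub>L Blinfun \<rho>) - l0) o\<^sub>L T = \<eta>"
    proof (rule blinfun_eqI)
      fix w
      have "\<rho> (T w) = w" by (rule \<rho>I[OF _ z]) simp
      then show "(snd ((0, \<omega> o\<^sub>L Blinfun \<rho>) - l0) o\<^sub>L T) w = \<eta> w"
        by (simp add: \<beta> blinfun.diff_left \<omega>_def blinfun.add_left)
    qed
    moreover have "T u - fst ((0, \<omega> o\<^sub>L Blinfun \<rho>) - l0) = v" using l0(2) by simp
    ultimately show ?thesis using l by blast
  qed
  fix u l assume l: "l \<in> W" "T u = fst l" "snd l o\<^sub>L T = 0"
  have "T u \<in> fst ` W \<inter> range (blinfun_apply T)" using l(1) unfolding l(2) by (metis IntI imageI l(2) rangeI)
  then have "T u = 0" using int by auto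
  then have "fst l = 0" using l(2) by simp
  \<comment> \<open>On pr_1 \<open>W\<close> the covector vanishes by isotropy, since
    \<open>fst l = 0\<close>; on T_qQ it vanishes by hypothesis. The two spaces span.\<close>
  have "snd l x = 0" for x
  proof -
    obtain p w where pw: "p \<in> W" "x = fst p + T w" using sum[of x] by blast
    have "snd l (fst p) = 0" using iso[OF l(1) pw(1)] \<open>fst l = 0\<close> by (simp add: pairing_def)
    moreover have "snd l (T w) = 0" using arg_cong[OF l(3), of "\<lambda>A. blinfun_apply A w"] by simp
    ultimately show ?thesis by (simp add: pw(2) blinfun.add_right)
  qed
  then have "l = 0" using \<open>fst l = 0\<close> by (intro prod_eqI) (auto intro: blinfun_eqI)
  then show "u = 0 \<and> l = 0" using T0 \<open>T u = 0\<close> by blast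
qed

text \<open>\<open>transversal_fibre\<close> gives invertibility at \<open>m\<^sub>0\<close>, and
  \<open>smooth_coordinates\<close> spreads it, with smooth inverse, to a neighbourhood. The frame
  of \<open>L\<close> is pulled back along the inclusion, so the neighbourhood is open in the
  topology of \<open>Q\<close>.\<close>

lemma exists_induced_lift:
  fixes M :: "('a, 'm::real_inner) mfd" and Q :: "('a, 'q::real_inner) mfd"
  assumes QM: "submfd Q M" and L: "dirac_structure M L" and m\<^sub>0: "m\<^sub>0 \<in> topspace (mtop Q)"
    and inj: "inj (tmap Q M id m\<^sub>0)"
    and sum: "\<And>x. \<exists>p\<in>fst ` L m\<^sub>0. \<exists>u. x = p + tmap Q M id m\<^sub>0 u"
    and int: "fst ` L m\<^sub>0 \<inter> range (tmap Q M id m\<^sub>0) = {0}"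
  obtains c d V k \<sigma> R \<kappa> where "induced_lift M L Q c d V k \<sigma> R \<kappa>" "m\<^sub>0 \<in> V"
proof -
  note Q = submfdD(1)[OF QM] and M = submfdD(2)[OF QM]
  note fdQ = smooth_manifoldD(1)[OF Q] and fdM = smooth_manifoldD(1)[OF M]
  have m\<^sub>0M: "m\<^sub>0 \<in> topspace (mtop M)" using m\<^sub>0 submfdD(3)[OF QM] by blast
  define c where "c = chart_at Q m\<^sub>0"
  define d where "d = chart_at M m\<^sub>0"
  note c = chart_at[OF Q m\<^sub>0, folded c_def] and d = chart_at[OF M m\<^sub>0M, folded d_def]
  obtain W k \<sigma> where W: "openin (mtop M) W" "m\<^sub>0 \<in> W" and \<sigma>: "\<And>i. i < k \<Longrightarrow> \<sigma> i \<in> sections M (topspace (mtop M)) L"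
    and frame: "\<And>q l. q \<in> W \<Longrightarrow> l \<in> L q \<Longrightarrow> \<exists>a. l = (\<Sum>i<k::nat. a i *\<^sub>R \<sigma> i q)"
    and indep: "\<And>q a i. q \<in> W \<Longrightarrow> (\<Sum>i<k. a i *\<^sub>R \<sigma> i q) = 0 \<Longrightarrow> i < k \<Longrightarrow> a i = 0"
    using global_frame[OF M L m\<^sub>0M] by blast
  define V0 where "V0 = fst c \<inter> (topspace (mtop Q) \<inter> (fst d \<inter> W))"
  have V0: "openin (mtop Q) V0" "m\<^sub>0 \<in> V0"
    unfolding V0_def using c(2) d(2) m\<^sub>0 W(2)
    by (auto intro!: openin_Int[OF chart_domain(1)[OF Q c(1)]] submfd_openin[OF QM]
        openin_Int[OF chart_domain(1)[OF M d(1)] W(1)])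
  define S where "S = snd c ` V0"
  define y\<^sub>0 where "y\<^sub>0 = snd c m\<^sub>0"
  have "snd c ` (fst c \<inter> V0) = S" by (auto simp: S_def V0_def)
  then have S: "open S" "y\<^sub>0 \<in> S" using open_chart_image[OF Q c(1) V0(1)] V0(2) by (auto simp: S_def y\<^sub>0_def)
  define X where "X i y = vrep M d (fst \<circ> \<sigma> i) (transition c d y)" for i y
  define \<alpha> where "\<alpha> i y = covrep M d (snd \<circ> \<sigma> i) (transition c d y)" for i y
  have X: "X i (snd c q) = fst (tcoord M d q (\<sigma> i q))" and \<alpha>: "\<alpha> i (snd c q) = snd (tcoord M d q (\<sigma> i q))"
    if "q \<in> V0" for i q
    using that by (simp_all add: X_def \<alpha>_def V0_def transition_chart[OF Q c(1)] vrep_covrep_chart[OF M d(1)])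
  have \<phi>: "smooth_on S (transition c d)"
    by (rule smooth_on_subset[OF smooth_on_transition(2)[OF QM c(1) d(1)]]) (auto simp: S_def V0_def)
  have \<phi>S: "transition c d ` S \<subseteq> snd d ` (fst d \<inter> topspace (mtop M))"
    using chart_domain(2)[OF M d(1)] by (auto simp: S_def V0_def transition_chart[OF Q c(1)])
  have oM: "open (snd d ` (fst d \<inter> topspace (mtop M)))" by (rule open_chart_image[OF M d(1) openin_topspace])
  have sX: "smooth_on S (X i)" and s\<alpha>: "smooth_on S (\<alpha> i)" if "i < k" for i
    unfolding X_def \<alpha>_def using \<sigma>[OF that] d(1) unfolding sections_def smooth_section_def
    by (auto intro!: smooth_on_compose[OF fdM S(1) oM \<phi>S \<phi>])
  \<comment> \<open>The columns of the isomorphism: images of the basis vectors of T_qQ under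
    \<open>Inl\<close>, of the frame of \<open>L\<close> under \<open>Inr\<close>.\<close>
  define w where "w j y = (case j of Inl b \<Rightarrow> (fderiv (transition c d) y b, 0) | Inr i \<Rightarrow> (- X i y, \<alpha> i y o\<^sub>L fderiv (transition c d) y))"
    for j :: "'q + nat" and y
  define J where "J = (onb :: 'q set) <+> {..<k}"
  have J: "finite J" unfolding J_def using finite_onb[OF fdQ] by simp
  have sw: "smooth_on S (w j)" if "j \<in> J" for j
  proof (cases j)
    case (Inl b)
    then show ?thesis unfolding w_def
      by (simp, intro smooth_on_Pair S(1) smooth_on_const smooth_on_blinfun_apply smooth_on_fderiv[OF fdQ S(1) \<phi>])
  next
    case (Inr i)
    then have "i < k" using that by (auto simp: J_def)
    then show ?thesis unfolding w_def Inr
      by (simp, intro smooth_on_Pair S(1) smooth_on_minus smooth_on_blinfun_compose sX s\<alpha> smooth_on_fderiv[OF fdQ S(1) \<phi>])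
  qed
  have wsum: "(\<Sum>j\<in>J. A j *\<^sub>R w j (snd c q)) =
      (jac c d q (\<Sum>b\<in>onb. A (Inl b) *\<^sub>R b) - (\<Sum>i<k. A (Inr i) *\<^sub>R fst (tcoord M d q (\<sigma> i q))),
       \<Sum>i<k. A (Inr i) *\<^sub>R (snd (tcoord M d q (\<sigma> i q)) o\<^sub>L jac c d q))" if q: "q \<in> V0" for A q
    unfolding J_def sum.Plus[OF finite_onb[OF fdQ] finite_lessThan]
    by (simp add: w_def X[OF q] \<alpha>[OF q] prod_eq_iff fst_sum snd_sum jac_def blinfun.sum_right blinfun.scaleR_right
        sum_negf)
  define T where "T = jac c d m\<^sub>0"
  have T: "tmap Q M id m\<^sub>0 = blinfun_apply T"
    unfolding T_def c_def d_def by (rule tmap_eq_jac[OF QM m\<^sub>0])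
  have td: "tcoord M d m\<^sub>0 p = p" for p unfolding d_def by (rule tcoord_chart_at[OF M m\<^sub>0M])
  have Lm: "maximal_isotropic (L m\<^sub>0)" using L m\<^sub>0M unfolding dirac_structure_on_def by blast
  note fibre = transversal_fibre[OF fdM Lm inj[unfolded T] sum[unfolded T] int[unfolded T]]
  have w0: "(\<Sum>j\<in>J. A j *\<^sub>R w j y\<^sub>0) = (T (\<Sum>b\<in>onb. A (Inl b) *\<^sub>R b) - fst (\<Sum>i<k. A (Inr i) *\<^sub>R \<sigma> i m\<^sub>0),
      snd (\<Sum>i<k. A (Inr i) *\<^sub>R \<sigma> i m\<^sub>0) o\<^sub>L T)" for A
    unfolding y\<^sub>0_def wsum[OF V0(2)] td T_def[symmetric]
    by (auto simp: fst_sum snd_sum blinfun.sum_left blinfun.scaleR_left intro!: blinfun_eqI)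
  have span: "\<exists>A. (\<Sum>j\<in>J. A j *\<^sub>R w j y\<^sub>0) = e" for e
  proof -
    obtain u l where ul: "l \<in> L m\<^sub>0" "T u - fst l = fst e" "snd l o\<^sub>L T = snd e" using fibre(1) by blast
    obtain a where a: "l = (\<Sum>i<k. a i *\<^sub>R \<sigma> i m\<^sub>0)" using frame[OF W(2) ul(1)] by blast
    show ?thesis
      using ul(2,3) onb_expand[OF fdQ, of u, symmetric]
      by (intro exI[of _ "case_sum (\<lambda>b. u \<bullet> b) a"]) (simp add: w0 a[symmetric])
  qed
  have ind: "A j = 0" if A: "(\<Sum>j\<in>J. A j *\<^sub>R w j y\<^sub>0) = 0" and j: "j \<in> J" for A j
  proof -
    define u where "u = (\<Sum>b\<in>onb. A (Inl b) *\<^sub>R b)"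
    define l where "l = (\<Sum>i<k. A (Inr i) *\<^sub>R \<sigma> i m\<^sub>0)"
    have "l \<in> L m\<^sub>0" unfolding l_def
      using \<sigma> m\<^sub>0M maximal_isotropicD(1)[OF Lm] unfolding sections_def
      by (intro subspace_sum subspace_scale) auto
    moreover have "T u = fst l" "snd l o\<^sub>L T = 0"
      using A unfolding w0 u_def[symmetric] l_def[symmetric] by (simp_all add: prod_eq_iff)
    ultimately have ul: "u = 0" "l = 0" using fibre(2) by blast+
    show ?thesis
    proof (cases j)
      case (Inl b)
      then have b: "b \<in> onb" using j by (auto simp: J_def)
      have "u \<bullet> b = (\<Sum>b'\<in>onb. if b' = b then A (Inl b) else 0)"
        unfolding u_def inner_sum_left by (rule sum.cong) (use onb_inner[OF fdQ _ b] in auto)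
      then show ?thesis using ul(1) b finite_onb[OF fdQ] Inl by simp
    next
      case (Inr i)
      then show ?thesis using indep[OF W(2), of "\<lambda>i. A (Inr i)" i] ul(2) j by (auto simp: l_def J_def)
    qed
  qed
  obtain C :: "'q + nat \<Rightarrow> ('m \<times> ('q \<Rightarrow>\<^sub>L real)) \<Rightarrow>\<^sub>L real" where
    C: "\<And>e. (\<Sum>j\<in>J. C j e *\<^sub>R w j y\<^sub>0) = e" "\<And>a i. i \<in> J \<Longrightarrow> C i (\<Sum>j\<in>J. a j *\<^sub>R w j y\<^sub>0) = a i"
  proof (rule dual_coordinates[of J "\<lambda>j. w j y\<^sub>0", OF J bounded_linear_on_cotangent_sum[OF fdM fdQ]])
    show "A j = 0" if "(\<Sum>j\<in>J. A j *\<^sub>R w j y\<^sub>0) = 0" "j \<in> J" for A j by (rule ind[OF that])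
  qed (assumption, rule span, rule that)
  obtain V1 K where V1: "open V1" "y\<^sub>0 \<in> V1" "V1 \<subseteq> S" and sK: "\<And>j. smooth_on V1 (K j)"
    and K: "\<And>y e. y \<in> V1 \<Longrightarrow> (\<Sum>j\<in>J. blinfun_apply (K j y) e *\<^sub>R w j y) = e"
      "\<And>y a i. y \<in> V1 \<Longrightarrow> i \<in> J \<Longrightarrow> blinfun_apply (K i y) (\<Sum>j\<in>J. a j *\<^sub>R w j y) = a i"
    by (rule smooth_coordinates[where w = w and c = C, OF J S]) (erule sw, rule C(1), erule C(2), rule that)
  define V where "V = V0 \<inter> {q \<in> fst c. snd c q \<in> V1}"
  have V: "openin (mtop Q) V" unfolding V_def
    by (rule openin_Int[OF V0(1) openin_chart_preimage[OF Q c(1) V1(1)]])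
  have VV1: "snd c ` V \<subseteq> V1" and VV0: "V \<subseteq> V0" unfolding V_def by auto
  have oV: "open (snd c ` V)"
    using open_chart_image[OF Q c(1) V] VV0 by (simp add: V0_def Int_absorb1 le_infI1)
  \<comment> \<open>The coordinates of \<open>(0, \<eta>)\<close> are read off through
    \<open>E\<close>: those under \<open>Inl\<close> assemble to \<open>R\<close>, those under
    \<open>Inr\<close> are the \<open>\<kappa> i\<close>.\<close>
  define E where "E = (Blinfun (\<lambda>\<eta>. (0, \<eta>)) :: ('q \<Rightarrow>\<^sub>L real) \<Rightarrow>\<^sub>L ('m \<times> ('q \<Rightarrow>\<^sub>L real)))"
  have "bounded_linear (\<lambda>\<eta>::'q \<Rightarrow>\<^sub>L real. (0::'m, \<eta>))"
    by (intro bounded_linear_Pair bounded_linear_ident bounded_linear_zero)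
  then have E: "blinfun_apply E \<eta> = (0, \<eta>)" for \<eta> by (simp add: E_def bounded_linear_Blinfun_apply)
  define R where "R y = (\<Sum>b\<in>onb. blinfun_scaleR_left b o\<^sub>L (K (Inl b) y o\<^sub>L E))" for y
  define \<kappa> where "\<kappa> i y = K (Inr i) y o\<^sub>L E" for i y
  have R: "R y \<eta> = (\<Sum>b\<in>onb. K (Inl b) y (0, \<eta>) *\<^sub>R b)" for y \<eta>
    by (simp add: R_def blinfun.sum_left E)
  have \<kappa>: "\<kappa> i y \<eta> = K (Inr i) y (0, \<eta>)" for i y \<eta> by (simp add: \<kappa>_def E)
  have "induced_lift M L Q c d V k \<sigma> R \<kappa>"
  proof
    show "V \<subseteq> fst c" "V \<subseteq> fst d" using VV0 by (auto simp: V0_def)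
    show "\<exists>a. l = (\<Sum>i<k. a i *\<^sub>R \<sigma> i q)" if "q \<in> V" "l \<in> L q" for q l
      by (rule frame[OF _ that(2)]) (use that(1) VV0 in \<open>auto simp: V0_def\<close>)
    note sK' = smooth_on_subset[OF sK VV1]
    show "smooth_on (snd c ` V) R" unfolding R_def
      by (intro smooth_on_sum smooth_on_blinfun_compose smooth_on_const oV sK')
    show "smooth_on (snd c ` V) (\<kappa> i)" for i unfolding \<kappa>_def
      by (intro smooth_on_blinfun_compose smooth_on_const oV sK')
    fix q assume q: "q \<in> V"
    then have q0: "q \<in> V0" and q1: "snd c q \<in> V1" using VV0 VV1 by auto
    show "jac c d q (R (snd c q) \<eta>) = (\<Sum>i<k. \<kappa> i (snd c q) \<eta> *\<^sub>R fst (tcoord M d q (\<sigma> i q)))"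
      "(\<Sum>i<k. \<kappa> i (snd c q) \<eta> *\<^sub>R (snd (tcoord M d q (\<sigma> i q)) o\<^sub>L jac c d q)) = \<eta>" for \<eta>
      using K(1)[OF q1, of "(0, \<eta>)"] unfolding wsum[OF q0] R[symmetric] \<kappa>[symmetric]
      by (simp_all add: prod_eq_iff)
    fix u a assume u: "jac c d q u = (\<Sum>i<k. a i *\<^sub>R fst (tcoord M d q (\<sigma> i q)))"
    define \<eta> where "\<eta> = (\<Sum>i<k. a i *\<^sub>R (snd (tcoord M d q (\<sigma> i q)) o\<^sub>L jac c d q))"
    \<comment> \<open>By hypothesis \<open>u\<close> and \<open>a\<close> together are coordinates
      of \<open>(0, \<eta>)\<close>; as coordinates are unique, \<open>u\<close> must be the vector
      that \<open>R\<close> assigns to \<eta>.\<close>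
    define A where "A = case_sum (\<lambda>b. u \<bullet> b) a"
    have "(\<Sum>j\<in>J. A j *\<^sub>R w j (snd c q)) = (0, \<eta>)"
      unfolding wsum[OF q0] using u onb_expand[OF fdQ, of u, symmetric] by (simp add: A_def \<eta>_def)
    then have "K (Inl b) (snd c q) (0, \<eta>) = u \<bullet> b" if "b \<in> onb" for b
      using K(2)[OF q1, of "Inl b" A] that by (simp add: J_def A_def InlI)
    then have "R (snd c q) \<eta> = (\<Sum>b\<in>onb. (u \<bullet> b) *\<^sub>R b)" unfolding R by (intro sum.cong) simp_all
    then show "u = R (snd c q) (\<Sum>i<k. a i *\<^sub>R (snd (tcoord M d q (\<sigma> i q)) o\<^sub>L jac c d q))"
      using onb_expand[OF fdQ, of u] by (simp add: \<eta>_def)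
  qed (use QM L c d V \<sigma> in auto)
  moreover have "m\<^sub>0 \<in> V" using V0(2) c(2) V1(2) by (simp add: V_def y\<^sub>0_def)
  ultimately show ?thesis by (rule that)
qed

theorem theorem4p3:
  fixes M :: "('a, 'm::real_inner) mfd"
    and L :: "'a \<Rightarrow> ('m \<times> ('m \<Rightarrow>\<^sub>L real)) set"
    and P :: "('a, 'p::real_inner) mfd"
    and Q :: "('a, 'q::real_inner) mfd"
    and m\<^sub>0 :: 'a
  assumes "smooth_manifold M"
    and "dirac_structure M L"
    and "presymplectic_leaf M L P"
    and "m\<^sub>0 \<in> topspace (mtop P)"
    and "immersed_submanifold M Q"
    and "m\<^sub>0 \<in> topspace (mtop Q)"
    and "transversal_at M P Q m\<^sub>0"
  shows "\<exists>V \<pi>. openin (mtop Q) V \<and> m\<^sub>0 \<in> V \<and>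
    dirac_structure_on Q V (induced_structure M L Q) \<and>
    poisson_structure_on Q V \<pi> \<and>
    (\<forall>q\<in>V. induced_structure M L Q q = bivector_graph (\<pi> q)) \<and>
    (\<forall>\<alpha> \<beta>. \<pi> m\<^sub>0 \<alpha> \<beta> = 0)"
proof -
  have QM: "submfd Q M" using assms(1,5) unfolding submfd_def immersed_submanifold_def by blast
  \<comment> \<open>The tangent space of the leaf is pr_1 \<open>L\<close>, which turns
    transversality into a condition on \<open>L\<close> and \<open>Q\<close> at
    \<open>m\<^sub>0\<close>.\<close>
  have D: "range (tmap P M id m\<^sub>0) = fst ` L m\<^sub>0"
    using assms(3,4) unfolding presymplectic_leaf_def integral_manifold_def characteristic_distribution_def by blast
  have inj: "inj (tmap Q M id m\<^sub>0)" using assms(5,6) unfolding immersed_submanifold_def by blast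
  have int: "fst ` L m\<^sub>0 \<inter> range (tmap Q M id m\<^sub>0) = {0}"
    using assms(7) unfolding transversal_at_def D by blast
  have sum: "\<exists>p\<in>fst ` L m\<^sub>0. \<exists>u. x = p + tmap Q M id m\<^sub>0 u" for x
  proof -
    have "x \<in> {u + v |u v. u \<in> fst ` L m\<^sub>0 \<and> v \<in> range (tmap Q M id m\<^sub>0)}"
      using assms(7) unfolding transversal_at_def D by simp
    then show ?thesis by blast
  qed
  obtain c d V k \<sigma> R \<kappa> where il: "induced_lift M L Q c d V k \<sigma> R \<kappa>" and m\<^sub>0: "m\<^sub>0 \<in> V"
    using exists_induced_lift[OF QM assms(2,6) inj sum int] by blast
  interpret induced_lift M L Q c d V k \<sigma> R \<kappa> by (rule il)
  have "graph_bivector (LQ m\<^sub>0) \<alpha> \<beta> = 0" for \<alpha> \<beta>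
  proof -
    have "(graph_vector (LQ m\<^sub>0) \<alpha>, \<alpha>) \<in> LQ m\<^sub>0" by (rule graph_vector_in[OF LQ_graph[OF m\<^sub>0]])
    then obtain \<xi> where "(tmap Q M id m\<^sub>0 (graph_vector (LQ m\<^sub>0) \<alpha>), \<xi>) \<in> L m\<^sub>0"
      unfolding induced_structure_def by blast
    then have "tmap Q M id m\<^sub>0 (graph_vector (LQ m\<^sub>0) \<alpha>) = 0" using int by force
    moreover have "tmap Q M id m\<^sub>0 0 = 0"
      using tmap_eq_jac[OF QM assms(6)] by simp
    ultimately have "graph_vector (LQ m\<^sub>0) \<alpha> = 0" using injD[OF inj] by metis
    then show ?thesis by (simp add: graph_bivector_def)
  qed
  moreover have "LQ q = bivector_graph (\<pi> q)" if "q \<in> V" for q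
    using bivector_graph_graph_bivector[OF LQ_graph[OF that]] by simp
  ultimately show ?thesis
    using V m\<^sub>0 LQ_dirac poisson by (intro exI[of _ V] exI[of _ \<pi>]) blast
qed

end
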